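(* Let $(\mathbf Z_n,\mathbf A_{n\times n})$ be generated from the stochastic block model with parameters $(\pi,\rho_nS)$, with $\rho_n\to0$, and suppose either $\rho_n\gg\log n/n$, or $\rho_n=\log n/n$ and $C(\pi,S)\ge1+k^2$. Then \[ \mathbb P\bigl(m(\hat{\mathbf z}_n^{\mathrm{ICL}},\mathbf Z_n)=0\bigr)\to1\quad\text{as }n\to\infty. \]
   Context: SBM with parameters $(\pi,\rho_nS)$: $k\ge2$ fixed; $\pi$ a probability vector on $[k]$ with all $\pi_a>0$; $S$ a fixed symmetric $k\times k$ matrix with strictly positive entries and no two identical columns; $\rho_n>0$. $\mathbf Z_n=(Z_1,\dots,Z_n)$ i.i.d. with law $\pi$; given $\mathbf Z_n=\mathbf z_n$, $\mathbf A_{n\times n}$ is symmetric with zero diagonal and $A_{ij}$, $i<j$, independent Bernoulli$(\rho_nS_{z_iz_j})$. For $\mathbf e_n\in[k]^n$: $n_a(\mathbf e_n)=\#\{i:e_i=a\}$; $n_{ab}=n_an_b$ ($a\ne b$), $n_{aa}=n_a(n_a-1)$; $o_{ab}(\mathbf e_n)=\sum_{i,j}\mathbf 1\{e_i=a,e_j=b\}A_{ij}$; $\tilde o_{aa}=o_{aa}/2$, $\tilde n_{aa}=n_{aa}/2$, $\tilde o_{ab}=o_{ab}$, $\tilde n_{ab}=n_{ab}$ for $a\ne b$; $Q_{\mathrm{ICL}}(\mathbf e_n)=\frac1{n^2}\sum_{a\le b}\log\frac{B(\tilde o_{ab}+1/2,\tilde n_{ab}-\tilde o_{ab}+1/2)}{B(1/2,1/2)}$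 ($B$ the beta function). Standing assumption: a fixed $\alpha$ with $0<\alpha<\min_a\pi_a$; $\mathcal F(n,\alpha)=\{\mathbf e_n:n_a(\mathbf e_n)\ge\alpha n\ \forall a\}$; $\hat{\mathbf z}_n^{\mathrm{ICL}}$ is a maximizer of $Q_{\mathrm{ICL}}$ over $\mathcal F(n,\alpha)$. $m(\hat{\mathbf z}_n,\mathbf Z_n)=\min_\sigma\sum_i\mathbf 1\{\hat z_i\ne\sigma(Z_i)\}$ over permutations $\sigma$ of $[k]$. $C(\pi,S)=\min_{b\ne b'}\max_{t\in[0,1]}\sum_a\pi_aH_t(S_{ab}\|S_{ab'})$ with $H_t(p\|q)=(1-t)p+tq-p^{1-t}q^t$. "$\rho_n\gg\log n/n$" means $n\rho_n/\log n\to\infty$. *)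

theory Defs
  imports "HOL-Analysis.Analysis" "HOL-Probability.Probability"
begin

definition labelings :: "nat \<Rightarrow> nat \<Rightarrow> (nat \<Rightarrow> nat) set" where
  "labelings k n = {e. (\<forall>i<n. e i < k) \<and> (\<forall>i. n \<le> i \<longrightarrow> e i = 0)}"

definition label_pmf :: "nat \<Rightarrow> (nat \<Rightarrow> real) \<Rightarrow> nat pmf" where
  "label_pmf k \<pi> = embed_pmf (\<lambda>a. if a < k then \<pi> a else 0)"

definition sbm :: "nat \<Rightarrow> (nat \<Rightarrow> real) \<Rightarrow> (nat \<Rightarrow> nat \<Rightarrow> real) \<Rightarrow> real \<Rightarrow> nat
    \<Rightarrow> ((nat \<Rightarrow> nat) \<times> (nat \<Rightarrow> nat \<Rightarrow> bool)) pmf" where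
  "sbm k \<pi> S \<rho> n =
     do {
       z \<leftarrow> Pi_pmf {..<n} 0 (\<lambda>_. label_pmf k \<pi>);
       E \<leftarrow> Pi_pmf {(i, j). i < j \<and> j < n} False
              (\<lambda>(i, j). bernoulli_pmf (\<rho> * S (z i) (z j)));
       return_pmf (z, (\<lambda>i j. if i < j then E (i, j) else if j < i then E (j, i) else False))
     }"

definition n_cnt :: "nat \<Rightarrow> (nat \<Rightarrow> nat) \<Rightarrow> nat \<Rightarrow> nat" where
  "n_cnt n e a = card {i. i < n \<and> e i = a}"

definition n_pair :: "nat \<Rightarrow> (nat \<Rightarrow> nat) \<Rightarrow> nat \<Rightarrow> nat \<Rightarrow> real" where
  "n_pair n e a b = (if a \<noteq> b then real (n_cnt n e a) * real (n_cnt n e b)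
                     else real (n_cnt n e a) * (real (n_cnt n e a) - 1))"

definition o_pair :: "nat \<Rightarrow> (nat \<Rightarrow> nat \<Rightarrow> bool) \<Rightarrow> (nat \<Rightarrow> nat) \<Rightarrow> nat \<Rightarrow> nat \<Rightarrow> real" where
  "o_pair n A e a b = (\<Sum>i<n. \<Sum>j<n. if e i = a \<and> e j = b \<and> A i j then 1 else 0)"

definition n_tilde :: "nat \<Rightarrow> (nat \<Rightarrow> nat) \<Rightarrow> nat \<Rightarrow> nat \<Rightarrow> real" where
  "n_tilde n e a b = (if a = b then n_pair n e a b / 2 else n_pair n e a b)"

definition o_tilde :: "nat \<Rightarrow> (nat \<Rightarrow> nat \<Rightarrow> bool) \<Rightarrow> (nat \<Rightarrow> nat) \<Rightarrow> nat \<Rightarrow> nat \<Rightarrow> real" where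
  "o_tilde n A e a b = (if a = b then o_pair n A e a b / 2 else o_pair n A e a b)"

definition Q_ICL :: "nat \<Rightarrow> nat \<Rightarrow> (nat \<Rightarrow> nat \<Rightarrow> bool) \<Rightarrow> (nat \<Rightarrow> nat) \<Rightarrow> real" where
  "Q_ICL k n A e = (1 / (real n)\<^sup>2) *
     (\<Sum>(a, b) \<in> {(a, b). a \<le> b \<and> b < k}.
        ln (Beta (o_tilde n A e a b + 1/2) (n_tilde n e a b - o_tilde n A e a b + 1/2)
            / Beta (1/2) (1/2 :: real)))"

definition F_set :: "nat \<Rightarrow> nat \<Rightarrow> real \<Rightarrow> (nat \<Rightarrow> nat) set" where
  "F_set k n \<alpha> = {e \<in> labelings k n. \<forall>a<k. real (n_cnt n e a) \<ge> \<alpha> * real n}"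

definition mismatch :: "nat \<Rightarrow> nat \<Rightarrow> (nat \<Rightarrow> nat) \<Rightarrow> (nat \<Rightarrow> nat) \<Rightarrow> nat" where
  "mismatch k n zhat z =
     Min ((\<lambda>\<sigma>. card {i. i < n \<and> zhat i \<noteq> \<sigma> (z i)}) ` {\<sigma>. \<sigma> permutes {..<k}})"

definition H_div :: "real \<Rightarrow> real \<Rightarrow> real \<Rightarrow> real" where
  "H_div t p q = (1 - t) * p + t * q - p powr (1 - t) * q powr t"

definition C_const :: "nat \<Rightarrow> (nat \<Rightarrow> real) \<Rightarrow> (nat \<Rightarrow> nat \<Rightarrow> real) \<Rightarrow> real" where
  "C_const k \<pi> S =
     Min ((\<lambda>(b, b'). SUP t\<in>{0..1}. \<Sum>a<k. \<pi> a * H_div t (S a b) (S a b'))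
          ` {(b, b'). b < k \<and> b' < k \<and> b \<noteq> b'})"

end

theory Submission
  imports Defs "HOL-Real_Asymp.Real_Asymp"
begin

text \<open>Up to the factor \<open>1/n\<^sup>2\<close>, the ICL criterion is the logarithm of a likelihood that is
  integrated against the Jeffreys prior blockwise. This integrated likelihood is at most the maximised
  likelihood, and at least \<open>(e n)\<close> to the power \<open>- k (k + 1) / 2\<close> times the likelihood under any parameter.
  Hence, given the true labels \<open>z\<close>, a labeling \<open>e\<close> beats \<open>z\<close> only if its maximised likelihood
  exceeds the true likelihood up to a polynomial factor, and Markov's inequality for the square root of
  the likelihood ratio bounds the probability of this event by the Hellinger affinity of two product
  Bernoulli laws.

  If \<open>e\<close> differs from every permutation of \<open>z\<close> in at least \<open>\<epsilon> n\<close> nodes, the affinity is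
  \<open>exp (- c n\<^sup>2 \<rho>)\<close>, which absorbs a union bound over all labelings and all possible values of the
  maximum likelihood estimate. If \<open>e\<close> differs from \<open>z\<close> in \<open>m \<le> \<epsilon> n\<close> nodes, then on an event of high
  probability (concentrated block counts, degrees of order \<open>n \<rho>\<close>) the maximum likelihood estimate may be
  replaced by the true parameter at the cost of \<open>exp (\<eta> (ln n + m n \<rho>))\<close>, and the affinity is about
  \<open>exp (- m n \<rho> c\<^sub>0)\<close> with \<open>c\<^sub>0\<close> half the minimum over \<open>b \<noteq> b'\<close> of \<open>\<Sum>a. \<pi> a (sqrt (S a b) - sqrt (S a b'))\<^sup>2\<close>.
  Summing over these labelings needs \<open>n \<rho> c\<^sub>0 > (1 + k (k + 1) / 4) ln n\<close>. This holds in both regimes,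
  because concavity of \<open>H\<^sub>t\<close> in \<open>t\<close> gives \<open>c\<^sub>0 > C(\<pi>, S) / 2\<close>, and
  \<open>(1 + k\<^sup>2) / 2 \<ge> 1 + k (k + 1) / 4\<close> for \<open>k \<ge> 2\<close>.\<close>

subsection \<open>The integrated Bernoulli likelihood\<close>

lemma nonneg_of_antimono_tendsto_0:
  fixes f f' :: "real \<Rightarrow> real"
  assumes deriv: "\<And>x. x > 0 \<Longrightarrow> (f has_real_derivative f' x) (at x)"
    and neg: "\<And>x. x > 0 \<Longrightarrow> f' x \<le> 0"
    and lim: "(f \<longlongrightarrow> 0) at_top" and x: "x > 0"
  shows "f x \<ge> 0"
proof (rule tendsto_upperbound[OF lim])
  have "f y \<le> f x" if "y \<ge> x" for y
  proof (rule DERIV_nonpos_imp_nonincreasing[OF that])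
    fix t assume "x \<le> t" "t \<le> y"
    then show "\<exists>D. DERIV f t :> D \<and> D \<le> 0"
      using deriv[of t] neg[of t] x by auto
  qed
  then show "eventually (\<lambda>y. f y \<le> f x) at_top"
    by (auto simp: eventually_at_top_linorder)
qed auto

lemma half_shift_ln_bound:
  fixes x :: real
  assumes x: "x > 0"
  shows "(x + 1) * ln (x + 1) \<le> 1 + ln (x + 1/2) + x * ln x"
proof -
  define f where "f = (\<lambda>x::real. 1 + ln (x + 1/2) + x * ln x - (x + 1) * ln (x + 1))"
  have "f x \<ge> 0"
  proof (rule nonneg_of_antimono_tendsto_0[OF _ _ _ x])
    show "(f has_real_derivative (inverse (x + 1/2) + ln x - ln (x + 1))) (at x)" if "x > 0" for x
    proof -
      have "(f has_real_derivative ((0 + 1 / (x + 1/2) + (1 * ln x + x * (1 / x))) -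
          (1 * ln (x + 1) + (x + 1) * (1 / (x + 1))))) (at x)"
        unfolding f_def using that by (auto intro!: derivative_eq_intros)
      also have "(0 + 1 / (x + 1/2) + (1 * ln x + x * (1 / x))) -
          (1 * ln (x + 1) + (x + 1) * (1 / (x + 1))) = inverse (x + 1/2) + ln x - ln (x + 1)"
        using that by (simp add: inverse_eq_divide)
      finally show ?thesis .
    qed
    show "inverse (x + 1/2) + ln x - ln (x + 1) \<le> 0" if "x > 0" for x :: real
      using ln_inverse_approx_ge[of x "x + 1"] that by (simp add: field_simps)
    show "(f \<longlongrightarrow> 0) at_top"
      unfolding f_def by real_asymp
  qed
  then show ?thesis by (simp add: f_def)
qed

lemma pochhammer_half_ge:
  "real m ^ m * exp (- real m) \<le> pochhammer (1/2 :: real) m"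
proof (induction m)
  case 0
  then show ?case by simp
next
  case (Suc m)
  have step: "real (Suc m) ^ Suc m * exp (- real (Suc m)) \<le> (real m ^ m * exp (- real m)) * (real m + 1/2)"
  proof (cases "m = 0")
    case True
    have "exp (1::real) \<ge> 2" using exp_ge_add_one_self[of 1] by simp
    then show ?thesis using True by (simp add: exp_minus field_simps)
  next
    case False
    have "real (Suc m) ^ Suc m * exp (- real (Suc m)) = exp ((real m + 1) * ln (real m + 1) - real m - 1)"
      using exp_of_nat_mult[of "Suc m" "ln (real m + 1)"]
      by (simp add: exp_diff exp_minus exp_add add.commute field_simps)
    also have "\<dots> \<le> exp (ln (real m + 1/2) + real m * ln (real m) - real m)"
      using half_shift_ln_bound[of "real m"] False by simp
    also have "\<dots> = (real m ^ m * exp (- real m)) * (real m + 1/2)"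
      using False by (simp add: exp_diff exp_minus exp_add exp_of_nat_mult field_simps)
    finally show ?thesis .
  qed
  also have "\<dots> \<le> pochhammer (1/2) m * (real m + 1/2)"
    by (intro mult_right_mono Suc.IH) auto
  finally show ?case by (simp add: pochhammer_Suc algebra_simps)
qed

lemma fact_le_stirling:
  assumes "N > 0"
  shows "fact N \<le> exp 1 * sqrt (real N) * real N ^ N * exp (- real N)"
  using assms
proof (induction N)
  case 0
  then show ?case by simp
next
  case (Suc N)
  show ?case
  proof (cases "N = 0")
    case True
    then show ?thesis by (simp add: exp_minus)
  next
    case False
    then have N: "real N > 0" by simp
    have "2 * (real N + 1 - real N) / (real N + (real N + 1)) \<le> ln (real N + 1) - ln (real N)"
      using ln_inverse_approx_ge[of "real N" "real N + 1"] N by simp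
    then have key: "1 \<le> (real N + 1/2) * (ln (real N + 1) - ln (real N))"
      using N by (simp add: field_simps)
    have st: "exp 1 * sqrt x * x ^ M * exp (- x) = exp (1 + ln x / 2 + M * ln x - x)"
      if "x > 0" for x :: real and M :: nat
      using that by (simp add: exp_add exp_diff exp_of_nat_mult exp_minus field_simps
          flip: ln_sqrt)
    have "fact (Suc N) = (real N + 1) * fact N" by simp
    also have "\<dots> \<le> (real N + 1) * (exp 1 * sqrt (real N) * real N ^ N * exp (- real N))"
      using Suc.IH False by (intro mult_left_mono) auto
    also have "\<dots> = exp (ln (real N + 1)) * exp (1 + ln (real N) / 2 + real N * ln (real N) - real N)"
      using N by (simp add: st)
    also have "\<dots> \<le> exp (1 + ln (real N + 1) / 2 + real (Suc N) * ln (real N + 1) - (real N + 1))"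
      using key unfolding exp_add[symmetric] by (simp add: algebra_simps)
    also have "\<dots> = exp 1 * sqrt (real N + 1) * (real N + 1) ^ Suc N * exp (- (real N + 1))"
      using st[of "real N + 1" "Suc N"] N by simp
    finally show ?thesis by (simp add: add.commute)
  qed
qed

text \<open>The Krichevsky--Trofimov weight: the Bernoulli likelihood integrated against the Jeffreys prior.\<close>

definition kt_weight :: "nat \<Rightarrow> nat \<Rightarrow> real" where
  "kt_weight m l = Beta (real m + 1/2) (real l + 1/2) / Beta (1/2) (1/2)"

lemma Beta_half_pos: "Beta (1/2) (1/2 :: real) > 0"
  by (simp add: Beta_def)

lemma kt_weight_pos: "kt_weight m l > 0"
  using Beta_half_pos by (auto simp: kt_weight_def Beta_def intro!: divide_pos_pos mult_pos_pos Gamma_real_pos)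

lemma kt_weight_pochhammer:
  "kt_weight m l = pochhammer (1/2) m * pochhammer (1/2) l / fact (m + l)"
proof -
  have half: "Gamma (1/2 :: real) > 0" by (rule Gamma_real_pos) simp
  then have half_nz: "Gamma (1/2 :: real) \<noteq> 0" by (rule less_imp_neq[THEN not_sym])
  have notin: "(1/2 :: real) \<notin> \<int>\<^sub>\<le>\<^sub>0"
    using half Gamma_eq_zero_iff[of "1/2 :: real"] by auto
  have G: "Gamma (real m + 1/2) = pochhammer (1/2) m * Gamma (1/2 :: real)" for m
    using pochhammer_Gamma[of "1/2::real" m] half notin
    by (simp add: add.commute field_simps)
  have F: "Gamma (real m + 1/2 + (real l + 1/2)) = fact (m + l)"
    using Gamma_fact[of "m + l", where 'a = real] by (simp add: algebra_simps)
  show ?thesis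
    using half_nz unfolding kt_weight_def Beta_def F G[of m] G[of l] by (simp add: field_simps)
qed

lemma bernoulli_lik_le_mle:
  fixes t :: real
  assumes "0 \<le> t" "t \<le> 1"
  shows "t ^ m * (1 - t) ^ l \<le> (real m / real (m + l)) ^ m * (1 - real m / real (m + l)) ^ l"
proof -
  have aux: "x ^ a \<le> (real a / N) ^ a * exp (N * x - real a)" if "x \<ge> 0" "N > 0" for x N and a :: nat
  proof (cases "a = 0 \<or> x = 0")
    case True
    then show ?thesis using that by (cases "a = 0") (auto simp: zero_power)
  next
    case False
    then have p: "x > 0" "real a > 0" using that by auto
    have "real a * ln (x * N / real a) \<le> real a * (x * N / real a - 1)"
      using p that by (intro mult_left_mono ln_le_minus_one) auto
    also have "\<dots> = N * x - real a" using p by (simp add: field_simps)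
    finally have "exp (real a * ln (x * N / real a)) \<le> exp (N * x - real a)" by simp
    then have "(x * N / real a) ^ a \<le> exp (N * x - real a)"
      using p that by (simp add: exp_of_nat_mult)
    then have "(real a / N) ^ a * (x * N / real a) ^ a \<le> (real a / N) ^ a * exp (N * x - real a)"
      using p that by (intro mult_left_mono) auto
    then show ?thesis
      using p that by (simp flip: power_mult_distrib)
  qed
  show ?thesis
  proof (cases "m + l = 0")
    case False
    define N where "N = real (m + l)"
    have N: "N > 0" unfolding N_def using False by linarith
    have "t ^ m * (1 - t) ^ l \<le> ((real m / N) ^ m * exp (N * t - real m)) * ((real l / N) ^ l * exp (N * (1 - t) - real l))"
      using assms N by (intro mult_mono aux) auto
    also have "\<dots> = (real m / N) ^ m * (real l / N) ^ l * exp (N * t - real m + (N * (1 - t) - real l))"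
      unfolding exp_add by simp
    also have "N * t - real m + (N * (1 - t) - real l) = 0" by (simp add: N_def algebra_simps)
    also have "real l / N = 1 - real m / N" using N by (simp add: N_def divide_simps)
    finally show ?thesis by (simp add: N_def)
  qed auto
qed

lemma kt_weight_le_mle:
  "kt_weight m l \<le> (real m / real (m + l)) ^ m * (1 - real m / real (m + l)) ^ l" (is "_ \<le> ?M")
proof -
  have "Beta (real m + 1/2) (real l + 1/2) \<le> ?M * Beta (1/2) (1/2)"
  proof (rule has_integral_le)
    show "((\<lambda>t. t powr (real m + 1/2 - 1) * (1 - t) powr (real l + 1/2 - 1)) has_integral
        Beta (real m + 1/2) (real l + 1/2)) {0<..<1}"
      using has_integral_Beta_real[of "real m + 1/2" "real l + 1/2"] by (simp add: has_integral_Icc_iff_Ioo)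
    show "((\<lambda>t. ?M * (t powr (1/2 - 1) * (1 - t) powr (1/2 - 1))) has_integral
        ?M * Beta (1/2) (1/2)) {0<..<1}"
      using has_integral_Beta_real[of "1/2" "1/2"]
      by (intro has_integral_mult_right) (simp add: has_integral_Icc_iff_Ioo)
    fix t :: real assume t: "t \<in> {0<..<1}"
    have "t powr (real m + 1/2 - 1) * (1 - t) powr (real l + 1/2 - 1)
      = (t ^ m * (1 - t) ^ l) * (t powr (1/2 - 1) * (1 - t) powr (1/2 - 1))"
      using powr_add[of t "real m" "1/2 - 1"] powr_add[of "1 - t" "real l" "1/2 - 1"] t
      by (simp add: powr_realpow)
    also have "\<dots> \<le> ?M * (t powr (1/2 - 1) * (1 - t) powr (1/2 - 1))"
      using t by (intro mult_right_mono bernoulli_lik_le_mle) auto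
    finally show "t powr (real m + 1/2 - 1) * (1 - t) powr (real l + 1/2 - 1)
        \<le> ?M * (t powr (1/2 - 1) * (1 - t) powr (1/2 - 1))" .
  qed
  then show ?thesis using Beta_half_pos by (simp add: kt_weight_def field_simps)
qed

lemma kt_weight_ge:
  fixes t :: real
  assumes t: "0 \<le> t" "t \<le> 1" and N: "m + l > 0"
  shows "kt_weight m l \<ge> t ^ m * (1 - t) ^ l / (exp 1 * sqrt (real (m + l)))"
proof -
  define N where "N = real (m + l)"
  have Np: "N > 0" unfolding N_def using N by linarith
  have "t ^ m * (1 - t) ^ l \<le> (real m / N) ^ m * (1 - real m / N) ^ l"
    using bernoulli_lik_le_mle[OF t] by (simp add: N_def)
  also have "1 - real m / N = real l / N" using Np by (simp add: N_def field_simps)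
  finally have "t ^ m * (1 - t) ^ l / (exp 1 * sqrt N) \<le> (real m / N) ^ m * (real l / N) ^ l / (exp 1 * sqrt N)"
    using Np by (simp add: divide_right_mono)
  also have "\<dots> = (real m ^ m * exp (- real m)) * (real l ^ l * exp (- real l)) /
      (exp 1 * sqrt N * N ^ (m + l) * exp (- N))"
  proof -
    have "exp (- N) = exp (- real m) * exp (- real l)"
      by (simp add: N_def flip: exp_add)
    then show ?thesis using Np by (simp add: power_divide power_add)
  qed
  also have "\<dots> \<le> pochhammer (1/2) m * pochhammer (1/2) l / fact (m + l)"
  proof (rule frac_le)
    show "fact (m + l) \<le> exp 1 * sqrt N * N ^ (m + l) * exp (- N)"
      using fact_le_stirling[OF N] by (simp add: N_def)
    show "real m ^ m * exp (- real m) * (real l ^ l * exp (- real l)) \<le> pochhammer (1/2) m * pochhammer (1/2) l"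
      by (intro mult_mono pochhammer_half_ge pochhammer_nonneg) auto
  qed (auto intro!: mult_nonneg_nonneg pochhammer_nonneg)
  finally show ?thesis by (simp add: kt_weight_pochhammer N_def)
qed

subsection \<open>Block counts and block likelihoods\<close>

definition node_pairs :: "nat \<Rightarrow> (nat \<times> nat) set" where
  "node_pairs n = {(i, j). i < j \<and> j < n}"

definition blocks :: "nat \<Rightarrow> (nat \<times> nat) set" where
  "blocks k = {(a, b). a \<le> b \<and> b < k}"

definition block_of :: "(nat \<Rightarrow> nat) \<Rightarrow> nat \<times> nat \<Rightarrow> nat \<times> nat" where
  "block_of e p = (min (e (fst p)) (e (snd p)), max (e (fst p)) (e (snd p)))"

definition block_size :: "nat \<Rightarrow> (nat \<Rightarrow> nat) \<Rightarrow> nat \<times> nat \<Rightarrow> nat" where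
  "block_size n e c = card {p \<in> node_pairs n. block_of e p = c}"

definition block_edges :: "nat \<Rightarrow> (nat \<times> nat \<Rightarrow> bool) \<Rightarrow> (nat \<Rightarrow> nat) \<Rightarrow> nat \<times> nat \<Rightarrow> nat" where
  "block_edges n E e c = card {p \<in> node_pairs n. block_of e p = c \<and> E p}"

definition adjacency :: "(nat \<times> nat \<Rightarrow> bool) \<Rightarrow> nat \<Rightarrow> nat \<Rightarrow> bool" where
  "adjacency E = (\<lambda>i j. if i < j then E (i, j) else if j < i then E (j, i) else False)"

definition kt_lik :: "nat \<Rightarrow> nat \<Rightarrow> (nat \<times> nat \<Rightarrow> bool) \<Rightarrow> (nat \<Rightarrow> nat) \<Rightarrow> real" where
  "kt_lik k n E e =
     (\<Prod>c\<in>blocks k. kt_weight (block_edges n E e c) (block_size n e c - block_edges n E e c))"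

definition bern_lik :: "'a set \<Rightarrow> ('a \<Rightarrow> real) \<Rightarrow> ('a \<Rightarrow> bool) \<Rightarrow> real" where
  "bern_lik P r E = (\<Prod>p\<in>P. if E p then r p else 1 - r p)"

lemma finite_node_pairs [simp]: "finite (node_pairs n)"
  by (rule finite_subset[of _ "{..<n} \<times> {..<n}"]) (auto simp: node_pairs_def)

lemma finite_blocks [simp]: "finite (blocks k)"
  by (rule finite_subset[of _ "{..<k} \<times> {..<k}"]) (auto simp: blocks_def)

lemma block_edges_le: "block_edges n E e c \<le> block_size n e c"
  unfolding block_edges_def block_size_def by (intro card_mono) auto

lemma card_node_pairs_le: "card (node_pairs n) \<le> n ^ 2"
proof -
  have "card (node_pairs n) \<le> card ({..<n} \<times> {..<n})"
    by (intro card_mono) (auto simp: node_pairs_def)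
  then show ?thesis by (simp add: power2_eq_square)
qed

lemma block_size_le: "block_size n e c \<le> n ^ 2"
proof -
  have "block_size n e c \<le> card (node_pairs n)"
    unfolding block_size_def by (intro card_mono) auto
  then show ?thesis using card_node_pairs_le[of n] by simp
qed

lemma block_of_in_blocks:
  "(\<And>i. i < n \<Longrightarrow> e i < k) \<Longrightarrow> p \<in> node_pairs n \<Longrightarrow> block_of e p \<in> blocks k"
  by (auto simp: node_pairs_def block_of_def blocks_def)

lemma double_sum_eq_node_pairs:
  fixes f :: "nat \<Rightarrow> nat \<Rightarrow> real"
  assumes "\<And>i. f i i = 0"
  shows "(\<Sum>i<n. \<Sum>j<n. f i j) = (\<Sum>p\<in>node_pairs n. f (fst p) (snd p) + f (snd p) (fst p))"
proof -
  have split: "{..<n} \<times> {..<n} = node_pairs n \<union> (prod.swap ` node_pairs n \<union> (\<lambda>i. (i, i)) ` {..<n})"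
  proof -
    have "p \<in> node_pairs n \<union> (prod.swap ` node_pairs n \<union> (\<lambda>i. (i, i)) ` {..<n})" if pn: "p \<in> {..<n} \<times> {..<n}" for p
    proof -
      obtain i j where p: "p = (i, j)" "i < n" "j < n" using pn by auto
      consider "i < j" | "j < i" | "i = j" by linarith
      then show ?thesis
      proof cases
        case 2
        then have "p = prod.swap (j, i)" "(j, i) \<in> node_pairs n" using p by (auto simp: node_pairs_def)
        then show ?thesis by blast
      qed (use p in \<open>auto simp: node_pairs_def\<close>)
    qed
    then show ?thesis by (auto simp: node_pairs_def)
  qed
  have "(\<Sum>i<n. \<Sum>j<n. f i j) = (\<Sum>(i, j)\<in>{..<n} \<times> {..<n}. f i j)"
    by (simp add: sum.cartesian_product)
  also have "\<dots> = (\<Sum>(i, j)\<in>node_pairs n. f i j) + ((\<Sum>(i, j)\<in>prod.swap ` node_pairs n. f i j)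
      + (\<Sum>(i, j)\<in>(\<lambda>i. (i, i)) ` {..<n}. f i j))"
    unfolding split
    by (subst sum.union_disjoint, simp, simp, force simp: node_pairs_def,
        subst sum.union_disjoint) (simp, simp, force simp: node_pairs_def, simp)
  also have "(\<Sum>(i, j)\<in>(\<lambda>i. (i, i)) ` {..<n}. f i j) = 0"
    by (intro sum.neutral) (auto simp: assms)
  also have "(\<Sum>(i, j)\<in>prod.swap ` node_pairs n. f i j) = (\<Sum>(i, j)\<in>node_pairs n. f j i)"
    by (subst sum.reindex) (auto simp: case_prod_unfold intro!: sum.cong)
  finally show ?thesis
    by (simp add: sum.distrib case_prod_unfold)
qed

lemma sum_labelled_adjacency:
  assumes "a \<le> b"
  shows "(\<Sum>i<n. \<Sum>j<n. if e i = a \<and> e j = b \<and> adjacency E i j then 1 else 0)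
    = (if a = b then 2 else 1) * real (block_edges n E e (a, b))"
proof -
  have "(\<Sum>i<n. \<Sum>j<n. if e i = a \<and> e j = b \<and> adjacency E i j then 1 else (0::real))
    = (\<Sum>p\<in>node_pairs n. (if a = b then 2 else 1) * (if block_of e p = (a, b) \<and> E p then 1 else 0))"
    by (subst double_sum_eq_node_pairs)
      (use assms in \<open>auto simp: adjacency_def node_pairs_def block_of_def min_def max_def intro!: sum.cong\<close>)
  also have "\<dots> = (if a = b then 2 else 1) * (\<Sum>p\<in>node_pairs n. (if block_of e p = (a, b) \<and> E p then 1 else 0))"
    by (simp only: sum_distrib_left)
  also have "(\<Sum>p\<in>node_pairs n. (if block_of e p = (a, b) \<and> E p then 1 else (0::real))) = real (block_edges n E e (a, b))"
    unfolding block_edges_def by (subst sum.If_cases) (auto simp: Int_def)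
  finally show ?thesis .
qed

lemma o_tilde_adjacency:
  "a \<le> b \<Longrightarrow> o_tilde n (adjacency E) e a b = real (block_edges n E e (a, b))"
  by (auto simp: o_tilde_def o_pair_def sum_labelled_adjacency)

lemma n_tilde_eq_block_size:
  assumes "a \<le> b"
  shows "n_tilde n e a b = real (block_size n e (a, b))"
proof -
  have cnt: "(\<Sum>i<n. if e i = a then 1 else (0::real)) = real (n_cnt n e a)" for a
    unfolding n_cnt_def by (subst sum.If_cases) (auto simp: Int_def)
  have "(\<Sum>i<n. \<Sum>j<n. if e i = a \<and> e j = b \<and> adjacency (\<lambda>_. True) i j then 1 else (0::real))
    = (\<Sum>i<n. \<Sum>j<n. (if e i = a then 1 else 0) * (if e j = b then 1 else 0)
        - (if i = j then if e i = a \<and> a = b then 1 else 0 else 0))"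
    by (intro sum.cong) (auto simp: adjacency_def)
  also have "\<dots> = (\<Sum>i<n. \<Sum>j<n. (if e i = a then 1 else 0) * (if e j = b then 1 else 0))
      - (\<Sum>i<n. if e i = a \<and> a = b then 1 else 0)"
    by (simp add: sum_subtractf sum.delta)
  also have "(\<Sum>i<n. \<Sum>j<n. (if e i = a then 1 else 0) * (if e j = b then 1 else (0::real)))
      = real (n_cnt n e a) * real (n_cnt n e b)"
    by (simp only: sum_product[symmetric] cnt)
  also have "(\<Sum>i<n. if e i = a \<and> a = b then 1 else (0::real)) = (if a = b then real (n_cnt n e a) else 0)"
    using cnt[of a] by (cases "a = b") simp_all
  finally have "n_pair n e a b =
      (\<Sum>i<n. \<Sum>j<n. if e i = a \<and> e j = b \<and> adjacency (\<lambda>_. True) i j then 1 else 0)"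
    by (cases "a = b") (simp_all add: n_pair_def algebra_simps)
  then show ?thesis
    unfolding n_tilde_def sum_labelled_adjacency[OF assms] by (auto simp: block_edges_def block_size_def)
qed

lemma kt_lik_pos: "kt_lik k n E e > 0"
  by (simp add: kt_lik_def kt_weight_pos prod_pos)

lemma Q_ICL_adjacency:
  "Q_ICL k n (adjacency E) e = 1 / (real n)\<^sup>2 * ln (kt_lik k n E e)"
proof -
  have "ln (kt_lik k n E e) = (\<Sum>c\<in>blocks k. ln (kt_weight (block_edges n E e c) (block_size n e c - block_edges n E e c)))"
    unfolding kt_lik_def by (rule ln_prod) (auto simp: kt_weight_pos less_imp_neq[THEN not_sym])
  also have "\<dots> = (\<Sum>(a, b) \<in> {(a, b). a \<le> b \<and> b < k}.
        ln (Beta (o_tilde n (adjacency E) e a b + 1/2) (n_tilde n e a b - o_tilde n (adjacency E) e a b + 1/2)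
            / Beta (1/2) (1/2 :: real)))"
    unfolding blocks_def kt_weight_def
    by (intro sum.cong) (auto simp: o_tilde_adjacency n_tilde_eq_block_size of_nat_diff block_edges_le)
  finally show ?thesis by (simp add: Q_ICL_def)
qed

lemma bern_lik_block_of:
  assumes e: "\<And>i. i < n \<Longrightarrow> e i < k"
  shows "bern_lik (node_pairs n) (\<lambda>p. \<theta> (block_of e p)) E =
    (\<Prod>c\<in>blocks k. \<theta> c ^ block_edges n E e c * (1 - \<theta> c) ^ (block_size n e c - block_edges n E e c))"
proof -
  have "bern_lik (node_pairs n) (\<lambda>p. \<theta> (block_of e p)) E =
     (\<Prod>c\<in>blocks k. \<Prod>p\<in>{p \<in> node_pairs n. block_of e p = c}. if E p then \<theta> (block_of e p) else 1 - \<theta> (block_of e p))"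
    unfolding bern_lik_def using block_of_in_blocks[OF e] by (subst prod.group) auto
  also have "\<dots> = (\<Prod>c\<in>blocks k. \<theta> c ^ block_edges n E e c * (1 - \<theta> c) ^ (block_size n e c - block_edges n E e c))"
  proof (rule prod.cong[OF refl])
    fix c
    let ?P = "{p \<in> node_pairs n. block_of e p = c}"
    have "(\<Prod>p\<in>?P. if E p then \<theta> (block_of e p) else 1 - \<theta> (block_of e p)) = (\<Prod>p\<in>?P. if E p then \<theta> c else 1 - \<theta> c)"
      by (intro prod.cong) auto
    also have "\<dots> = \<theta> c ^ card (?P \<inter> {p. E p}) * (1 - \<theta> c) ^ card (?P \<inter> - {p. E p})"
      by (subst prod.If_cases) auto
    also have "?P \<inter> {p. E p} = {p \<in> node_pairs n. block_of e p = c \<and> E p}" by auto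
    also have "?P \<inter> - {p. E p} = ?P - {p \<in> node_pairs n. block_of e p = c \<and> E p}" by auto
    also have "card \<dots> = block_size n e c - block_edges n E e c"
      unfolding block_size_def block_edges_def by (intro card_Diff_subset) (auto intro: finite_subset[OF _ finite_node_pairs])
    finally show "(\<Prod>p\<in>?P. if E p then \<theta> (block_of e p) else 1 - \<theta> (block_of e p)) =
        \<theta> c ^ block_edges n E e c * (1 - \<theta> c) ^ (block_size n e c - block_edges n E e c)"
      by (simp add: block_edges_def)
  qed
  finally show ?thesis .
qed

definition mle :: "nat \<Rightarrow> (nat \<times> nat \<Rightarrow> bool) \<Rightarrow> (nat \<Rightarrow> nat) \<Rightarrow> nat \<times> nat \<Rightarrow> real" where
  "mle n E e c = real (block_edges n E e c) / real (block_size n e c)"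

lemma kt_lik_le_mle:
  assumes e: "\<And>i. i < n \<Longrightarrow> e i < k"
  shows "kt_lik k n E e \<le> bern_lik (node_pairs n) (\<lambda>p. mle n E e (block_of e p)) E"
proof (subst bern_lik_block_of[where k = k, OF e]; (unfold kt_lik_def)?; (intro prod_mono conjI)?)
  fix c
  show "kt_weight (block_edges n E e c) (block_size n e c - block_edges n E e c) \<le>
    mle n E e c ^ block_edges n E e c * (1 - mle n E e c) ^ (block_size n e c - block_edges n E e c)"
    using kt_weight_le_mle[of "block_edges n E e c" "block_size n e c - block_edges n E e c"]
    by (simp add: mle_def block_edges_le)
qed (auto intro: less_imp_le kt_weight_pos)

lemma kt_lik_ge:
  assumes e: "\<And>i. i < n \<Longrightarrow> e i < k" and \<theta>: "\<And>c. c \<in> blocks k \<Longrightarrow> 0 \<le> \<theta> c \<and> \<theta> c \<le> 1" and n: "n > 0"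
  shows "kt_lik k n E e \<ge> bern_lik (node_pairs n) (\<lambda>p. \<theta> (block_of e p)) E / (exp 1 * real n) ^ card (blocks k)"
proof -
  have "bern_lik (node_pairs n) (\<lambda>p. \<theta> (block_of e p)) E / (exp 1 * real n) ^ card (blocks k) =
    (\<Prod>c\<in>blocks k. \<theta> c ^ block_edges n E e c * (1 - \<theta> c) ^ (block_size n e c - block_edges n E e c) / (exp 1 * real n))"
    by (subst bern_lik_block_of[where k = k, OF e]) (simp_all add: prod_dividef)
  also have "\<dots> \<le> kt_lik k n E e" unfolding kt_lik_def
  proof (intro prod_mono conjI)
    fix c assume c: "c \<in> blocks k"
    let ?m = "block_edges n E e c" and ?N = "block_size n e c"
    show "0 \<le> \<theta> c ^ ?m * (1 - \<theta> c) ^ (?N - ?m) / (exp 1 * real n)" using \<theta>[OF c] by simp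
    have en: "exp 1 * real n \<ge> 1" using n mult_mono[of 1 "exp 1 :: real" 1 "real n"] by simp
    show "\<theta> c ^ ?m * (1 - \<theta> c) ^ (?N - ?m) / (exp 1 * real n) \<le> kt_weight ?m (?N - ?m)"
    proof (cases "?N = 0")
      case True
      then have "?m = 0" using block_edges_le[of n E e c] by simp
      then show ?thesis using True en Beta_half_pos by (simp add: kt_weight_def)
    next
      case False
      have "sqrt (real ?N) \<le> sqrt (real (n ^ 2))"
        using block_size_le[of n e c] by (simp only: real_sqrt_le_iff of_nat_le_iff)
      then have "\<theta> c ^ ?m * (1 - \<theta> c) ^ (?N - ?m) / (exp 1 * real n) \<le>
          \<theta> c ^ ?m * (1 - \<theta> c) ^ (?N - ?m) / (exp 1 * sqrt (real ?N))"
        using \<theta>[OF c] n False by (intro divide_left_mono) auto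
      also have "\<dots> \<le> kt_weight ?m (?N - ?m)"
        using kt_weight_ge[of "\<theta> c" ?m "?N - ?m"] \<theta>[OF c] False by (simp add: block_edges_le)
      finally show ?thesis .
    qed
  qed
  finally show ?thesis .
qed

definition relabel :: "nat \<Rightarrow> (nat \<Rightarrow> nat) \<Rightarrow> (nat \<Rightarrow> nat) \<Rightarrow> nat \<Rightarrow> nat" where
  "relabel n \<sigma> e = (\<lambda>i. if i < n then \<sigma> (e i) else 0)"

lemma kt_lik_relabel:
  assumes \<sigma>: "\<sigma> permutes {..<k}"
  shows "kt_lik k n E (relabel n \<sigma> e) = kt_lik k n E e"
proof -
  define f where "f = (\<lambda>c::nat \<times> nat. (min (\<sigma> (fst c)) (\<sigma> (snd c)), max (\<sigma> (fst c)) (\<sigma> (snd c))))"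
  have inj: "\<sigma> a = \<sigma> b \<longleftrightarrow> a = b" for a b using permutes_inj[OF \<sigma>] by (auto simp: inj_def)
  have lt: "\<sigma> a < k \<longleftrightarrow> a < k" for a using permutes_in_image[OF \<sigma>, of a] by simp
  have injf: "c = d" if "f c = f d" "fst c \<le> snd c" "fst d \<le> snd d" for c d
    using that by (cases c; cases d) (auto simp: f_def min_def max_def inj split: if_splits)
  have "f ` blocks k = blocks k"
  proof (rule endo_inj_surj)
    show "f ` blocks k \<subseteq> blocks k" by (auto simp: f_def blocks_def lt)
    show "inj_on f (blocks k)" by (rule inj_onI, rule injf) (auto simp: blocks_def)
  qed simp
  then have bij: "bij_betw f (blocks k) (blocks k)"
    by (simp add: bij_betw_def eq_card_imp_inj_on)
  have eq: "block_of (relabel n \<sigma> e) p = f c \<longleftrightarrow> block_of e p = c" if "p \<in> node_pairs n" "c \<in> blocks k" for p c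
  proof -
    have "block_of (relabel n \<sigma> e) p = f (block_of e p)"
      using that by (auto simp: block_of_def relabel_def node_pairs_def f_def min_def max_def)
    moreover have "f (block_of e p) = f c \<longleftrightarrow> block_of e p = c"
      using injf[of "block_of e p" c] that by (auto simp: block_of_def blocks_def)
    ultimately show ?thesis by simp
  qed
  have "block_size n (relabel n \<sigma> e) (f c) = block_size n e c"
    "block_edges n E (relabel n \<sigma> e) (f c) = block_edges n E e c" if "c \<in> blocks k" for c
    unfolding block_size_def block_edges_def using eq[OF _ that] by (auto intro!: arg_cong[of _ _ card])
  then show ?thesis
    unfolding kt_lik_def by (subst prod.reindex_bij_betw[OF bij, symmetric]) simp
qed

subsection \<open>Concentration and likelihood ratios for independent edges\<close>

lemma exp_le_quadratic:
  fixes s :: real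
  assumes "\<bar>s\<bar> \<le> 1"
  shows "exp s \<le> 1 + s + s\<^sup>2"
proof (cases "s \<ge> 0")
  case True
  then show ?thesis using assms exp_bound[of s] by simp
next
  case False
  define x where "x = - s"
  have x: "x > 0" using False by (simp add: x_def)
  have pos: "1 + x + x\<^sup>2 / 2 > 0" using x by (simp add: add_pos_pos)
  have "exp s = 1 / exp x" by (simp add: x_def exp_minus field_simps)
  also have "\<dots> \<le> 1 / (1 + x + x\<^sup>2 / 2)"
    using exp_lower_Taylor_quadratic[of x] x pos by (intro divide_left_mono) auto
  also have "\<dots> \<le> 1 - x + x\<^sup>2"
  proof -
    have "(1 - x + x\<^sup>2) * (1 + x + x\<^sup>2 / 2) = 1 + x ^ 2 / 2 + x ^ 3 / 2 + x ^ 4 / 2"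
      by (simp add: field_simps power2_eq_square power3_eq_cube power4_eq_xxxx)
    also have "\<dots> \<ge> 1" using x by simp
    finally show ?thesis using pos by (simp add: divide_le_eq)
  qed
  finally show ?thesis by (simp add: x_def)
qed

lemma Pi_pmf_chernoff_signed:
  fixes s u :: real and p :: "'a \<Rightarrow> 'b pmf" and B :: "'a \<Rightarrow> 'b set"
  assumes A: "finite A" and s: "\<bar>s\<bar> \<le> 1"
  defines "\<mu> \<equiv> \<Sum>x\<in>A. measure_pmf.prob (p x) (B x)"
  shows "measure_pmf.prob (Pi_pmf A d p) {f. s * (real (card {x\<in>A. f x \<in> B x}) - \<mu>) \<ge> u} \<le> exp (s\<^sup>2 * \<mu> - u)"
proof -
  let ?P = "Pi_pmf A d p"
  let ?g = "\<lambda>f. \<Prod>x\<in>A. exp (s * indicat_real (B x) (f x))"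
  have g: "?g f = exp (s * real (card {x\<in>A. f x \<in> B x}))" for f
  proof -
    have "(\<Sum>x\<in>A. indicat_real (B x) (f x)) = real (card {x\<in>A. f x \<in> B x})"
      using A by (simp add: indicator_def of_bool_def sum.If_cases Int_def)
    then show ?thesis using A by (simp add: exp_sum[symmetric] sum_distrib_left[symmetric])
  qed
  have int1: "integrable (measure_pmf q) (\<lambda>y. exp (s * indicat_real C y))" for q :: "'b pmf" and C
    by (rule measure_pmf.integrable_const_bound[where B = "exp \<bar>s\<bar>"]) (auto simp: indicator_def)
  have intg: "integrable ?P ?g"
    by (rule integrable_prod_Pi_pmf[OF A int1])
  have "measure_pmf.prob ?P {f. s * (real (card {x\<in>A. f x \<in> B x}) - \<mu>) \<ge> u}
     = measure_pmf.expectation ?P (indicat_real {f. s * (real (card {x\<in>A. f x \<in> B x}) - \<mu>) \<ge> u})"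
    by simp
  also have "\<dots> \<le> measure_pmf.expectation ?P (\<lambda>f. exp (- s * \<mu> - u) * ?g f)"
  proof (rule integral_mono)
    show "indicat_real {f. s * (real (card {x\<in>A. f x \<in> B x}) - \<mu>) \<ge> u} f \<le> exp (- s * \<mu> - u) * ?g f" for f
      unfolding g mult_exp_exp by (auto simp: indicator_def algebra_simps)
  qed (auto intro!: integrable_mult_right intg measure_pmf.integrable_const_bound[where B = 1])
  also have "\<dots> = exp (- s * \<mu> - u) * (\<Prod>x\<in>A. measure_pmf.expectation (p x) (\<lambda>y. exp (s * indicat_real (B x) y)))"
    using expectation_prod_Pi_pmf[OF A, where p = p and f = "\<lambda>x y. exp (s * indicat_real (B x) y)" and dflt = d] int1 by simp
  also have "(\<Prod>x\<in>A. measure_pmf.expectation (p x) (\<lambda>y. exp (s * indicat_real (B x) y)))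
     \<le> (\<Prod>x\<in>A. exp ((s + s\<^sup>2) * measure_pmf.prob (p x) (B x)))"
  proof (intro prod_mono conjI)
    fix x
    have "measure_pmf.expectation (p x) (\<lambda>y. exp (s * indicat_real (B x) y)) =
      measure_pmf.expectation (p x) (\<lambda>y. 1 + (exp s - 1) * indicat_real (B x) y)"
      by (intro Bochner_Integration.integral_cong) (auto simp: indicator_def)
    also have "\<dots> = 1 + (exp s - 1) * measure_pmf.prob (p x) (B x)"
      by (subst Bochner_Integration.integral_add)
        (auto intro!: integrable_mult_right measure_pmf.integrable_const_bound[where B = 1])
    also have "\<dots> \<le> 1 + (s + s\<^sup>2) * measure_pmf.prob (p x) (B x)"
      using exp_le_quadratic[OF s] by (intro add_left_mono mult_right_mono) auto
    also have "\<dots> \<le> exp ((s + s\<^sup>2) * measure_pmf.prob (p x) (B x))" by simp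
    finally show "measure_pmf.expectation (p x) (\<lambda>y. exp (s * indicat_real (B x) y)) \<le> \<dots>" .
  qed (auto intro!: Bochner_Integration.integral_nonneg)
  also have "\<dots> = exp ((s + s\<^sup>2) * \<mu>)"
    using A by (simp add: \<mu>_def sum_distrib_left exp_sum)
  also have "exp (- s * \<mu> - u) * \<dots> = exp (s\<^sup>2 * \<mu> - u)"
    unfolding mult_exp_exp by (simp add: algebra_simps)
  finally show ?thesis by simp
qed

lemma Pi_pmf_chernoff:
  fixes t l :: real and p :: "'a \<Rightarrow> 'b pmf" and B :: "'a \<Rightarrow> 'b set"
  assumes A: "finite A" and l: "0 \<le> l" "l \<le> 1"
  defines "\<mu> \<equiv> \<Sum>x\<in>A. measure_pmf.prob (p x) (B x)"
  shows "measure_pmf.prob (Pi_pmf A d p) {f. \<bar>real (card {x\<in>A. f x \<in> B x}) - \<mu>\<bar> \<ge> t} \<le> 2 * exp (l\<^sup>2 * \<mu> - l * t)"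
proof -
  let ?S = "\<lambda>s. {f. s * (real (card {x\<in>A. f x \<in> B x}) - \<mu>) \<ge> l * t}"
  have "{f. \<bar>real (card {x\<in>A. f x \<in> B x}) - \<mu>\<bar> \<ge> t} \<subseteq> ?S l \<union> ?S (- l)"
  proof
    fix f assume "f \<in> {f. \<bar>real (card {x\<in>A. f x \<in> B x}) - \<mu>\<bar> \<ge> t}"
    then have "t \<le> real (card {x\<in>A. f x \<in> B x}) - \<mu> \<or> t \<le> - (real (card {x\<in>A. f x \<in> B x}) - \<mu>)"
      by auto
    then have "l * t \<le> l * (real (card {x\<in>A. f x \<in> B x}) - \<mu>) \<or> l * t \<le> l * (- (real (card {x\<in>A. f x \<in> B x}) - \<mu>))"
      using l(1) mult_left_mono by blast
    then show "f \<in> ?S l \<union> ?S (- l)" by (simp add: algebra_simps)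
  qed
  then have "measure_pmf.prob (Pi_pmf A d p) {f. \<bar>real (card {x\<in>A. f x \<in> B x}) - \<mu>\<bar> \<ge> t}
      \<le> measure_pmf.prob (Pi_pmf A d p) (?S l \<union> ?S (- l))"
    by (intro measure_pmf.finite_measure_mono) auto
  also have "\<dots> \<le> measure_pmf.prob (Pi_pmf A d p) (?S l) + measure_pmf.prob (Pi_pmf A d p) (?S (- l))"
    by (intro measure_Un_le) auto
  also have "\<dots> \<le> exp (l\<^sup>2 * \<mu> - l * t) + exp ((- l)\<^sup>2 * \<mu> - l * t)"
    unfolding \<mu>_def using l by (intro add_mono Pi_pmf_chernoff_signed A) auto
  finally show ?thesis by simp
qed

abbreviation edge_pmf :: "'a set \<Rightarrow> ('a \<Rightarrow> real) \<Rightarrow> ('a \<Rightarrow> bool) pmf" where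
  "edge_pmf P r \<equiv> Pi_pmf P False (\<lambda>p. bernoulli_pmf (r p))"

lemma edge_pmf_chernoff:
  fixes t l :: real
  assumes P: "finite P" and r: "\<And>p. p \<in> P \<Longrightarrow> 0 \<le> r p \<and> r p \<le> 1" and l: "0 \<le> l" "l \<le> 1"
    and M: "(\<Sum>p | p \<in> P \<and> Q p. r p) \<le> M"
  shows "measure_pmf.prob (edge_pmf P r) {E. \<bar>real (card {p\<in>P. Q p \<and> E p}) - (\<Sum>p | p \<in> P \<and> Q p. r p)\<bar> \<ge> t}
    \<le> 2 * exp (l\<^sup>2 * M - l * t)"
proof -
  let ?B = "\<lambda>p. if Q p then {True} else {}"
  have "(\<Sum>p\<in>P. measure_pmf.prob (bernoulli_pmf (r p)) (?B p)) = (\<Sum>p\<in>P. if Q p then r p else 0)"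
    using r by (intro sum.cong) (auto simp: measure_pmf_single)
  also have "\<dots> = (\<Sum>p | p \<in> P \<and> Q p. r p)"
    using P by (simp add: sum.inter_filter)
  finally have mu: "(\<Sum>p\<in>P. measure_pmf.prob (bernoulli_pmf (r p)) (?B p)) = (\<Sum>p | p \<in> P \<and> Q p. r p)" .
  have set_eq: "{p\<in>P. E p \<in> ?B p} = {p\<in>P. Q p \<and> E p}" for E :: "'a \<Rightarrow> bool" by auto
  have "measure_pmf.prob (edge_pmf P r) {E. \<bar>real (card {p\<in>P. Q p \<and> E p}) - (\<Sum>p | p \<in> P \<and> Q p. r p)\<bar> \<ge> t}
    \<le> 2 * exp (l\<^sup>2 * (\<Sum>p | p \<in> P \<and> Q p. r p) - l * t)"
    using Pi_pmf_chernoff[OF P l, where p = "\<lambda>p. bernoulli_pmf (r p)" and B = ?B and d = False and t = t]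
    unfolding mu set_eq .
  also have "\<dots> \<le> 2 * exp (l\<^sup>2 * M - l * t)"
    using M by (simp add: mult_left_mono)
  finally show ?thesis .
qed

lemma bernoulli_affinity_le:
  fixes a b :: real
  assumes "0 \<le> a" "a \<le> 1" "0 \<le> b" "b \<le> 1"
  shows "sqrt (a * b) + sqrt ((1 - a) * (1 - b)) \<le> exp (- (sqrt a - sqrt b)\<^sup>2 / 2)"
proof -
  have "sqrt ((1 - a) * (1 - b)) \<le> ((1 - a) + (1 - b)) / 2"
    using assms by (intro arith_geo_mean_sqrt) auto
  then have "sqrt (a * b) + sqrt ((1 - a) * (1 - b)) \<le> 1 + (- (sqrt a - sqrt b)\<^sup>2 / 2)"
    using assms by (simp add: power2_diff real_sqrt_mult field_simps)
  also have "\<dots> \<le> exp (- (sqrt a - sqrt b)\<^sup>2 / 2)" by (rule exp_ge_add_one_self)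
  finally show ?thesis .
qed

lemma bern_lik_pos:
  "(\<And>p. p \<in> P \<Longrightarrow> 0 < r p \<and> r p < 1) \<Longrightarrow> bern_lik P r E > 0"
  unfolding bern_lik_def by (intro prod_pos) auto

text \<open>Markov's inequality for the square root of the likelihood ratio.\<close>

lemma edge_pmf_lik_ratio:
  fixes c :: real
  assumes P: "finite P" and r: "\<And>p. p \<in> P \<Longrightarrow> 0 < r p \<and> r p < 1"
    and s: "\<And>p. p \<in> P \<Longrightarrow> 0 \<le> s p \<and> s p \<le> 1" and c: "c > 0"
  shows "measure_pmf.prob (edge_pmf P r) {E. bern_lik P s E \<ge> c * bern_lik P r E}
    \<le> exp (- (\<Sum>p\<in>P. (sqrt (r p) - sqrt (s p))\<^sup>2) / 2) / sqrt c"
proof -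
  let ?P = "edge_pmf P r"
  let ?h = "\<lambda>p y. sqrt ((if y then s p else 1 - s p) / (if y then r p else 1 - r p))"
  let ?g = "\<lambda>E. \<Prod>p\<in>P. ?h p (E p)"
  have g: "?g E = sqrt (bern_lik P s E / bern_lik P r E)" for E
    unfolding bern_lik_def prod_dividef[symmetric]
    using P by (induction P rule: finite_induct) (simp_all only: prod.empty prod.insert real_sqrt_mult real_sqrt_one not_False_eq_True)
  have int1: "integrable (measure_pmf (bernoulli_pmf q)) f" for q and f :: "bool \<Rightarrow> real"
    by (rule integrable_measure_pmf_finite) (auto intro: finite_subset[OF subset_UNIV])
  have intg: "integrable ?P ?g"
    by (rule integrable_prod_Pi_pmf[OF P int1])
  have "measure_pmf.prob ?P {E. bern_lik P s E \<ge> c * bern_lik P r E}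
     = measure_pmf.expectation ?P (indicat_real {E. bern_lik P s E \<ge> c * bern_lik P r E})" by simp
  also have "\<dots> \<le> measure_pmf.expectation ?P (\<lambda>E. (1 / sqrt c) * ?g E)"
  proof (rule integral_mono)
    fix E
    have "1 \<le> (1 / sqrt c) * ?g E" if "bern_lik P s E \<ge> c * bern_lik P r E"
    proof -
      have "c \<le> bern_lik P s E / bern_lik P r E" using that bern_lik_pos[of P r E, OF r] by (simp add: field_simps)
      then have "sqrt c \<le> ?g E" unfolding g by simp
      then show ?thesis using c by (simp add: field_simps)
    qed
    moreover have "0 \<le> (1 / sqrt c) * ?g E"
      using c r s by (intro mult_nonneg_nonneg prod_nonneg) (auto simp: less_imp_le)
    ultimately show "indicat_real {E. bern_lik P s E \<ge> c * bern_lik P r E} E \<le> (1 / sqrt c) * ?g E"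
      by (simp only: indicator_def) (auto split: if_splits)
  qed (rule integrable_mult_right[OF intg] measure_pmf.integrable_const_bound[where B = 1] | simp)+
  also have "\<dots> = (1 / sqrt c) * (\<Prod>p\<in>P. measure_pmf.expectation (bernoulli_pmf (r p)) (?h p))"
  proof -
    have "measure_pmf.expectation ?P ?g = (\<Prod>p\<in>P. measure_pmf.expectation (bernoulli_pmf (r p)) (?h p))"
      using r s by (intro expectation_prod_Pi_pmf P int1) (auto simp: less_imp_le)
    then show ?thesis by (simp only: integral_mult_right_zero)
  qed
  also have "\<dots> \<le> (1 / sqrt c) * (\<Prod>p\<in>P. exp (- (sqrt (r p) - sqrt (s p))\<^sup>2 / 2))"
  proof (intro mult_left_mono prod_mono conjI)
    fix p assume p: "p \<in> P"
    have "measure_pmf.expectation (bernoulli_pmf (r p)) (?h p) = r p * sqrt (s p / r p) + (1 - r p) * sqrt ((1 - s p) / (1 - r p))"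
      using r[OF p] by (simp add: mult.commute)
    also have "\<dots> = sqrt (r p * s p) + sqrt ((1 - r p) * (1 - s p))"
    proof -
      have "a * sqrt (b / a) = sqrt (a * b)" if "a > 0" for a b :: real
        using that by (simp add: real_sqrt_mult real_sqrt_divide field_simps)
      then show ?thesis using r[OF p] by simp
    qed
    also have "\<dots> \<le> exp (- (sqrt (r p) - sqrt (s p))\<^sup>2 / 2)"
      using r[OF p] s[OF p] by (intro bernoulli_affinity_le) auto
    finally show "measure_pmf.expectation (bernoulli_pmf (r p)) (?h p) \<le> exp (- (sqrt (r p) - sqrt (s p))\<^sup>2 / 2)" .
    show "0 \<le> measure_pmf.expectation (bernoulli_pmf (r p)) (?h p)"
      using r[OF p] s[OF p] by (intro Bochner_Integration.integral_nonneg) auto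
  qed (use c in auto)
  also have "(\<Prod>p\<in>P. exp (- (sqrt (r p) - sqrt (s p))\<^sup>2 / 2)) = exp (- (\<Sum>p\<in>P. (sqrt (r p) - sqrt (s p))\<^sup>2) / 2)"
    using P by (simp add: exp_sum[symmetric] sum_negf sum_divide_distrib)
  finally show ?thesis by simp
qed

lemma labelings_eq_PiE_dflt: "labelings k n = PiE_dflt {..<n} 0 (\<lambda>_. {..<k})"
  by (auto simp: labelings_def PiE_dflt_def not_less)

lemma finite_labelings [simp]: "finite (labelings k n)"
  by (simp add: labelings_eq_PiE_dflt finite_PiE_dflt)

lemma card_labelings: "card (labelings k n) = k ^ n"
  by (simp add: labelings_eq_PiE_dflt card_PiE_dflt)

lemma sum_power_hamming_le:
  fixes x :: real
  assumes x: "x \<ge> 0"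
  shows "(\<Sum>e\<in>labelings k n. x ^ card {i. i < n \<and> e i \<noteq> z i}) \<le> (1 + real k * x) ^ n"
proof -
  let ?g = "\<lambda>(h::nat \<Rightarrow> nat) i. if i \<in> {..<n} then h i else 0"
  let ?f = "\<lambda>i a. if a \<noteq> z i then x else 1"
  have w: "x ^ card {i. i < n \<and> e i \<noteq> z i} = (\<Prod>i<n. ?f i (e i))" for e
    by (subst prod.If_cases) (auto simp: Int_def)
  have inj: "inj_on ?g (PiE {..<n} (\<lambda>_. {..<k}))"
    by (rule inj_on_inverseI[where g = "\<lambda>h. restrict h {..<n}"]) (auto simp: fun_eq_iff PiE_def extensional_def)
  have "(\<Sum>e\<in>labelings k n. x ^ card {i. i < n \<and> e i \<noteq> z i}) =
      (\<Sum>e\<in>PiE {..<n} (\<lambda>_. {..<k}). \<Prod>i<n. ?f i (e i))"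
    unfolding labelings_eq_PiE_dflt dflt_image_PiE[symmetric] w
    by (subst sum.reindex[OF inj]) (auto intro!: sum.cong prod.cong)
  also have "\<dots> = (\<Prod>i<n. \<Sum>a<k. ?f i a)"
    by (rule prod_sum_PiE[symmetric]) auto
  also have "\<dots> \<le> (\<Prod>i<n. 1 + real k * x)"
  proof (intro prod_mono conjI)
    fix i
    have "(\<Sum>a<k. ?f i a) \<le> (\<Sum>a<k. x + (if a = z i then 1 else 0))"
      using x by (intro sum_mono) auto
    also have "\<dots> \<le> 1 + real k * x"
      by (simp add: sum.distrib sum.delta')
    finally show "(\<Sum>a<k. ?f i a) \<le> 1 + real k * x" .
  qed (use x in \<open>auto intro!: sum_nonneg\<close>)
  finally show ?thesis by simp
qed

subsection \<open>Hellinger separation of near and far labelings\<close>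

definition degree :: "nat \<Rightarrow> (nat \<times> nat \<Rightarrow> bool) \<Rightarrow> nat \<Rightarrow> nat" where
  "degree n E i = card {p \<in> node_pairs n. (fst p = i \<or> snd p = i) \<and> E p}"

definition hamming :: "nat \<Rightarrow> (nat \<Rightarrow> nat) \<Rightarrow> (nat \<Rightarrow> nat) \<Rightarrow> nat" where
  "hamming n e z = card {i. i < n \<and> e i \<noteq> z i}"

lemma block_edges_le_hamming:
  assumes d: "\<And>i. i < n \<Longrightarrow> degree n E i \<le> \<Delta>"
  shows "block_edges n E e c \<le> block_edges n E z c + hamming n e z * \<Delta>"
proof -
  let ?M = "{i. i < n \<and> e i \<noteq> z i}"
  let ?D = "\<lambda>i. {p \<in> node_pairs n. (fst p = i \<or> snd p = i) \<and> E p}"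
  have fin: "finite {p \<in> node_pairs n. Q p}" for Q by (rule finite_subset[OF _ finite_node_pairs]) auto
  have "{p \<in> node_pairs n. block_of e p = c \<and> E p} \<subseteq> {p \<in> node_pairs n. block_of z p = c \<and> E p} \<union> (\<Union>i\<in>?M. ?D i)"
  proof
    fix p assume p: "p \<in> {p \<in> node_pairs n. block_of e p = c \<and> E p}"
    then have lt: "fst p < n" "snd p < n" by (auto simp: node_pairs_def)
    show "p \<in> {p \<in> node_pairs n. block_of z p = c \<and> E p} \<union> (\<Union>i\<in>?M. ?D i)"
    proof (cases "fst p \<in> ?M \<or> snd p \<in> ?M")
      case True
      then have "p \<in> ?D (fst p) \<and> fst p \<in> ?M \<or> p \<in> ?D (snd p) \<and> snd p \<in> ?M" using p by simp
      then show ?thesis by blast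
    next
      case False
      then have "block_of e p = block_of z p" using lt by (simp add: block_of_def)
      then show ?thesis using p by simp
    qed
  qed
  then have "block_edges n E e c \<le> card ({p \<in> node_pairs n. block_of z p = c \<and> E p} \<union> (\<Union>i\<in>?M. ?D i))"
    unfolding block_edges_def using fin by (intro card_mono finite_UnI finite_UN_I) simp_all
  also have "\<dots> \<le> block_edges n E z c + card (\<Union>i\<in>?M. ?D i)"
    unfolding block_edges_def by (rule card_Un_le)
  also have "card (\<Union>i\<in>?M. ?D i) \<le> (\<Sum>i\<in>?M. degree n E i)"
    unfolding degree_def by (rule card_UN_le) simp
  also have "\<dots> \<le> (\<Sum>i\<in>?M. \<Delta>)" using d by (intro sum_mono) auto
  finally show ?thesis by (simp add: hamming_def)
qed

lemma hamming_commute: "hamming n e z = hamming n z e"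
  unfolding hamming_def by (metis (no_types, lifting))

lemma block_edges_diff_le:
  assumes d: "\<And>i. i < n \<Longrightarrow> real (degree n E i) \<le> \<Delta>"
  shows "\<bar>real (block_edges n E e c) - real (block_edges n E z c)\<bar> \<le> real (hamming n e z) * \<Delta>"
proof (cases "n = 0")
  case True
  then show ?thesis by (simp add: block_edges_def node_pairs_def hamming_def)
next
  case False
  have \<Delta>: "\<Delta> \<ge> 0" using d[of 0] False by simp
  have nd: "degree n E i \<le> nat \<lfloor>\<Delta>\<rfloor>" if "i < n" for i using d[OF that] by (simp add: le_nat_floor)
  have "real (block_edges n E e c) \<le> real (block_edges n E z c + hamming n e z * nat \<lfloor>\<Delta>\<rfloor>)"
    "real (block_edges n E z c) \<le> real (block_edges n E e c + hamming n z e * nat \<lfloor>\<Delta>\<rfloor>)"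
    using nd by (intro of_nat_mono block_edges_le_hamming; simp)+
  moreover have "real (hamming n e z) * real (nat \<lfloor>\<Delta>\<rfloor>) \<le> real (hamming n e z) * \<Delta>"
    using \<Delta> by (intro mult_left_mono) auto
  ultimately show ?thesis by (simp add: hamming_commute[of n z e])
qed

lemma degree_le: "degree n E i \<le> n"
proof -
  have "{p \<in> node_pairs n. (fst p = i \<or> snd p = i) \<and> E p} \<subseteq> (\<lambda>j. (min i j, max i j)) ` {..<n}"
  proof
    fix p assume p: "p \<in> {p \<in> node_pairs n. (fst p = i \<or> snd p = i) \<and> E p}"
    obtain a b where ab: "p = (a, b)" "a < b" "b < n" using p by (auto simp: node_pairs_def)
    then have "p = (min i b, max i b) \<and> b < n \<or> p = (min i a, max i a) \<and> a < n" using p by auto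
    then show "p \<in> (\<lambda>j. (min i j, max i j)) ` {..<n}" by blast
  qed
  then have "degree n E i \<le> card ((\<lambda>j. (min i j, max i j)) ` {..<n})"
    unfolding degree_def by (intro card_mono) auto
  also have "\<dots> \<le> n" using card_image_le[of "{..<n}"] by fastforce
  finally show ?thesis .
qed

lemma block_size_diff_le:
  "\<bar>real (block_size n e c) - real (block_size n z c)\<bar> \<le> real (hamming n e z) * real n"
proof -
  have "block_size n e c = block_edges n (\<lambda>_. True) e c" for e
    by (simp add: block_size_def block_edges_def)
  then show ?thesis using block_edges_diff_le[of n "\<lambda>_. True" "real n" e c z] degree_le by simp
qed

lemma bernoulli_mle_le:
  fixes \<theta> :: real
  assumes \<theta>: "0 < \<theta>" "\<theta> < 1" and m: "m \<le> N"
  defines "x \<equiv> real m / real N"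
  shows "x ^ m * (1 - x) ^ (N - m) \<le> \<theta> ^ m * (1 - \<theta>) ^ (N - m) * exp ((real m - real N * \<theta>)\<^sup>2 / (real N * (\<theta> * (1 - \<theta>))))"
proof (cases "N = 0")
  case False
  then have N: "real N > 0" by simp
  have x: "0 \<le> x" "x \<le> 1" using m N by (auto simp: x_def)
  have aux: "y ^ a \<le> t ^ a * exp (real a * (y / t - 1))" if "t > 0" "y \<ge> 0" for y t :: real and a :: nat
  proof -
    have "(y / t) ^ a \<le> exp (y / t - 1) ^ a"
      using that exp_ge_add_one_self[of "y / t - 1"] by (intro power_mono) auto
    then have "t ^ a * (y / t) ^ a \<le> t ^ a * exp (y / t - 1) ^ a"
      using that by (intro mult_left_mono) auto
    then show ?thesis unfolding exp_of_nat_mult using that by (simp add: power_divide)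
  qed
  have "x ^ m * (1 - x) ^ (N - m) \<le> (\<theta> ^ m * exp (real m * (x / \<theta> - 1))) *
      ((1 - \<theta>) ^ (N - m) * exp (real (N - m) * ((1 - x) / (1 - \<theta>) - 1)))"
    using x \<theta> by (intro mult_mono aux) auto
  also have "\<dots> = \<theta> ^ m * (1 - \<theta>) ^ (N - m) * exp (real m * (x / \<theta> - 1) + real (N - m) * ((1 - x) / (1 - \<theta>) - 1))"
    unfolding exp_add by simp
  also have "real m * (x / \<theta> - 1) + real (N - m) * ((1 - x) / (1 - \<theta>) - 1) =
      (real m - real N * \<theta>)\<^sup>2 / (real N * (\<theta> * (1 - \<theta>)))"
  proof -
    have m': "real m = real N * x" using N by (simp add: x_def)
    have "real (N - m) = real N * (1 - x)" using m by (simp add: of_nat_diff m' algebra_simps)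
    then show ?thesis unfolding m' using \<theta> N by (simp add: divide_simps) (simp add: algebra_simps power2_eq_square)
  qed
  finally show ?thesis .
qed (use m in auto)

lemma bern_lik_mle_le:
  assumes e: "\<And>i. i < n \<Longrightarrow> e i < k" and \<theta>: "\<And>c. c \<in> blocks k \<Longrightarrow> 0 < \<theta> c \<and> \<theta> c < 1"
  shows "bern_lik (node_pairs n) (\<lambda>p. mle n E e (block_of e p)) E \<le>
    bern_lik (node_pairs n) (\<lambda>p. \<theta> (block_of e p)) E *
    exp (\<Sum>c\<in>blocks k. (real (block_edges n E e c) - real (block_size n e c) * \<theta> c)\<^sup>2 /
        (real (block_size n e c) * (\<theta> c * (1 - \<theta> c))))"
proof -
  have "bern_lik (node_pairs n) (\<lambda>p. mle n E e (block_of e p)) E =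
    (\<Prod>c\<in>blocks k. mle n E e c ^ block_edges n E e c * (1 - mle n E e c) ^ (block_size n e c - block_edges n E e c))"
    by (rule bern_lik_block_of[where k = k, OF e])
  also have "\<dots> \<le> (\<Prod>c\<in>blocks k. \<theta> c ^ block_edges n E e c * (1 - \<theta> c) ^ (block_size n e c - block_edges n E e c) *
      exp ((real (block_edges n E e c) - real (block_size n e c) * \<theta> c)\<^sup>2 / (real (block_size n e c) * (\<theta> c * (1 - \<theta> c)))))"
  proof (intro prod_mono conjI)
    fix c assume c: "c \<in> blocks k"
    show "mle n E e c ^ block_edges n E e c * (1 - mle n E e c) ^ (block_size n e c - block_edges n E e c) \<le>
      \<theta> c ^ block_edges n E e c * (1 - \<theta> c) ^ (block_size n e c - block_edges n E e c) *
      exp ((real (block_edges n E e c) - real (block_size n e c) * \<theta> c)\<^sup>2 / (real (block_size n e c) * (\<theta> c * (1 - \<theta> c))))"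
      using \<theta>[OF c] unfolding mle_def by (intro bernoulli_mle_le block_edges_le) auto
    have "mle n E e c \<le> 1" using block_edges_le[of n E e c]
      by (cases "block_size n e c = 0") (auto simp: mle_def divide_le_eq_1)
    then show "0 \<le> mle n E e c ^ block_edges n E e c * (1 - mle n E e c) ^ (block_size n e c - block_edges n E e c)"
      by (simp add: mle_def)
  qed
  also have "\<dots> = bern_lik (node_pairs n) (\<lambda>p. \<theta> (block_of e p)) E *
    exp (\<Sum>c\<in>blocks k. (real (block_edges n E e c) - real (block_size n e c) * \<theta> c)\<^sup>2 /
        (real (block_size n e c) * (\<theta> c * (1 - \<theta> c))))"
    by (subst bern_lik_block_of[where k = k, OF e]) (simp_all add: prod.distrib exp_sum)
  finally show ?thesis .
qed

definition symmetric_pos :: "nat \<Rightarrow> (nat \<Rightarrow> nat \<Rightarrow> real) \<Rightarrow> bool" where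
  "symmetric_pos k S \<longleftrightarrow> (\<forall>a<k. \<forall>b<k. S a b = S b a \<and> S a b > 0)"

lemma sum_swap_le_node_pairs:
  fixes g :: "nat \<Rightarrow> nat \<Rightarrow> real"
  assumes sym: "\<And>i j. g i j = g j i" and nn: "\<And>i j. g i j \<ge> 0" and M: "M \<subseteq> {..<n}"
  shows "(\<Sum>i\<in>M. \<Sum>j\<in>{..<n} - M. g i j) \<le> (\<Sum>p\<in>node_pairs n. g (fst p) (snd p))"
proof -
  let ?f = "\<lambda>(i, j). (min i j, max i j) :: nat \<times> nat"
  have inj: "inj_on ?f (M \<times> ({..<n} - M))"
    by (rule inj_onI) (auto simp: min_def max_def split: if_splits)
  have "(\<Sum>i\<in>M. \<Sum>j\<in>{..<n} - M. g i j) = (\<Sum>(i, j)\<in>M \<times> ({..<n} - M). g i j)"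
    by (simp add: sum.cartesian_product)
  also have "\<dots> = (\<Sum>p\<in>?f ` (M \<times> ({..<n} - M)). g (fst p) (snd p))"
    by (subst sum.reindex[OF inj]) (auto intro!: sum.cong simp: min_def max_def sym)
  also have "\<dots> \<le> (\<Sum>p\<in>node_pairs n. g (fst p) (snd p))"
  proof (rule sum_mono2)
    show "?f ` (M \<times> ({..<n} - M)) \<subseteq> node_pairs n"
      using M by (auto simp: node_pairs_def min_less_iff_disj less_max_iff_disj) (metis nat_neq_iff)
  qed (use nn in auto)
  finally show ?thesis .
qed

lemma near_hellinger_ge:
  fixes S :: "nat \<Rightarrow> nat \<Rightarrow> real" and \<delta> \<epsilon> s1 cs \<rho> :: real
  assumes S: "symmetric_pos k S" and s1: "\<And>a b. a < k \<Longrightarrow> b < k \<Longrightarrow> S a b \<le> s1"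
    and cs: "\<And>b b'. b < k \<Longrightarrow> b' < k \<Longrightarrow> b \<noteq> b' \<Longrightarrow> 2 * cs \<le> (\<Sum>a<k. \<pi> a * (sqrt (S a b) - sqrt (S a b'))\<^sup>2)"
    and z: "\<And>i. i < n \<Longrightarrow> z i < k" and e: "\<And>i. i < n \<Longrightarrow> e i < k"
    and typical: "\<And>a. a < k \<Longrightarrow> real (n_cnt n z a) \<ge> (\<pi> a - \<delta>) * real n"
    and near: "real (hamming n e z) \<le> \<epsilon> * real n" and de: "\<delta> \<ge> 0" "\<epsilon> \<ge> 0" and \<rho>: "\<rho> \<ge> 0"
  shows "(\<Sum>p\<in>node_pairs n. (sqrt (\<rho> * S (z (fst p)) (z (snd p))) - sqrt (\<rho> * S (e (fst p)) (e (snd p))))\<^sup>2)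
    \<ge> real (hamming n e z) * (real n * \<rho> * (2 * cs - (\<delta> + \<epsilon>) * (real k * s1)))"
proof -
  define M where "M = {i. i < n \<and> e i \<noteq> z i}"
  define d where "d = (\<lambda>i j. (sqrt (S (z i) (z j)) - sqrt (S (e i) (e j)))\<^sup>2)"
  define g where "g = (\<lambda>i j. if i < n \<and> j < n then \<rho> * d i j else 0)"
  have Mn: "M \<subseteq> {..<n}" "finite M" by (auto simp: M_def)
  have inner: "real n * \<rho> * (2 * cs - (\<delta> + \<epsilon>) * (real k * s1)) \<le> (\<Sum>j\<in>{..<n} - M. g i j)" if i: "i \<in> M" for i
  proof -
    have ik: "z i < k" "e i < k" "z i \<noteq> e i" "i < n" using i z e by (auto simp: M_def)
    define D where "D = (\<lambda>a. (sqrt (S a (z i)) - sqrt (S a (e i)))\<^sup>2)"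
    have D1: "0 \<le> D a" "D a \<le> s1" if "a < k" for a
    proof -
      have D: "D a = (sqrt (S a (z i)))\<^sup>2 + (sqrt (S a (e i)))\<^sup>2 - 2 * (sqrt (S a (z i)) * sqrt (S a (e i)))"
        by (simp add: D_def power2_diff)
      have p: "S a (z i) > 0" "S a (e i) > 0" using S that ik by (auto simp: symmetric_pos_def)
      let ?m = "min (S a (z i)) (S a (e i))"
      have "sqrt ?m * sqrt ?m \<le> sqrt (S a (z i)) * sqrt (S a (e i))"
        using p by (intro mult_mono) auto
      then have "?m \<le> sqrt (S a (z i)) * sqrt (S a (e i))" using p by simp
      then have "D a \<le> max (S a (z i)) (S a (e i))" unfolding D using p by (simp add: min_def max_def split: if_splits)
      then show "D a \<le> s1" using s1[OF that ik(1)] s1[OF that ik(2)] by linarith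
    qed (simp add: D_def)
    have cnt: "real (card {j \<in> {..<n} - M. z j = a}) \<ge> (\<pi> a - \<delta> - \<epsilon>) * real n" if "a < k" for a
    proof -
      have "n_cnt n z a \<le> card ({j \<in> {..<n} - M. z j = a} \<union> M)"
        unfolding n_cnt_def using Mn by (intro card_mono) auto
      also have "\<dots> \<le> card {j \<in> {..<n} - M. z j = a} + card M" by (rule card_Un_le)
      finally have "real (n_cnt n z a) \<le> real (card {j \<in> {..<n} - M. z j = a}) + real (hamming n e z)"
        by (simp add: hamming_def M_def)
      then show ?thesis using typical[OF that] near by (simp add: algebra_simps)
    qed
    have "real n * (2 * cs - (\<delta> + \<epsilon>) * (real k * s1)) \<le> (\<Sum>a<k. (\<pi> a - \<delta> - \<epsilon>) * real n * D a)"
    proof -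
      have "(\<Sum>a<k. D a) \<le> real k * s1" using sum_bounded_above[of "{..<k}" D s1] D1 by simp
      then have "(\<delta> + \<epsilon>) * (\<Sum>a<k. D a) \<le> (\<delta> + \<epsilon>) * (real k * s1)" using de by (intro mult_left_mono) auto
      moreover have "2 * cs \<le> (\<Sum>a<k. \<pi> a * D a)" unfolding D_def using ik by (intro cs) auto
      ultimately have "2 * cs - (\<delta> + \<epsilon>) * (real k * s1) \<le> (\<Sum>a<k. \<pi> a * D a) - (\<delta> + \<epsilon>) * (\<Sum>a<k. D a)" by linarith
      also have "\<dots> = (\<Sum>a<k. (\<pi> a - \<delta> - \<epsilon>) * D a)"
        by (simp add: sum_distrib_left sum_subtractf[symmetric] algebra_simps)
      finally have "real n * (2 * cs - (\<delta> + \<epsilon>) * (real k * s1)) \<le> real n * (\<Sum>a<k. (\<pi> a - \<delta> - \<epsilon>) * D a)"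
        by (rule mult_left_mono) simp
      then show ?thesis by (simp add: sum_distrib_left mult_ac)
    qed
    also have "\<dots> \<le> (\<Sum>a<k. real (card {j \<in> {..<n} - M. z j = a}) * D a)"
      using cnt D1 by (intro sum_mono mult_right_mono) auto
    also have "\<dots> = (\<Sum>a<k. \<Sum>j | j \<in> {..<n} - M \<and> z j = a. D (z j))" by simp
    also have "\<dots> = (\<Sum>j\<in>{..<n} - M. D (z j))"
      using z by (subst sum.group) auto
    finally have "\<rho> * (real n * (2 * cs - (\<delta> + \<epsilon>) * (real k * s1))) \<le> \<rho> * (\<Sum>j\<in>{..<n} - M. D (z j))"
      using \<rho> by (rule mult_left_mono)
    also have "\<dots> = (\<Sum>j\<in>{..<n} - M. g i j)"
      unfolding sum_distrib_left
    proof (intro sum.cong refl)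
      fix j assume j: "j \<in> {..<n} - M"
      then have "e j = z j" "z j < k" "j < n" using z by (auto simp: M_def)
      then show "\<rho> * D (z j) = g i j" using S ik by (simp add: D_def g_def d_def symmetric_pos_def)
    qed
    finally show ?thesis by (simp add: mult_ac)
  qed
  have "real (hamming n e z) * (real n * \<rho> * (2 * cs - (\<delta> + \<epsilon>) * (real k * s1)))
      = (\<Sum>i\<in>M. real n * \<rho> * (2 * cs - (\<delta> + \<epsilon>) * (real k * s1)))"
    by (simp add: hamming_def M_def)
  also have "\<dots> \<le> (\<Sum>i\<in>M. \<Sum>j\<in>{..<n} - M. g i j)" by (intro sum_mono inner)
  also have "\<dots> \<le> (\<Sum>p\<in>node_pairs n. g (fst p) (snd p))"
  proof (rule sum_swap_le_node_pairs)
    show "g i j = g j i" for i j using S z e by (auto simp: g_def d_def symmetric_pos_def)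
    show "g i j \<ge> 0" for i j using \<rho> by (simp add: g_def d_def)
  qed (use Mn in auto)
  also have "\<dots> = (\<Sum>p\<in>node_pairs n. (sqrt (\<rho> * S (z (fst p)) (z (snd p))) - sqrt (\<rho> * S (e (fst p)) (e (snd p))))\<^sup>2)"
  proof (intro sum.cong refl)
    fix p assume "p \<in> node_pairs n"
    then have "fst p < n" "snd p < n" by (auto simp: node_pairs_def)
    moreover have "(sqrt (\<rho> * x) - sqrt (\<rho> * y))\<^sup>2 = \<rho> * (sqrt x - sqrt y)\<^sup>2" for x y
      using \<rho> by (simp add: real_sqrt_mult right_diff_distrib[symmetric] power_mult_distrib)
    ultimately show "g (fst p) (snd p) = (sqrt (\<rho> * S (z (fst p)) (z (snd p))) - sqrt (\<rho> * S (e (fst p)) (e (snd p))))\<^sup>2"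
      by (simp add: g_def d_def)
  qed
  finally show ?thesis .
qed

lemma node_pairs_double_sum:
  fixes g :: "nat \<Rightarrow> nat \<Rightarrow> real"
  assumes sym: "\<And>i j. g i j = g j i" and diag: "\<And>i. g i i = 0"
  shows "(\<Sum>i<n. \<Sum>j<n. g i j) = 2 * (\<Sum>p\<in>node_pairs n. g (fst p) (snd p))"
proof -
  have "(\<Sum>i<n. \<Sum>j<n. g i j) = (\<Sum>p\<in>node_pairs n. g (fst p) (snd p) + g (snd p) (fst p))"
    by (rule double_sum_eq_node_pairs[OF diag])
  also have "\<dots> = (\<Sum>p\<in>node_pairs n. 2 * g (fst p) (snd p))"
  proof (intro sum.cong refl)
    fix p
    show "g (fst p) (snd p) + g (snd p) (fst p) = 2 * g (fst p) (snd p)"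
      by (subst sym[of "snd p"]) simp
  qed
  finally show ?thesis by (simp add: sum_distrib_left)
qed

lemma sum_two_rectangles_ge:
  fixes g :: "nat \<Rightarrow> nat \<Rightarrow> real"
  assumes I: "I \<subseteq> {..<n}" "real (card I) \<ge> x" and I': "I' \<subseteq> {..<n}" "real (card I') \<ge> x"
    and J: "J \<subseteq> {..<n}" "real (card J) \<ge> x" and disj: "I \<inter> I' = {}" and x: "x \<ge> 1"
    and nn: "\<And>i j. g i j \<ge> 0" and v: "v \<ge> 0" "v' \<ge> 0"
    and g: "\<And>i j. i \<in> I \<Longrightarrow> j \<in> J \<Longrightarrow> i \<noteq> j \<Longrightarrow> g i j \<ge> v"
    and g': "\<And>i j. i \<in> I' \<Longrightarrow> j \<in> J \<Longrightarrow> i \<noteq> j \<Longrightarrow> g i j \<ge> v'"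
  shows "(\<Sum>i<n. \<Sum>j<n. g i j) \<ge> x * (x - 1) * (v + v')"
proof -
  have fin: "finite I" "finite I'" "finite J" using I I' J by (auto intro: finite_subset)
  have row: "(\<Sum>j<n. g i j) \<ge> (x - 1) * w" if w: "\<And>j. j \<in> J \<Longrightarrow> i \<noteq> j \<Longrightarrow> g i j \<ge> w" "w \<ge> 0" for i w
  proof -
    have "card J \<le> card (J - {i}) + 1"
      using fin by (cases "i \<in> J") auto
    then have "real (card J) \<le> real (card (J - {i})) + 1" by linarith
    then have "(x - 1) * w \<le> real (card (J - {i})) * w"
      using J w by (intro mult_right_mono) auto
    also have "\<dots> = (\<Sum>j\<in>J - {i}. w)" by simp
    also have "\<dots> \<le> (\<Sum>j\<in>J - {i}. g i j)" using w by (intro sum_mono) auto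
    also have "\<dots> \<le> (\<Sum>j<n. g i j)" using J nn by (intro sum_mono2) auto
    finally show ?thesis .
  qed
  have part: "x * (x - 1) * w \<le> (\<Sum>i\<in>K. \<Sum>j<n. g i j)"
    if "real (card K) \<ge> x" "\<And>i j. i \<in> K \<Longrightarrow> j \<in> J \<Longrightarrow> i \<noteq> j \<Longrightarrow> g i j \<ge> w" "w \<ge> 0" for K w
  proof -
    have "x * ((x - 1) * w) \<le> real (card K) * ((x - 1) * w)"
      using that x by (intro mult_right_mono) auto
    also have "\<dots> = (\<Sum>i\<in>K. (x - 1) * w)" by simp
    also have "\<dots> \<le> (\<Sum>i\<in>K. \<Sum>j<n. g i j)" using that by (intro sum_mono row) auto
    finally show ?thesis by (simp add: mult_ac)
  qed
  have "x * (x - 1) * (v + v') = x * (x - 1) * v + x * (x - 1) * v'" by (simp add: algebra_simps)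
  also have "\<dots> \<le> (\<Sum>i\<in>I. \<Sum>j<n. g i j) + (\<Sum>i\<in>I'. \<Sum>j<n. g i j)"
    using I I' v g g' by (intro add_mono part) auto
  also have "\<dots> = (\<Sum>i\<in>I \<union> I'. \<Sum>j<n. g i j)" using fin disj by (simp add: sum.union_disjoint)
  also have "\<dots> \<le> (\<Sum>i<n. \<Sum>j<n. g i j)" using I I' nn by (intro sum_mono2) (auto intro!: sum_nonneg)
  finally show ?thesis .
qed

text \<open>Identifiability: if an estimated class contains many nodes of two true classes b, b', then
  some true class c separates b from b', and a block probability cannot match both.\<close>

lemma far_hellinger_ge:
  fixes S :: "nat \<Rightarrow> nat \<Rightarrow> real" and \<rho> \<alpha> \<gamma> \<kappa> :: real
  assumes S: "symmetric_pos k S"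
    and \<kappa>: "\<And>b b'. b < k \<Longrightarrow> b' < k \<Longrightarrow> b \<noteq> b' \<Longrightarrow> \<exists>c<k. (sqrt (S b c) - sqrt (S b' c))\<^sup>2 \<ge> \<kappa>"
    and e: "e \<in> F_set k n \<alpha>" and z: "z \<in> F_set k n \<alpha>" and \<gamma>: "\<gamma> > 0" "real k * \<gamma> < \<alpha>" and n: "\<gamma> * real n \<ge> 1"
    and far: "\<And>\<tau>. \<tau> permutes {..<k} \<Longrightarrow> real (card {i. i < n \<and> \<tau> (e i) \<noteq> z i}) > (real k)\<^sup>2 * \<gamma> * real n"
    and \<rho>: "\<rho> \<ge> 0"
  shows "(\<Sum>p\<in>node_pairs n. (sqrt (\<rho> * S (z (fst p)) (z (snd p))) - sqrt (\<theta> (block_of e p)))\<^sup>2)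
    \<ge> (\<gamma> * real n) * (\<gamma> * real n - 1) * (\<rho> * \<kappa> / 4)"
proof -
  define R where "R = (\<lambda>a b. {i. i < n \<and> e i = a \<and> z i = b})"
  have fR: "finite (R a b)" for a b by (simp add: R_def)
  have zk: "z i < k" and ek: "e i < k" if "i < n" for i using e z that by (auto simp: F_set_def labelings_def)
  have npos: "real n > 0" using n \<gamma> by (cases "n = 0") auto
  have zdec: "\<exists>a<k. real (card (R a c)) \<ge> \<gamma> * real n" if "c < k" for c
  proof (rule ccontr)
    assume "\<not> ?thesis"
    then have small: "real (card (R a c)) \<le> \<gamma> * real n" if "a < k" for a using that by (auto simp: not_le less_imp_le)
    have "{i. i < n \<and> z i = c} = (\<Union>a<k. R a c)" using ek by (auto simp: R_def)
    then have "n_cnt n z c \<le> (\<Sum>a<k. card (R a c))" unfolding n_cnt_def by (simp add: card_UN_le)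
    then have "real (n_cnt n z c) \<le> (\<Sum>a<k. real (card (R a c)))" by (simp only: of_nat_sum[symmetric] of_nat_le_iff)
    also have "\<dots> \<le> real k * (\<gamma> * real n)"
      using sum_bounded_above[of "{..<k}" "\<lambda>a. real (card (R a c))" "\<gamma> * real n"] small by simp
    also have "\<dots> < \<alpha> * real n" using \<gamma> npos by (simp add: mult.assoc[symmetric])
    finally show False using z that by (auto simp: F_set_def)
  qed
  have edec: "\<exists>b<k. real (card (R a b)) \<ge> \<gamma> * real n" if "a < k" for a
  proof (rule ccontr)
    assume "\<not> ?thesis"
    then have small: "real (card (R a b)) \<le> \<gamma> * real n" if "b < k" for b using that by (auto simp: not_le less_imp_le)
    have "{i. i < n \<and> e i = a} = (\<Union>b<k. R a b)" using zk by (auto simp: R_def)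
    then have "n_cnt n e a \<le> (\<Sum>b<k. card (R a b))" unfolding n_cnt_def by (simp add: card_UN_le)
    then have "real (n_cnt n e a) \<le> (\<Sum>b<k. real (card (R a b)))" by (simp only: of_nat_sum[symmetric] of_nat_le_iff)
    also have "\<dots> \<le> real k * (\<gamma> * real n)"
      using sum_bounded_above[of "{..<k}" "\<lambda>b. real (card (R a b))" "\<gamma> * real n"] small by simp
    also have "\<dots> < \<alpha> * real n" using \<gamma> npos by (simp add: mult.assoc[symmetric])
    finally show False using e that by (auto simp: F_set_def)
  qed
  have "\<exists>a<k. \<exists>b<k. \<exists>b'<k. b \<noteq> b' \<and> real (card (R a b)) \<ge> \<gamma> * real n \<and> real (card (R a b')) \<ge> \<gamma> * real n"
  proof (rule ccontr)
    assume contra: "\<not> ?thesis"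
    define \<tau> where "\<tau> = (\<lambda>a. if a < k then SOME b. b < k \<and> real (card (R a b)) \<ge> \<gamma> * real n else a)"
    have \<tau>: "\<tau> a < k \<and> real (card (R a (\<tau> a))) \<ge> \<gamma> * real n" if "a < k" for a
      using someI_ex[OF edec[OF that]] that by (simp add: \<tau>_def)
    have uniq: "\<tau> a = b" if "a < k" "b < k" "real (card (R a b)) \<ge> \<gamma> * real n" for a b
      using contra \<tau>[OF that(1)] that by metis
    have "{..<k} \<subseteq> \<tau> ` {..<k}"
    proof
      fix c assume "c \<in> {..<k}"
      then obtain a where "a < k" "real (card (R a c)) \<ge> \<gamma> * real n" using zdec by auto
      then show "c \<in> \<tau> ` {..<k}" using uniq[of a c] \<open>c \<in> {..<k}\<close> by auto
    qed
    then have im: "\<tau> ` {..<k} = {..<k}" using \<tau> by auto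
    then have "inj_on \<tau> {..<k}" by (simp add: eq_card_imp_inj_on)
    then have perm: "\<tau> permutes {..<k}"
      using im by (intro bij_imp_permutes) (auto simp: bij_betw_def \<tau>_def)
    have "{i. i < n \<and> \<tau> (e i) \<noteq> z i} \<subseteq> (\<Union>(a, b)\<in>{(a, b). a < k \<and> b < k \<and> b \<noteq> \<tau> a}. R a b)"
      using ek zk by (force simp: R_def)
    moreover have finp: "finite {(a, b). a < k \<and> b < k \<and> b \<noteq> \<tau> a}"
      by (rule finite_subset[of _ "{..<k} \<times> {..<k}"]) auto
    ultimately have "card {i. i < n \<and> \<tau> (e i) \<noteq> z i} \<le> card (\<Union>(a, b)\<in>{(a, b). a < k \<and> b < k \<and> b \<noteq> \<tau> a}. R a b)"
      by (intro card_mono finite_UN_I) (auto simp: fR)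
    also have "\<dots> \<le> (\<Sum>p\<in>{(a, b). a < k \<and> b < k \<and> b \<noteq> \<tau> a}. card (R (fst p) (snd p)))"
      unfolding case_prod_unfold using finp by (intro card_UN_le) (simp add: case_prod_unfold)
    finally have "real (card {i. i < n \<and> \<tau> (e i) \<noteq> z i}) \<le> (\<Sum>p\<in>{(a, b). a < k \<and> b < k \<and> b \<noteq> \<tau> a}. real (card (R (fst p) (snd p))))"
      by (simp only: of_nat_sum[symmetric] of_nat_le_iff)
    also have "\<dots> \<le> (\<Sum>p\<in>{(a, b). a < k \<and> b < k \<and> b \<noteq> \<tau> a}. \<gamma> * real n)"
    proof (intro sum_mono)
      fix p assume "p \<in> {(a, b). a < k \<and> b < k \<and> b \<noteq> \<tau> a}"
      then show "real (card (R (fst p) (snd p))) \<le> \<gamma> * real n" using uniq[of "fst p" "snd p"] by force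
    qed
    also have "\<dots> \<le> (\<Sum>p\<in>{..<k} \<times> {..<k}. \<gamma> * real n)"
      using \<gamma> by (intro sum_mono2) auto
    also have "\<dots> = (real k)\<^sup>2 * \<gamma> * real n" by (simp add: power2_eq_square)
    finally show False using far[OF perm] by simp
  qed
  then obtain a b b' where ab: "a < k" "b < k" "b' < k" "b \<noteq> b'"
    "real (card (R a b)) \<ge> \<gamma> * real n" "real (card (R a b')) \<ge> \<gamma> * real n" by blast
  obtain c where c: "c < k" "(sqrt (S b c) - sqrt (S b' c))\<^sup>2 \<ge> \<kappa>" using \<kappa> ab by blast
  obtain a' where a': "a' < k" "real (card (R a' c)) \<ge> \<gamma> * real n" using zdec[OF c(1)] by auto
  define t where "t = sqrt (\<theta> (min a a', max a a'))"
  define g where "g = (\<lambda>i j. if i < n \<and> j < n \<and> i \<noteq> j then (sqrt (\<rho> * S (z i) (z j)) - sqrt (\<theta> (block_of e (i, j))))\<^sup>2 else 0)"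
  define v where "v = (\<lambda>b. (sqrt (\<rho> * S b c) - t)\<^sup>2)"
  have "(\<gamma> * real n) * (\<gamma> * real n - 1) * (v b + v b') \<le> (\<Sum>i<n. \<Sum>j<n. g i j)"
  proof (rule sum_two_rectangles_ge)
    show "g i j \<ge> v b" if "i \<in> R a b" "j \<in> R a' c" "i \<noteq> j" for i j
      using that by (auto simp: g_def R_def v_def t_def block_of_def)
    show "g i j \<ge> v b'" if "i \<in> R a b'" "j \<in> R a' c" "i \<noteq> j" for i j
      using that by (auto simp: g_def R_def v_def t_def block_of_def)
    show "g i j \<ge> 0" for i j by (simp add: g_def)
    show "R a b \<inter> R a b' = {}" using ab by (auto simp: R_def)
  qed (use ab a' n in \<open>auto simp: R_def v_def\<close>)
  also have "\<dots> = 2 * (\<Sum>p\<in>node_pairs n. g (fst p) (snd p))"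
  proof (rule node_pairs_double_sum)
    show "g i j = g j i" for i j
      using S zk by (auto simp: g_def symmetric_pos_def block_of_def min.commute max.commute)
  qed (simp add: g_def)
  also have "(\<Sum>p\<in>node_pairs n. g (fst p) (snd p)) =
      (\<Sum>p\<in>node_pairs n. (sqrt (\<rho> * S (z (fst p)) (z (snd p))) - sqrt (\<theta> (block_of e p)))\<^sup>2)"
    by (intro sum.cong refl) (auto simp: node_pairs_def g_def)
  finally have main: "(\<gamma> * real n) * (\<gamma> * real n - 1) * (v b + v b') \<le>
      2 * (\<Sum>p\<in>node_pairs n. (sqrt (\<rho> * S (z (fst p)) (z (snd p))) - sqrt (\<theta> (block_of e p)))\<^sup>2)" .
  have "\<rho> * \<kappa> / 2 \<le> \<rho> * (sqrt (S b c) - sqrt (S b' c))\<^sup>2 / 2"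
    using c \<rho> by (simp add: mult_left_mono)
  also have "\<dots> = (sqrt (\<rho> * S b c) - sqrt (\<rho> * S b' c))\<^sup>2 / 2"
    using \<rho> by (simp add: real_sqrt_mult right_diff_distrib[symmetric] power_mult_distrib)
  also have "\<dots> \<le> v b + v b'"
  proof -
    have "(x - y)\<^sup>2 / 2 \<le> (x - t)\<^sup>2 + (y - t)\<^sup>2" for x y :: real
    proof -
      have "2 * ((x - t)\<^sup>2 + (y - t)\<^sup>2) - (x - y)\<^sup>2 = (x + y - 2 * t)\<^sup>2"
        by (simp add: power2_eq_square algebra_simps)
      moreover have "c / 2 \<le> a + b" if "2 * (a + b) - c = d" "d \<ge> 0" for a b c d :: real
      proof -
        have "c \<le> (a + b) * 2" using that by simp
        then show ?thesis by simp
      qed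
      ultimately show ?thesis using zero_le_power2 by blast
    qed
    then show ?thesis by (simp add: v_def)
  qed
  finally have "(\<gamma> * real n) * (\<gamma> * real n - 1) * (\<rho> * \<kappa> / 2) \<le> (\<gamma> * real n) * (\<gamma> * real n - 1) * (v b + v b')"
    using n by (intro mult_left_mono) auto
  then show ?thesis using main by simp
qed

subsection \<open>The error probability given the labels\<close>

locale sbm_conditional =
  fixes k n :: nat and S :: "nat \<Rightarrow> nat \<Rightarrow> real" and \<rho> \<alpha> s0 s1 :: real and z :: "nat \<Rightarrow> nat"
  assumes S: "symmetric_pos k S"
    and S_ge: "\<And>a b. a < k \<Longrightarrow> b < k \<Longrightarrow> s0 \<le> S a b"
    and S_le: "\<And>a b. a < k \<Longrightarrow> b < k \<Longrightarrow> S a b \<le> s1"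
    and s0: "0 < s0" and \<rho>: "0 < \<rho>" "\<rho> * s1 \<le> 1/2"
    and \<alpha>: "0 < \<alpha>" and n_large: "\<alpha> * real n \<ge> 2" and z: "z \<in> F_set k n \<alpha>"
begin

definition \<theta> :: "nat \<times> nat \<Rightarrow> real" where "\<theta> c = \<rho> * S (fst c) (snd c)"

definition edge_prob :: "nat \<times> nat \<Rightarrow> real" where
  "edge_prob p = \<rho> * S (z (fst p)) (z (snd p))"

definition K :: nat where "K = card (blocks k)"

abbreviation edge_law :: "(nat \<times> nat \<Rightarrow> bool) pmf" where
  "edge_law \<equiv> edge_pmf (node_pairs n) edge_prob"

lemma n_pos: "n > 0"
  using n_large by (cases n) auto

lemma z_less: "i < n \<Longrightarrow> z i < k"
  using z by (auto simp: F_set_def labelings_def)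

lemma \<theta>_bounds:
  assumes "c \<in> blocks k"
  shows "\<rho> * s0 \<le> \<theta> c" "\<theta> c \<le> \<rho> * s1" "0 < \<theta> c" "\<theta> c \<le> 1/2"
proof -
  have c: "fst c < k" "snd c < k" using assms by (auto simp: blocks_def)
  show 1: "\<rho> * s0 \<le> \<theta> c" "\<theta> c \<le> \<rho> * s1"
    using S_ge[OF c] S_le[OF c] \<rho> by (simp_all add: \<theta>_def)
  show "0 < \<theta> c" using 1(1) mult_pos_pos[OF \<rho>(1) s0] by linarith
  show "\<theta> c \<le> 1/2" using 1(2) \<rho> by linarith
qed

lemma \<theta>_block_of:
  assumes e: "\<And>i. i < n \<Longrightarrow> e i < k" and p: "p \<in> node_pairs n"
  shows "\<theta> (block_of e p) = \<rho> * S (e (fst p)) (e (snd p))"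
proof -
  have "fst p < n" "snd p < n" using p by (auto simp: node_pairs_def)
  then show ?thesis using S e by (auto simp: \<theta>_def block_of_def min_def max_def symmetric_pos_def)
qed

lemma edge_prob_eq: "p \<in> node_pairs n \<Longrightarrow> edge_prob p = \<theta> (block_of z p)"
  using \<theta>_block_of[of z p] z_less by (simp add: edge_prob_def)

lemma edge_prob_bounds:
  assumes "p \<in> node_pairs n"
  shows "0 < edge_prob p" "edge_prob p < 1" "edge_prob p \<le> \<rho> * s1"
  using \<theta>_bounds[OF block_of_in_blocks[of n z k p, OF z_less assms]] edge_prob_eq[OF assms] by auto

lemma kt_event_prob_le:
  assumes C: "C > 0" and s: "\<And>p. p \<in> node_pairs n \<Longrightarrow> 0 \<le> s p \<and> s p \<le> 1"
    and A: "\<And>E. E \<in> A \<Longrightarrow> kt_lik k n E z \<le> C * bern_lik (node_pairs n) s E"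
  shows "measure_pmf.prob edge_law A \<le> sqrt (C * (exp 1 * real n) ^ K) *
    exp (- (\<Sum>p\<in>node_pairs n. (sqrt (edge_prob p) - sqrt (s p))\<^sup>2) / 2)"
proof -
  define c where "c = 1 / (C * (exp 1 * real n) ^ K)"
  have c: "c > 0" using C n_pos by (simp add: c_def)
  have "A \<subseteq> {E. bern_lik (node_pairs n) s E \<ge> c * bern_lik (node_pairs n) edge_prob E}"
  proof
    fix E assume "E \<in> A"
    have "bern_lik (node_pairs n) edge_prob E = bern_lik (node_pairs n) (\<lambda>p. \<theta> (block_of z p)) E"
      unfolding bern_lik_def by (intro prod.cong) (auto simp: edge_prob_eq)
    then have "bern_lik (node_pairs n) edge_prob E / (exp 1 * real n) ^ K \<le> kt_lik k n E z"
      using kt_lik_ge[of n z k \<theta> E, OF z_less _ n_pos] \<theta>_bounds(3,4) by (fastforce simp: K_def)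
    also have "\<dots> \<le> C * bern_lik (node_pairs n) s E" by (rule A) fact
    finally have "bern_lik (node_pairs n) edge_prob E \<le> C * bern_lik (node_pairs n) s E * (exp 1 * real n) ^ K"
      using n_pos by (subst (asm) pos_divide_le_eq) auto
    then have "bern_lik (node_pairs n) edge_prob E / (C * (exp 1 * real n) ^ K) \<le> bern_lik (node_pairs n) s E"
      using n_pos C by (subst pos_divide_le_eq) (auto simp: mult_ac)
    then show "E \<in> {E. bern_lik (node_pairs n) s E \<ge> c * bern_lik (node_pairs n) edge_prob E}"
      by (simp add: c_def)
  qed
  then have "measure_pmf.prob edge_law A \<le>
      measure_pmf.prob edge_law {E. bern_lik (node_pairs n) s E \<ge> c * bern_lik (node_pairs n) edge_prob E}"
    by (intro measure_pmf.finite_measure_mono) auto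
  also have "\<dots> \<le> exp (- (\<Sum>p\<in>node_pairs n. (sqrt (edge_prob p) - sqrt (s p))\<^sup>2) / 2) / sqrt c"
    by (intro edge_pmf_lik_ratio c s) (use edge_prob_bounds in auto)
  also have "\<dots> = sqrt (C * (exp 1 * real n) ^ K) *
    exp (- (\<Sum>p\<in>node_pairs n. (sqrt (edge_prob p) - sqrt (s p))\<^sup>2) / 2)"
    by (simp add: c_def real_sqrt_divide)
  finally show ?thesis .
qed

definition far :: "real \<Rightarrow> (nat \<Rightarrow> nat) \<Rightarrow> bool" where
  "far \<epsilon> e \<longleftrightarrow> (\<forall>\<tau>. \<tau> permutes {..<k} \<longrightarrow> real (card {i. i < n \<and> \<tau> (e i) \<noteq> z i}) > \<epsilon> * real n)"

text \<open>The maximum likelihood estimate of an arbitrary labeling takes at most polynomially many values,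
  so that a union bound over them costs less than the exponential separation gains.\<close>

lemma prob_far_le:
  fixes \<gamma> \<kappa> :: real
  assumes \<kappa>: "\<And>b b'. b < k \<Longrightarrow> b' < k \<Longrightarrow> b \<noteq> b' \<Longrightarrow> \<exists>c<k. (sqrt (S b c) - sqrt (S b' c))\<^sup>2 \<ge> \<kappa>"
    and \<gamma>: "\<gamma> > 0" "real k * \<gamma> < \<alpha>" and n: "\<gamma> * real n \<ge> 1"
  shows "measure_pmf.prob edge_law {E. \<exists>e\<in>F_set k n \<alpha>. far ((real k)\<^sup>2 * \<gamma>) e \<and> kt_lik k n E z \<le> kt_lik k n E e}
    \<le> real k ^ n * (real n ^ 2 + 1) ^ K *
      (sqrt ((exp 1 * real n) ^ K) * exp (- ((\<gamma> * real n) * (\<gamma> * real n - 1) * (\<rho> * \<kappa> / 8))))"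
proof -
  let ?W = "PiE (blocks k) (\<lambda>_. {..n ^ 2})"
  let ?L = "{e \<in> F_set k n \<alpha>. far ((real k)\<^sup>2 * \<gamma>) e}"
  let ?b = "sqrt ((exp 1 * real n) ^ K) * exp (- ((\<gamma> * real n) * (\<gamma> * real n - 1) * (\<rho> * \<kappa> / 8)))"
  define \<Theta> where "\<Theta> = (\<lambda>e (w :: nat \<times> nat \<Rightarrow> nat) c. min 1 (real (w c) / real (block_size n e c)))"
  define A where "A = (\<lambda>(e, w). {E. kt_lik k n E z \<le> bern_lik (node_pairs n) (\<lambda>p. \<Theta> e w (block_of e p)) E})"
  have finL: "finite ?L" by (rule finite_subset[OF _ finite_labelings[of k n]]) (auto simp: F_set_def)
  have finW: "finite ?W" by (intro finite_PiE) auto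
  have sub: "{E. \<exists>e\<in>F_set k n \<alpha>. far ((real k)\<^sup>2 * \<gamma>) e \<and> kt_lik k n E z \<le> kt_lik k n E e} \<subseteq> (\<Union>x\<in>?L \<times> ?W. A x)"
  proof
    fix E assume "E \<in> {E. \<exists>e\<in>F_set k n \<alpha>. far ((real k)\<^sup>2 * \<gamma>) e \<and> kt_lik k n E z \<le> kt_lik k n E e}"
    then obtain e where e: "e \<in> ?L" "kt_lik k n E z \<le> kt_lik k n E e" by auto
    then have ek: "e i < k" if "i < n" for i using that by (auto simp: F_set_def labelings_def)
    define w where "w = restrict (block_edges n E e) (blocks k)"
    have w: "w \<in> ?W" using order_trans[OF block_edges_le block_size_le] by (auto simp: w_def)
    have "kt_lik k n E z \<le> bern_lik (node_pairs n) (\<lambda>p. mle n E e (block_of e p)) E"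
      by (rule order_trans[OF e(2) kt_lik_le_mle]) (rule ek)
    also have "\<dots> = bern_lik (node_pairs n) (\<lambda>p. \<Theta> e w (block_of e p)) E"
    proof -
      have "mle n E e (block_of e p) = \<Theta> e w (block_of e p)" if "p \<in> node_pairs n" for p
      proof -
        have "mle n E e c \<le> 1" for c using block_edges_le[of n E e c]
          by (cases "block_size n e c = 0") (auto simp: mle_def divide_le_eq_1)
        then show ?thesis using block_of_in_blocks[of n e k p, OF ek that]
          by (simp add: \<Theta>_def w_def mle_def)
      qed
      then show ?thesis unfolding bern_lik_def by (intro prod.cong) auto
    qed
    finally show "E \<in> (\<Union>x\<in>?L \<times> ?W. A x)" using e w by (auto simp: A_def)
  qed
  have each: "measure_pmf.prob edge_law (A x) \<le> ?b" if xm: "x \<in> ?L \<times> ?W" for x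
  proof -
    obtain e w where x: "x = (e, w)" "e \<in> ?L" using xm by auto
    let ?s = "\<lambda>p. \<Theta> e w (block_of e p)"
    have "(\<gamma> * real n) * (\<gamma> * real n - 1) * (\<rho> * \<kappa> / 4) \<le>
        (\<Sum>p\<in>node_pairs n. (sqrt (edge_prob p) - sqrt (?s p))\<^sup>2)"
      unfolding edge_prob_def
      by (rule far_hellinger_ge[where k = k and \<alpha> = \<alpha>]) (use S \<kappa> \<gamma> n z x \<rho> in \<open>auto simp: far_def\<close>)
    then have h1: "exp (- (\<Sum>p\<in>node_pairs n. (sqrt (edge_prob p) - sqrt (?s p))\<^sup>2) / 2) \<le>
        exp (- ((\<gamma> * real n) * (\<gamma> * real n - 1) * (\<rho> * \<kappa> / 8)))" by (simp add: algebra_simps)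
    have h2: "measure_pmf.prob edge_law (A x) \<le> sqrt (1 * (exp 1 * real n) ^ K) *
        exp (- (\<Sum>p\<in>node_pairs n. (sqrt (edge_prob p) - sqrt (?s p))\<^sup>2) / 2)"
      by (rule kt_event_prob_le) (auto simp: \<Theta>_def A_def x)
    show ?thesis
      by (rule order_trans[OF h2]) (use h1 in \<open>simp add: mult_left_mono\<close>)
  qed
  have "measure_pmf.prob edge_law {E. \<exists>e\<in>F_set k n \<alpha>. far ((real k)\<^sup>2 * \<gamma>) e \<and> kt_lik k n E z \<le> kt_lik k n E e}
      \<le> measure_pmf.prob edge_law (\<Union>x\<in>?L \<times> ?W. A x)"
    using sub by (intro measure_pmf.finite_measure_mono) auto
  also have "\<dots> \<le> (\<Sum>x\<in>?L \<times> ?W. measure_pmf.prob edge_law (A x))"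
    using finL finW by (intro measure_UNION_le) auto
  also have "\<dots> \<le> real (card (?L \<times> ?W)) * ?b"
    using each by (rule sum_bounded_above)
  also have "\<dots> \<le> real k ^ n * (real n ^ 2 + 1) ^ K * ?b"
  proof (intro mult_right_mono)
    have "card ?L \<le> k ^ n"
      unfolding card_labelings[symmetric] by (intro card_mono) (auto simp: F_set_def)
    moreover have "card ?W = (n ^ 2 + 1) ^ K" by (simp add: card_PiE K_def)
    ultimately have "card (?L \<times> ?W) \<le> k ^ n * (n ^ 2 + 1) ^ K" by (simp add: card_cartesian_product)
    then have "real (card (?L \<times> ?W)) \<le> real (k ^ n * (n ^ 2 + 1) ^ K)" by (simp only: of_nat_le_iff)
    then show "real (card (?L \<times> ?W)) \<le> real k ^ n * (real n ^ 2 + 1) ^ K" by (simp add: add.commute)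
  qed (use n_pos in auto)
  finally show ?thesis .
qed

lemma block_size_ge:
  assumes e: "\<And>a. a < k \<Longrightarrow> real (n_cnt n e a) \<ge> \<alpha> * real n" and c: "c \<in> blocks k"
  shows "real (block_size n e c) \<ge> (\<alpha> * real n)\<^sup>2 / 4"
proof -
  obtain a b where ab: "c = (a, b)" "a \<le> b" "b < k" using c by (auto simp: blocks_def)
  have eq: "real (block_size n e c) = n_tilde n e a b" using ab by (simp add: n_tilde_eq_block_size)
  define x where "x = \<alpha> * real n"
  have n_large: "x \<ge> 2" using n_large by (simp add: x_def)
  have a: "real (n_cnt n e a) \<ge> x" and b: "real (n_cnt n e b) \<ge> x" using e ab by (auto simp: x_def)
  have "x\<^sup>2 / 4 \<le> real (block_size n e c)"
  proof (cases "a = b")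
    case True
    have "x * (x / 2) \<le> real (n_cnt n e a) * (real (n_cnt n e a) - 1)"
      using a n_large by (intro mult_mono) auto
    then show ?thesis unfolding eq n_tilde_def n_pair_def power2_eq_square using True by simp
  next
    case False
    have "x * x \<le> real (n_cnt n e a) * real (n_cnt n e b)"
      using a b n_large by (intro mult_mono) auto
    moreover have "real (n_cnt n e a) * real (n_cnt n e b) \<ge> 0" by simp
    ultimately have "x * x / 4 \<le> real (n_cnt n e a) * real (n_cnt n e b)" by linarith
    then show ?thesis unfolding eq n_tilde_def n_pair_def power2_eq_square using False by simp
  qed
  then show ?thesis by (simp add: x_def)
qed

definition good :: "real \<Rightarrow> real \<Rightarrow> (nat \<times> nat \<Rightarrow> bool) set" where
  "good T \<Delta> = {E. (\<forall>c\<in>blocks k. \<bar>real (block_edges n E z c) - real (block_size n z c) * \<theta> c\<bar> \<le> T) \<and>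
     (\<forall>i<n. real (degree n E i) \<le> \<Delta>)}"

lemma profile_excess_le:
  assumes E: "E \<in> good T \<Delta>" and e: "\<And>a. a < k \<Longrightarrow> real (n_cnt n e a) \<ge> \<alpha> * real n"
  shows "(\<Sum>c\<in>blocks k. (real (block_edges n E e c) - real (block_size n e c) * \<theta> c)\<^sup>2 /
        (real (block_size n e c) * (\<theta> c * (1 - \<theta> c)))) \<le>
     real K * ((T + real (hamming n e z) * (\<Delta> + real n * (\<rho> * s1)))\<^sup>2 * (8 / ((\<alpha> * real n)\<^sup>2 * (\<rho> * s0))))"
proof -
  let ?m = "real (hamming n e z)"
  have "(real (block_edges n E e c) - real (block_size n e c) * \<theta> c)\<^sup>2 /
        (real (block_size n e c) * (\<theta> c * (1 - \<theta> c))) \<le>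
      (T + ?m * (\<Delta> + real n * (\<rho> * s1)))\<^sup>2 * (8 / ((\<alpha> * real n)\<^sup>2 * (\<rho> * s0)))" if c: "c \<in> blocks k" for c
  proof -
    note th = \<theta>_bounds[OF c]
    have 1: "\<bar>real (block_edges n E z c) - real (block_size n z c) * \<theta> c\<bar> \<le> T"
      using E c by (auto simp: good_def)
    have 2: "\<bar>real (block_edges n E e c) - real (block_edges n E z c)\<bar> \<le> ?m * \<Delta>"
      using E by (intro block_edges_diff_le) (auto simp: good_def)
    have "\<bar>real (block_size n z c) - real (block_size n e c)\<bar> * \<theta> c \<le> (?m * real n) * (\<rho> * s1)"
      using block_size_diff_le[of n e c z] th by (intro mult_mono) auto
    then have 3: "\<bar>real (block_size n z c) * \<theta> c - real (block_size n e c) * \<theta> c\<bar> \<le> ?m * real n * (\<rho> * s1)"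
      using th by (simp add: left_diff_distrib[symmetric] abs_mult)
    have "\<bar>real (block_edges n E e c) - real (block_size n e c) * \<theta> c\<bar> \<le> T + ?m * (\<Delta> + real n * (\<rho> * s1))"
      using 1 2 3 by (simp add: algebra_simps abs_le_iff)
    then have num: "(real (block_edges n E e c) - real (block_size n e c) * \<theta> c)\<^sup>2 \<le> (T + ?m * (\<Delta> + real n * (\<rho> * s1)))\<^sup>2"
      by (simp add: abs_le_square_iff[symmetric])
    have den: "(\<alpha> * real n)\<^sup>2 / 4 * ((\<rho> * s0) * (1/2)) \<le> real (block_size n e c) * (\<theta> c * (1 - \<theta> c))"
      using block_size_ge[OF e c] th mult_pos_pos[OF \<rho>(1) s0] by (intro mult_mono) auto
    have pos: "(\<alpha> * real n)\<^sup>2 / 4 * ((\<rho> * s0) * (1/2)) > 0"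
      using \<alpha> n_pos \<rho> s0 by simp
    have "(real (block_edges n E e c) - real (block_size n e c) * \<theta> c)\<^sup>2 / (real (block_size n e c) * (\<theta> c * (1 - \<theta> c)))
      \<le> (T + ?m * (\<Delta> + real n * (\<rho> * s1)))\<^sup>2 / ((\<alpha> * real n)\<^sup>2 / 4 * ((\<rho> * s0) * (1/2)))"
      using num den pos by (intro frac_le) auto
    also have "\<dots> = (T + ?m * (\<Delta> + real n * (\<rho> * s1)))\<^sup>2 * (8 / ((\<alpha> * real n)\<^sup>2 * (\<rho> * s0)))"
      by simp
    finally show ?thesis .
  qed
  then show ?thesis unfolding K_def by (rule sum_bounded_above)
qed

lemma prob_not_good_le:
  assumes l: "0 \<le> l" "l \<le> 1"
  shows "measure_pmf.prob edge_law (- good T \<Delta>) \<le>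
    real K * (2 * exp (l\<^sup>2 * ((real n)\<^sup>2 * (\<rho> * s1)) - l * T)) +
    real n * (2 * exp (real n * (\<rho> * s1) - (\<Delta> - real n * (\<rho> * s1))))"
proof -
  let ?P = "node_pairs n"
  let ?dev = "\<lambda>Q t. {E. \<bar>real (card {p\<in>?P. Q p \<and> E p}) - (\<Sum>p | p \<in> ?P \<and> Q p. edge_prob p)\<bar> \<ge> t}"
  let ?Qb = "\<lambda>c p. block_of z p = c" and ?Qd = "\<lambda>i p. fst p = i \<or> snd p = i"
  let ?t = "\<Delta> - real n * (\<rho> * s1)"
  have fin: "finite {p \<in> ?P. Q p}" for Q by (rule finite_subset[OF _ finite_node_pairs]) auto
  have r: "0 \<le> edge_prob p \<and> edge_prob p \<le> 1" if "p \<in> ?P" for p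
    using edge_prob_bounds[OF that] by auto
  have s1: "\<rho> * s1 \<ge> 0" using \<rho> s0 S_ge[of "z 0" "z 0"] S_le[of "z 0" "z 0"] z_less[OF n_pos] by simp
  have sum_le: "(\<Sum>p | p \<in> ?P \<and> Q p. edge_prob p) \<le> N * (\<rho> * s1)" if "real (card {p\<in>?P. Q p}) \<le> N" for Q N
  proof -
    have "(\<Sum>p | p \<in> ?P \<and> Q p. edge_prob p) \<le> real (card {p\<in>?P. Q p}) * (\<rho> * s1)"
      by (rule sum_bounded_above) (use edge_prob_bounds in auto)
    also have "\<dots> \<le> N * (\<rho> * s1)" using that s1 by (rule mult_right_mono)
    finally show ?thesis .
  qed
  have block: "measure_pmf.prob edge_law (?dev (?Qb c) T) \<le> 2 * exp (l\<^sup>2 * ((real n)\<^sup>2 * (\<rho> * s1)) - l * T)" for c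
  proof (rule edge_pmf_chernoff[OF finite_node_pairs r l])
    have "real (block_size n z c) \<le> (real n)\<^sup>2"
      using block_size_le[of n z c] by (metis of_nat_le_iff of_nat_power)
    then show "(\<Sum>p | p \<in> ?P \<and> ?Qb c p. edge_prob p) \<le> (real n)\<^sup>2 * (\<rho> * s1)"
      by (intro sum_le) (simp add: block_size_def)
  qed
  have deg: "measure_pmf.prob edge_law (?dev (?Qd i) ?t) \<le> 2 * exp (1\<^sup>2 * (real n * (\<rho> * s1)) - 1 * ?t)" for i
  proof (rule edge_pmf_chernoff[OF finite_node_pairs r])
    show "(\<Sum>p | p \<in> ?P \<and> ?Qd i p. edge_prob p) \<le> real n * (\<rho> * s1)"
      using degree_le[of n "\<lambda>_. True" i] by (intro sum_le) (simp add: degree_def)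
  qed auto
  have "- good T \<Delta> \<subseteq> (\<Union>c\<in>blocks k. ?dev (?Qb c) T) \<union> (\<Union>i\<in>{..<n}. ?dev (?Qd i) ?t)"
  proof
    fix E assume "E \<in> - good T \<Delta>"
    then consider c where "c \<in> blocks k" "\<bar>real (block_edges n E z c) - real (block_size n z c) * \<theta> c\<bar> > T"
      | i where "i < n" "real (degree n E i) > \<Delta>" by (auto simp: good_def not_le)
    then show "E \<in> (\<Union>c\<in>blocks k. ?dev (?Qb c) T) \<union> (\<Union>i\<in>{..<n}. ?dev (?Qd i) ?t)"
    proof cases
      case 1
      have "(\<Sum>p | p \<in> ?P \<and> ?Qb c p. edge_prob p) = (\<Sum>p | p \<in> ?P \<and> ?Qb c p. \<theta> c)"
        by (intro sum.cong) (auto simp: edge_prob_eq)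
      then have "(\<Sum>p | p \<in> ?P \<and> ?Qb c p. edge_prob p) = real (block_size n z c) * \<theta> c"
        by (simp add: block_size_def)
      then have "E \<in> ?dev (?Qb c) T" using 1 by (simp add: block_edges_def)
      then show ?thesis using 1 by blast
    next
      case 2
      have "(\<Sum>p | p \<in> ?P \<and> ?Qd i p. edge_prob p) \<le> real n * (\<rho> * s1)"
        using degree_le[of n "\<lambda>_. True" i] by (intro sum_le) (simp add: degree_def)
      moreover have "real (card {p\<in>?P. ?Qd i p \<and> E p}) > \<Delta>" using 2 by (simp add: degree_def)
      ultimately have "E \<in> ?dev (?Qd i) ?t" by simp
      then show ?thesis using 2 by blast
    qed
  qed
  then have "measure_pmf.prob edge_law (- good T \<Delta>) \<le>
      measure_pmf.prob edge_law ((\<Union>c\<in>blocks k. ?dev (?Qb c) T) \<union> (\<Union>i\<in>{..<n}. ?dev (?Qd i) ?t))"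
    by (intro measure_pmf.finite_measure_mono) auto
  also have "\<dots> \<le> measure_pmf.prob edge_law (\<Union>c\<in>blocks k. ?dev (?Qb c) T) +
      measure_pmf.prob edge_law (\<Union>i\<in>{..<n}. ?dev (?Qd i) ?t)"
    by (intro measure_Un_le) auto
  also have "\<dots> \<le> (\<Sum>c\<in>blocks k. measure_pmf.prob edge_law (?dev (?Qb c) T)) +
      (\<Sum>i\<in>{..<n}. measure_pmf.prob edge_law (?dev (?Qd i) ?t))"
    by (intro add_mono measure_UNION_le) auto
  also have "\<dots> \<le> real K * (2 * exp (l\<^sup>2 * ((real n)\<^sup>2 * (\<rho> * s1)) - l * T)) +
      real n * (2 * exp (1\<^sup>2 * (real n * (\<rho> * s1)) - 1 * ?t))"
    using sum_bounded_above[of "blocks k", OF block] sum_bounded_above[of "{..<n}", OF deg]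
    unfolding K_def card_lessThan by (intro add_mono) auto
  finally show ?thesis by simp
qed

lemma prob_near_le:
  fixes \<pi> :: "nat \<Rightarrow> real" and \<delta> \<epsilon> cs D \<tau> :: real
  assumes cs: "\<And>b b'. b < k \<Longrightarrow> b' < k \<Longrightarrow> b \<noteq> b' \<Longrightarrow> 2 * cs \<le> (\<Sum>a<k. \<pi> a * (sqrt (S a b) - sqrt (S a b'))\<^sup>2)"
    and typical: "\<And>a. a < k \<Longrightarrow> real (n_cnt n z a) \<ge> (\<pi> a - \<delta>) * real n"
    and de: "\<delta> \<ge> 0" "\<epsilon> \<ge> 0" and D: "D \<ge> 0"
    and e: "e \<in> F_set k n \<alpha>" "real (hamming n e z) \<le> \<epsilon> * real n" "hamming n e z > 0"
  defines "c1 \<equiv> 8 * real K / (\<alpha>\<^sup>2 * s0)"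
  shows "measure_pmf.prob edge_law {E \<in> good (\<tau> * real n * sqrt (\<rho> * ln (real n))) (D * (real n * \<rho>)). kt_lik k n E z \<le> kt_lik k n E e}
    \<le> exp (c1 * \<tau>\<^sup>2 * ln (real n) + real K / 2 * (1 + ln (real n)) +
        real n * \<rho> * (c1 * \<epsilon> * (D + s1)\<^sup>2 - cs + (\<delta> + \<epsilon>) * (real k * s1) / 2)) ^ hamming n e z"
proof -
  define L where "L = ln (real n)"
  have L: "L \<ge> 0" using n_pos by (simp add: L_def)
  define m where "m = real (hamming n e z)"
  have m: "m \<ge> 1" "m \<le> \<epsilon> * real n" using e by (auto simp: m_def)
  define T where "T = \<tau> * real n * sqrt (\<rho> * L)"
  define \<Delta> where "\<Delta> = D * (real n * \<rho>)"
  have ek: "e i < k" if "i < n" for i using e that by (auto simp: F_set_def labelings_def)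
  have ecnt: "real (n_cnt n e a) \<ge> \<alpha> * real n" if "a < k" for a using e that by (auto simp: F_set_def)
  let ?s = "\<lambda>p. \<theta> (block_of e p)"
  define X where "X = real K * ((T + m * (\<Delta> + real n * (\<rho> * s1)))\<^sup>2 * (8 / ((\<alpha> * real n)\<^sup>2 * (\<rho> * s0))))"
  have pos: "\<alpha> > 0" "real n > 0" "\<rho> > 0" "s0 > 0" using \<alpha> n_pos \<rho> s0 by auto
  have "X \<le> 2 * c1 * (\<tau>\<^sup>2 * L + m * (\<epsilon> * real n * \<rho> * (D + s1)\<^sup>2))"
  proof -
    have sq: "(u + v)\<^sup>2 \<le> 2 * u\<^sup>2 + 2 * v\<^sup>2" for u v :: real
      using zero_le_power2[of "u - v"] by (simp add: power2_sum power2_diff)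
    have "(T + m * (\<Delta> + real n * (\<rho> * s1)))\<^sup>2 \<le> 2 * T\<^sup>2 + 2 * (m * (\<Delta> + real n * (\<rho> * s1)))\<^sup>2" by (rule sq)
    also have "T\<^sup>2 = \<tau>\<^sup>2 * (real n)\<^sup>2 * (\<rho> * L)" using pos L by (simp add: T_def power_mult_distrib)
    also have "(m * (\<Delta> + real n * (\<rho> * s1)))\<^sup>2 = m\<^sup>2 * ((real n)\<^sup>2 * \<rho>\<^sup>2 * (D + s1)\<^sup>2)"
      by (simp add: \<Delta>_def power2_eq_square algebra_simps)
    also have "2 * (\<tau>\<^sup>2 * (real n)\<^sup>2 * (\<rho> * L)) + 2 * (m\<^sup>2 * ((real n)\<^sup>2 * \<rho>\<^sup>2 * (D + s1)\<^sup>2))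
        = 2 * ((real n)\<^sup>2 * \<rho>) * (\<tau>\<^sup>2 * L + m * m * (\<rho> * (D + s1)\<^sup>2))"
      by (simp add: power2_eq_square algebra_simps)
    also have "\<dots> \<le> 2 * ((real n)\<^sup>2 * \<rho>) * (\<tau>\<^sup>2 * L + m * (\<epsilon> * real n) * (\<rho> * (D + s1)\<^sup>2))"
      using m pos by (intro mult_left_mono add_left_mono mult_right_mono) auto
    finally have "X \<le> real K * (2 * ((real n)\<^sup>2 * \<rho>) * (\<tau>\<^sup>2 * L + m * (\<epsilon> * real n) * (\<rho> * (D + s1)\<^sup>2)) * (8 / ((\<alpha> * real n)\<^sup>2 * (\<rho> * s0))))"
      unfolding X_def using pos by (intro mult_left_mono mult_right_mono) auto
    also have "\<dots> = 2 * c1 * (\<tau>\<^sup>2 * L + m * (\<epsilon> * real n * \<rho> * (D + s1)\<^sup>2))"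
      using pos by (simp add: c1_def power_mult_distrib mult_ac)
    finally show ?thesis .
  qed
  then have X: "X / 2 \<le> c1 * \<tau>\<^sup>2 * L + m * (real n * \<rho> * (c1 * \<epsilon> * (D + s1)\<^sup>2))" by (simp add: algebra_simps)
  have "measure_pmf.prob edge_law {E \<in> good T \<Delta>. kt_lik k n E z \<le> kt_lik k n E e} \<le>
      sqrt (exp X * (exp 1 * real n) ^ K) * exp (- (\<Sum>p\<in>node_pairs n. (sqrt (edge_prob p) - sqrt (?s p))\<^sup>2) / 2)"
  proof (rule kt_event_prob_le)
    fix p assume "p \<in> node_pairs n"
    from \<theta>_bounds[OF block_of_in_blocks[of n e k p, OF ek this]] show "0 \<le> ?s p \<and> ?s p \<le> 1" by simp
  next
    fix E assume "E \<in> {E \<in> good T \<Delta>. kt_lik k n E z \<le> kt_lik k n E e}"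
    then have E: "E \<in> good T \<Delta>" "kt_lik k n E z \<le> kt_lik k n E e" by auto
    note E(2)
    also have "kt_lik k n E e \<le> bern_lik (node_pairs n) (\<lambda>p. mle n E e (block_of e p)) E"
      by (rule kt_lik_le_mle) (rule ek)
    also have "\<dots> \<le> bern_lik (node_pairs n) ?s E *
      exp (\<Sum>c\<in>blocks k. (real (block_edges n E e c) - real (block_size n e c) * \<theta> c)\<^sup>2 /
        (real (block_size n e c) * (\<theta> c * (1 - \<theta> c))))"
      by (rule bern_lik_mle_le[where k = k, OF ek]) (use \<theta>_bounds in force)+
    also have "\<dots> \<le> bern_lik (node_pairs n) ?s E * exp X"
    proof (intro mult_left_mono)
      show "exp (\<Sum>c\<in>blocks k. (real (block_edges n E e c) - real (block_size n e c) * \<theta> c)\<^sup>2 /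
        (real (block_size n e c) * (\<theta> c * (1 - \<theta> c)))) \<le> exp X"
        using profile_excess_le[OF E(1) ecnt] by (simp add: X_def m_def)
      show "0 \<le> bern_lik (node_pairs n) ?s E"
      proof (rule less_imp_le, rule bern_lik_pos)
        fix p assume "p \<in> node_pairs n"
        from \<theta>_bounds[OF block_of_in_blocks[of n e k p, OF ek this]] show "0 < ?s p \<and> ?s p < 1" by simp
      qed
    qed
    finally show "kt_lik k n E z \<le> exp X * bern_lik (node_pairs n) ?s E" by (simp add: mult.commute)
  qed simp
  also have "sqrt (exp X * (exp 1 * real n) ^ K) = exp (X / 2 + real K / 2 * (1 + L))"
  proof -
    have "exp X * (exp 1 * real n) ^ K = exp (X + real K * (1 + L))"
      using pos by (simp add: exp_add exp_of_nat_mult power_mult_distrib L_def)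
    also have "X + real K * (1 + L) = 2 * (X / 2 + real K / 2 * (1 + L))" by (simp add: algebra_simps)
    also have "exp \<dots> = (exp (X / 2 + real K / 2 * (1 + L)))\<^sup>2" by (rule exp_double)
    finally show ?thesis by simp
  qed
  also have "exp (- (\<Sum>p\<in>node_pairs n. (sqrt (edge_prob p) - sqrt (?s p))\<^sup>2) / 2) \<le>
      exp (m * (real n * \<rho> * (- cs + (\<delta> + \<epsilon>) * (real k * s1) / 2)))"
  proof -
    have "m * (real n * \<rho> * (2 * cs - (\<delta> + \<epsilon>) * (real k * s1))) \<le>
      (\<Sum>p\<in>node_pairs n. (sqrt (\<rho> * S (z (fst p)) (z (snd p))) - sqrt (\<rho> * S (e (fst p)) (e (snd p))))\<^sup>2)"
      unfolding m_def
      by (rule near_hellinger_ge[where k = k and \<pi> = \<pi>]) (use S S_le cs z_less ek typical e de \<rho> in auto)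
    also have "\<dots> = (\<Sum>p\<in>node_pairs n. (sqrt (edge_prob p) - sqrt (?s p))\<^sup>2)"
      by (intro sum.cong refl) (simp add: edge_prob_def \<theta>_block_of[of e, OF ek])
    finally show ?thesis by (simp add: algebra_simps)
  qed
  also have "exp (X / 2 + real K / 2 * (1 + L)) * exp (m * (real n * \<rho> * (- cs + (\<delta> + \<epsilon>) * (real k * s1) / 2)))
     \<le> exp (m * (c1 * \<tau>\<^sup>2 * L + real K / 2 * (1 + L) +
        real n * \<rho> * (c1 * \<epsilon> * (D + s1)\<^sup>2 - cs + (\<delta> + \<epsilon>) * (real k * s1) / 2)))"
  proof -
    have "c1 * \<tau>\<^sup>2 * L + real K / 2 * (1 + L) \<ge> 0"
      using L pos by (auto simp: c1_def intro!: add_nonneg_nonneg mult_nonneg_nonneg)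
    then have "1 * (c1 * \<tau>\<^sup>2 * L + real K / 2 * (1 + L)) \<le> m * (c1 * \<tau>\<^sup>2 * L + real K / 2 * (1 + L))"
      using m by (intro mult_right_mono) auto
    then show ?thesis using X unfolding mult_exp_exp exp_le_cancel_iff by (simp add: algebra_simps)
  qed
  finally show ?thesis
    unfolding m_def exp_of_nat_mult T_def \<Delta>_def L_def by simp
qed

lemma labelings_eqI_hamming:
  assumes "e \<in> labelings k n" "z' \<in> labelings k n" "hamming n e z' = 0"
  shows "e = z'"
proof
  fix i
  have "{i. i < n \<and> e i \<noteq> z' i} = {}" using assms(3) by (simp add: hamming_def)
  then have "i < n \<Longrightarrow> e i = z' i" by blast
  then show "e i = z' i" using assms(1,2) by (cases "i < n") (auto simp: labelings_def)
qed

lemma prob_near_union_le: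
  fixes x :: real
  assumes x: "x \<ge> 0"
    and each: "\<And>e. e \<in> F_set k n \<alpha> \<Longrightarrow> real (hamming n e z) \<le> \<epsilon> * real n \<Longrightarrow> hamming n e z > 0 \<Longrightarrow>
      measure_pmf.prob edge_law {E \<in> G. kt_lik k n E z \<le> kt_lik k n E e} \<le> x ^ hamming n e z"
  shows "measure_pmf.prob edge_law {E \<in> G. \<exists>e\<in>F_set k n \<alpha>. e \<noteq> z \<and> real (hamming n e z) \<le> \<epsilon> * real n \<and>
      kt_lik k n E z \<le> kt_lik k n E e} \<le> (1 + real k * x) ^ n - 1"
proof -
  let ?I = "{e \<in> F_set k n \<alpha>. e \<noteq> z \<and> real (hamming n e z) \<le> \<epsilon> * real n}"
  let ?A = "\<lambda>e. {E \<in> G. kt_lik k n E z \<le> kt_lik k n E e}"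
  have F: "F_set k n \<alpha> \<subseteq> labelings k n" by (auto simp: F_set_def)
  have fin: "finite ?I" by (rule finite_subset[OF _ finite_labelings[of k n]]) (use F in auto)
  have zl: "z \<in> labelings k n" using z F by auto
  have "measure_pmf.prob edge_law {E \<in> G. \<exists>e\<in>F_set k n \<alpha>. e \<noteq> z \<and> real (hamming n e z) \<le> \<epsilon> * real n \<and>
      kt_lik k n E z \<le> kt_lik k n E e} \<le> measure_pmf.prob edge_law (\<Union>e\<in>?I. ?A e)"
    by (intro measure_pmf.finite_measure_mono) auto
  also have "\<dots> \<le> (\<Sum>e\<in>?I. measure_pmf.prob edge_law (?A e))"
    using fin by (intro measure_UNION_le) auto
  also have "\<dots> \<le> (\<Sum>e\<in>?I. x ^ hamming n e z)"
  proof (intro sum_mono)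
    fix e assume e: "e \<in> ?I"
    then have "hamming n e z > 0" using labelings_eqI_hamming[of e z] zl F by auto
    then show "measure_pmf.prob edge_law (?A e) \<le> x ^ hamming n e z" using e by (intro each) auto
  qed
  also have "\<dots> \<le> (\<Sum>e\<in>labelings k n - {z}. x ^ hamming n e z)"
    using F x by (intro sum_mono2) auto
  also have "\<dots> = (\<Sum>e\<in>labelings k n. x ^ hamming n e z) - 1"
    using zl by (subst sum_diff1) (auto simp: hamming_def)
  also have "\<dots> \<le> (1 + real k * x) ^ n - 1"
    using sum_power_hamming_le[OF x, of n z k] by (simp add: hamming_def)
  finally show ?thesis .
qed

definition equiv_labeling :: "(nat \<Rightarrow> nat) \<Rightarrow> bool" where
  "equiv_labeling e \<longleftrightarrow> (\<exists>\<sigma>. \<sigma> permutes {..<k} \<and> (\<forall>i<n. e i = \<sigma> (z i)))"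

lemma bad_labeling_cases:
  assumes e: "e \<in> F_set k n \<alpha>" "\<not> equiv_labeling e" "\<not> far \<epsilon> e"
  obtains e' where "e' \<in> F_set k n \<alpha>" "e' \<noteq> z" "real (hamming n e' z) \<le> \<epsilon> * real n"
    "\<And>E. kt_lik k n E e' = kt_lik k n E e"
proof -
  obtain \<tau> where \<tau>: "\<tau> permutes {..<k}" "real (card {i. i < n \<and> \<tau> (e i) \<noteq> z i}) \<le> \<epsilon> * real n"
    using e(3) by (auto simp: far_def not_less)
  let ?e = "relabel n \<tau> e"
  have lt: "\<tau> a < k \<longleftrightarrow> a < k" for a using permutes_in_image[OF \<tau>(1), of a] by simp
  show thesis
  proof
    have "n_cnt n ?e a = n_cnt n e (inv \<tau> a)" for a
      unfolding n_cnt_def relabel_def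
      by (rule arg_cong[of _ _ card]) (auto simp: permutes_inverses[OF \<tau>(1)])
    moreover have "inv \<tau> a < k" if "a < k" for a
      using permutes_in_image[OF permutes_inv[OF \<tau>(1)], of a] that by simp
    ultimately show "?e \<in> F_set k n \<alpha>"
      using e(1) by (auto simp: F_set_def labelings_def relabel_def lt)
    have "{i. i < n \<and> ?e i \<noteq> z i} = {i. i < n \<and> \<tau> (e i) \<noteq> z i}" by (auto simp: relabel_def)
    then show "real (hamming n ?e z) \<le> \<epsilon> * real n" using \<tau>(2) by (simp add: hamming_def)
    show "?e \<noteq> z"
    proof
      assume eq: "?e = z"
      have "e i = inv \<tau> (z i)" if "i < n" for i
      proof -
        have "z i = \<tau> (e i)" using that by (simp add: eq[symmetric] relabel_def)
        then show ?thesis by (simp add: permutes_inverses[OF \<tau>(1)])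
      qed
      then show False using e(2) permutes_inv[OF \<tau>(1)] by (auto simp: equiv_labeling_def)
    qed
    show "kt_lik k n E ?e = kt_lik k n E e" for E by (rule kt_lik_relabel[OF \<tau>(1)])
  qed
qed

lemma prob_bad_le:
  fixes \<pi> :: "nat \<Rightarrow> real" and \<delta> \<gamma> \<kappa> cs \<tau> l :: real
  assumes cs: "\<And>b b'. b < k \<Longrightarrow> b' < k \<Longrightarrow> b \<noteq> b' \<Longrightarrow> 2 * cs \<le> (\<Sum>a<k. \<pi> a * (sqrt (S a b) - sqrt (S a b'))\<^sup>2)"
    and \<kappa>: "\<And>b b'. b < k \<Longrightarrow> b' < k \<Longrightarrow> b \<noteq> b' \<Longrightarrow> \<exists>c<k. (sqrt (S b c) - sqrt (S b' c))\<^sup>2 \<ge> \<kappa>"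
    and typical: "\<And>a. a < k \<Longrightarrow> real (n_cnt n z a) \<ge> (\<pi> a - \<delta>) * real n" and \<delta>: "\<delta> \<ge> 0"
    and \<gamma>: "\<gamma> > 0" "real k * \<gamma> < \<alpha>" "\<gamma> * real n \<ge> 1" and l: "0 \<le> l" "l \<le> 1" and D: "D \<ge> 0"
  defines "c1 \<equiv> 8 * real K / (\<alpha>\<^sup>2 * s0)" and "\<epsilon> \<equiv> (real k)\<^sup>2 * \<gamma>"
  shows "measure_pmf.prob edge_law {E. \<exists>e\<in>F_set k n \<alpha>. \<not> equiv_labeling e \<and> kt_lik k n E z \<le> kt_lik k n E e} \<le>
    real K * (2 * exp (l\<^sup>2 * ((real n)\<^sup>2 * (\<rho> * s1)) - l * (\<tau> * real n * sqrt (\<rho> * ln (real n))))) +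
    real n * (2 * exp (real n * (\<rho> * s1) - (D * (real n * \<rho>) - real n * (\<rho> * s1)))) +
    real k ^ n * (real n ^ 2 + 1) ^ K *
      (sqrt ((exp 1 * real n) ^ K) * exp (- ((\<gamma> * real n) * (\<gamma> * real n - 1) * (\<rho> * \<kappa> / 8)))) +
    ((1 + real k * exp (c1 * \<tau>\<^sup>2 * ln (real n) + real K / 2 * (1 + ln (real n)) +
        real n * \<rho> * (c1 * \<epsilon> * (D + s1)\<^sup>2 - cs + (\<delta> + \<epsilon>) * (real k * s1) / 2))) ^ n - 1)"
    (is "_ \<le> ?b1 + ?b2 + ?b3 + ?b4")
proof -
  define G where "G = good (\<tau> * real n * sqrt (\<rho> * ln (real n))) (D * (real n * \<rho>))"
  let ?far = "{E. \<exists>e\<in>F_set k n \<alpha>. far \<epsilon> e \<and> kt_lik k n E z \<le> kt_lik k n E e}"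
  let ?near = "{E \<in> G. \<exists>e\<in>F_set k n \<alpha>. e \<noteq> z \<and> real (hamming n e z) \<le> \<epsilon> * real n \<and> kt_lik k n E z \<le> kt_lik k n E e}"
  have "{E. \<exists>e\<in>F_set k n \<alpha>. \<not> equiv_labeling e \<and> kt_lik k n E z \<le> kt_lik k n E e} \<subseteq> - G \<union> (?far \<union> ?near)"
  proof
    fix E assume "E \<in> {E. \<exists>e\<in>F_set k n \<alpha>. \<not> equiv_labeling e \<and> kt_lik k n E z \<le> kt_lik k n E e}"
    then obtain e where e: "e \<in> F_set k n \<alpha>" "\<not> equiv_labeling e" "kt_lik k n E z \<le> kt_lik k n E e" by auto
    show "E \<in> - G \<union> (?far \<union> ?near)"
    proof (cases "far \<epsilon> e")
      case True
      then show ?thesis using e by auto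
    next
      case False
      obtain e' where "e' \<in> F_set k n \<alpha>" "e' \<noteq> z" "real (hamming n e' z) \<le> \<epsilon> * real n"
        "kt_lik k n E e' = kt_lik k n E e" by (rule bad_labeling_cases[OF e(1,2) False]) blast
      then show ?thesis using e(3) by auto
    qed
  qed
  then have "measure_pmf.prob edge_law {E. \<exists>e\<in>F_set k n \<alpha>. \<not> equiv_labeling e \<and> kt_lik k n E z \<le> kt_lik k n E e} \<le>
      measure_pmf.prob edge_law (- G \<union> (?far \<union> ?near))"
    by (intro measure_pmf.finite_measure_mono) auto
  also have "\<dots> \<le> measure_pmf.prob edge_law (- G) + measure_pmf.prob edge_law (?far \<union> ?near)"
    by (intro measure_Un_le) auto
  also have "measure_pmf.prob edge_law (?far \<union> ?near) \<le> measure_pmf.prob edge_law ?far + measure_pmf.prob edge_law ?near"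
    by (intro measure_Un_le) auto
  also have "measure_pmf.prob edge_law (- G) \<le> ?b1 + ?b2"
    unfolding G_def by (rule prob_not_good_le[OF l])
  also have "measure_pmf.prob edge_law ?far \<le> ?b3"
    unfolding \<epsilon>_def by (rule prob_far_le[OF \<kappa> \<gamma>])
  also have "measure_pmf.prob edge_law ?near \<le> ?b4"
  proof (rule prob_near_union_le)
    fix e assume e: "e \<in> F_set k n \<alpha>" "real (hamming n e z) \<le> \<epsilon> * real n" "hamming n e z > 0"
    have "\<epsilon> \<ge> 0" using \<gamma> by (simp add: \<epsilon>_def)
    from prob_near_le[OF cs typical \<delta> this D e, of \<tau>]
    show "measure_pmf.prob edge_law {E \<in> G. kt_lik k n E z \<le> kt_lik k n E e} \<le>
      exp (c1 * \<tau>\<^sup>2 * ln (real n) + real K / 2 * (1 + ln (real n)) +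
        real n * \<rho> * (c1 * \<epsilon> * (D + s1)\<^sup>2 - cs + (\<delta> + \<epsilon>) * (real k * s1) / 2)) ^ hamming n e z"
      unfolding G_def c1_def .
  qed simp
  finally show ?thesis by simp
qed

end

subsection \<open>The constant \<open>C(\<pi>, S)\<close>\<close>

lemma H_div_half:
  assumes "p > 0" "q > 0"
  shows "H_div (1/2) p q = (sqrt p - sqrt q)\<^sup>2 / 2"
  using assms by (simp add: H_div_def powr_half_sqrt power2_diff field_simps)

lemma H_div_boundary: "p > 0 \<Longrightarrow> q > 0 \<Longrightarrow> H_div 0 p q = 0" "p > 0 \<Longrightarrow> q > 0 \<Longrightarrow> H_div 1 p q = 0"
  by (simp_all add: H_div_def)

lemma H_div_eq_exp:
  assumes "p > 0" "q > 0"
  shows "H_div t p q = (1 - t) * p + t * q - exp ((1 - t) * ln p + t * ln q)"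
  using assms by (simp add: H_div_def powr_def exp_add)

lemma H_div_concave:
  assumes pq: "p > 0" "q > 0" and w: "0 \<le> w" "w \<le> 1"
  shows "(1 - w) * H_div s p q + w * H_div t p q \<le> H_div ((1 - w) * s + w * t) p q"
proof -
  let ?x = "\<lambda>t. (1 - t) * ln p + t * ln q"
  have "exp ((1 - w) *\<^sub>R ?x s + w *\<^sub>R ?x t) \<le> (1 - w) * exp (?x s) + w * exp (?x t)"
    by (rule convex_onD[OF exp_convex]) (use w in auto)
  also have "(1 - w) *\<^sub>R ?x s + w *\<^sub>R ?x t = ?x ((1 - w) * s + w * t)"
    by (simp add: algebra_simps)
  finally show ?thesis unfolding H_div_eq_exp[OF pq] by (simp add: algebra_simps)
qed

text \<open>A concave function on the unit interval vanishing at both ends is less than twice its value at 1/2.\<close>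

lemma SUP_H_div_less:
  fixes u v \<pi> :: "nat \<Rightarrow> real"
  assumes u: "\<And>a. a < k \<Longrightarrow> u a > 0" and v: "\<And>a. a < k \<Longrightarrow> v a > 0" and \<pi>: "\<And>a. a < k \<Longrightarrow> \<pi> a > 0"
    and diff: "\<exists>a<k. u a \<noteq> v a"
  shows "(SUP t\<in>{0..1}. \<Sum>a<k. \<pi> a * H_div t (u a) (v a)) < (\<Sum>a<k. \<pi> a * (sqrt (u a) - sqrt (v a))\<^sup>2)"
proof -
  define f where "f = (\<lambda>t. \<Sum>a<k. \<pi> a * H_div t (u a) (v a))"
  have half: "2 * f (1/2) = (\<Sum>a<k. \<pi> a * (sqrt (u a) - sqrt (v a))\<^sup>2)"
    unfolding f_def sum_distrib_left using u v by (intro sum.cong) (auto simp: H_div_half)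
  have pos: "f (1/2) > 0"
  proof -
    obtain a where a: "a < k" "u a \<noteq> v a" using diff by auto
    have "0 < (\<Sum>a<k. \<pi> a * (sqrt (u a) - sqrt (v a))\<^sup>2)"
      by (rule sum_pos2[of _ a]) (use a \<pi> in \<open>auto simp: less_imp_le\<close>)
    then show ?thesis using half by simp
  qed
  have conc: "(1 - w) * f s + w * f t \<le> f ((1 - w) * s + w * t)" if w: "0 \<le> w" "w \<le> 1" for w s t
  proof -
    have "(1 - w) * f s + w * f t = (\<Sum>a<k. \<pi> a * ((1 - w) * H_div s (u a) (v a) + w * H_div t (u a) (v a)))"
      by (simp add: f_def sum_distrib_left sum.distrib[symmetric] algebra_simps)
    also have "\<dots> \<le> f ((1 - w) * s + w * t)" unfolding f_def
      using u v \<pi> w by (intro sum_mono mult_left_mono H_div_concave) (auto simp: less_imp_le)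
    finally show ?thesis .
  qed
  have f01: "f 0 = 0" "f 1 = 0"
    unfolding f_def using u v by (auto intro!: sum.neutral simp: H_div_boundary)
  have lt: "f t < 2 * f (1/2)" if t: "0 \<le> t" "t \<le> 1" for t
  proof (cases "t = 0 \<or> t = 1")
    case True
    then show ?thesis using f01 pos by auto
  next
    case False
    then have t01: "0 < t" "t < 1" using t by auto
    show ?thesis
    proof (cases "t \<le> 1/2")
      case True
      define w where "w = (1/2 - t) / (1 - t)"
      have w: "0 \<le> w" "w \<le> 1" using True t01 by (auto simp: w_def divide_simps)
      have w1: "1 - w = (1/2) / (1 - t)" using t01 by (simp add: w_def field_simps)
      have "(1 - w) * (1 - t) = 1/2" using t01 unfolding w1 by simp
      then have eq: "(1 - w) * t + w * 1 = 1/2" by (simp add: algebra_simps)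
      have "(1 - w) * f t \<le> f (1/2)" using conc[OF w, of t 1] f01 unfolding eq by simp
      then have "2 * (1 - t) * ((1 - w) * f t) \<le> 2 * (1 - t) * f (1/2)" using t01 by (intro mult_left_mono) auto
      moreover have "2 * (1 - t) * ((1 - w) * f t) = f t" using t01 by (simp add: w1)
      ultimately have "f t \<le> 2 * (1 - t) * f (1/2)" by (simp only:)
      also have "\<dots> < 2 * f (1/2)" using t01 pos by simp
      finally show ?thesis .
    next
      case F: False
      define w where "w = 1 / (2 * t)"
      have w: "0 \<le> w" "w \<le> 1" using F t01 by (auto simp: w_def divide_simps)
      have eq: "(1 - w) * 0 + w * t = 1/2" using t01 by (simp add: w_def)
      have "w * f t \<le> f (1/2)" using conc[OF w, of 0 t] f01 unfolding eq by simp
      then have "2 * t * (w * f t) \<le> 2 * t * f (1/2)" using t01 by (intro mult_left_mono) auto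
      moreover have "2 * t * (w * f t) = f t" using t01 by (simp add: w_def)
      ultimately have "f t \<le> 2 * t * f (1/2)" by (simp only:)
      also have "\<dots> < 2 * f (1/2)" using t01 pos by simp
      finally show ?thesis .
    qed
  qed
  have "continuous_on {0..1} (\<lambda>t. \<Sum>a<k. \<pi> a * ((1 - t) * u a + t * v a - exp ((1 - t) * ln (u a) + t * ln (v a))))"
    by (intro continuous_intros)
  also have "(\<lambda>t. \<Sum>a<k. \<pi> a * ((1 - t) * u a + t * v a - exp ((1 - t) * ln (u a) + t * ln (v a)))) = f"
    unfolding f_def using u v by (intro ext sum.cong) (auto simp: H_div_eq_exp)
  finally obtain t where t: "t \<in> {0..1}" "\<And>s. s \<in> {0..1} \<Longrightarrow> f s \<le> f t"
    using continuous_attains_sup[of "{0..1::real}" f] by auto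
  have "(SUP t\<in>{0..1}. f t) \<le> f t" by (intro cSUP_least t) auto
  also have "\<dots> < 2 * f (1/2)" using lt t by auto
  finally show ?thesis unfolding half unfolding f_def .
qed

lemma card_blocks: "card (blocks k) = k * (k + 1) div 2"
proof (induction k)
  case 0
  then show ?case by (simp add: blocks_def)
next
  case (Suc k)
  have "blocks (Suc k) = blocks k \<union> (\<lambda>a. (a, k)) ` {..k}" by (auto simp: blocks_def less_Suc_eq)
  moreover have "blocks k \<inter> (\<lambda>a. (a, k)) ` {..k} = {}" by (auto simp: blocks_def)
  ultimately have "card (blocks (Suc k)) = card (blocks k) + (k + 1)"
    by (simp add: card_Un_disjoint card_image inj_on_def)
  then show ?case using Suc by simp
qed

lemma C_const_less:
  assumes k: "k \<ge> 2" and \<pi>: "\<forall>a<k. \<pi> a > 0" and S_sym: "\<forall>a<k. \<forall>b<k. S a b = S b a"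
    and S: "\<forall>a<k. \<forall>b<k. S a b > 0"
    and cols: "\<forall>b<k. \<forall>b'<k. b \<noteq> b' \<longrightarrow> (\<exists>a<k. S a b \<noteq> S a b')"
    and b: "b < k" "b' < k" "b \<noteq> b'"
  shows "C_const k \<pi> S < (\<Sum>a<k. \<pi> a * (sqrt (S a b) - sqrt (S a b'))\<^sup>2)"
proof -
  let ?f = "\<lambda>(b, b'). SUP t\<in>{0..1}. \<Sum>a<k. \<pi> a * H_div t (S a b) (S a b')"
  let ?I = "{(b, b'). b < k \<and> b' < k \<and> b \<noteq> b'}"
  have "finite ?I" by (rule finite_subset[of _ "{..<k} \<times> {..<k}"]) auto
  then have "C_const k \<pi> S \<le> ?f (b, b')"
    unfolding C_const_def using b by (intro Min_le imageI finite_imageI) auto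
  also have "\<dots> < (\<Sum>a<k. \<pi> a * (sqrt (S a b) - sqrt (S a b'))\<^sup>2)"
    unfolding case_prod_conv using assms by (intro SUP_H_div_less) auto
  finally show ?thesis .
qed

subsection \<open>Random labels and consistency\<close>

lemma prob_bind_pmf_le:
  assumes b: "b \<ge> 0" and le: "\<And>x. x \<in> set_pmf M \<Longrightarrow> x \<notin> A \<Longrightarrow> measure_pmf.prob (N x) X \<le> b"
  shows "measure_pmf.prob (bind_pmf M N) X \<le> measure_pmf.prob M A + b"
proof -
  have "emeasure (bind_pmf M N) X = (\<integral>\<^sup>+x. emeasure (N x) X \<partial>M)" by (rule emeasure_bind_pmf)
  also have "\<dots> \<le> (\<integral>\<^sup>+x. indicator A x + ennreal b \<partial>M)"
  proof (rule nn_integral_mono_AE, rule AE_pmfI)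
    fix x assume x: "x \<in> set_pmf M"
    show "emeasure (N x) X \<le> indicator A x + ennreal b"
    proof (cases "x \<in> A")
      case True
      have "emeasure (N x) X \<le> 1 + 0" using measure_pmf.emeasure_le_1 by simp
      also have "\<dots> \<le> 1 + ennreal b" by (intro add_left_mono) simp
      finally show ?thesis using True by simp
    next
      case False
      then show ?thesis using le[OF x False] b
        by (simp add: measure_pmf.emeasure_eq_measure ennreal_leI)
    qed
  qed
  also have "\<dots> = emeasure M A + ennreal b"
    by (simp add: nn_integral_add)
  finally have "ennreal (measure_pmf.prob (bind_pmf M N) X) \<le> ennreal (measure_pmf.prob M A + b)"
    using b by (simp add: measure_pmf.emeasure_eq_measure ennreal_plus)
  then show ?thesis using b by (subst (asm) ennreal_le_iff) auto
qed

definition atypical :: "nat \<Rightarrow> nat \<Rightarrow> (nat \<Rightarrow> real) \<Rightarrow> real \<Rightarrow> (nat \<Rightarrow> nat) set" where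
  "atypical k n \<pi> \<delta> = {z. \<exists>a<k. real (n_cnt n z a) < (\<pi> a - \<delta>) * real n}"

context
  fixes k :: nat and \<pi> :: "nat \<Rightarrow> real"
  assumes \<pi>_pos: "\<forall>a<k. \<pi> a > 0" and \<pi>_sum: "(\<Sum>a<k. \<pi> a) = 1"
begin

lemma pmf_label_pmf: "pmf (label_pmf k \<pi>) a = (if a < k then \<pi> a else 0)"
  unfolding label_pmf_def
proof (rule pmf_embed_pmf)
  have "(\<integral>\<^sup>+x. ennreal (if x < k then \<pi> x else 0) \<partial>count_space UNIV) = (\<Sum>x<k. ennreal (\<pi> x))"
    by (subst nn_integral_count_space'[of "{..<k}"]) auto
  also have "\<dots> = ennreal (\<Sum>x<k. \<pi> x)" using \<pi>_pos by (intro sum_ennreal) (auto simp: less_imp_le)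
  finally show "(\<integral>\<^sup>+x. ennreal (if x < k then \<pi> x else 0) \<partial>count_space UNIV) = 1" by (simp add: \<pi>_sum)
qed (use \<pi>_pos in \<open>auto simp: less_imp_le\<close>)

abbreviation labels_pmf :: "nat \<Rightarrow> (nat \<Rightarrow> nat) pmf" where
  "labels_pmf n \<equiv> Pi_pmf {..<n} 0 (\<lambda>_. label_pmf k \<pi>)"

lemma set_labels_pmf:
  assumes "z \<in> set_pmf (labels_pmf n)"
  shows "z \<in> labelings k n"
proof -
  have z: "z \<in> PiE_dflt {..<n} 0 (set_pmf \<circ> (\<lambda>_. label_pmf k \<pi>))"
    using assms set_Pi_pmf[of "{..<n}" 0 "\<lambda>_. label_pmf k \<pi>"] by simp
  have "a < k" if "a \<in> set_pmf (label_pmf k \<pi>)" for a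
    using that pmf_label_pmf[of a] by (cases "a < k") (auto simp: set_pmf_iff)
  then show ?thesis using z by (simp add: PiE_dflt_def labelings_def)
qed

lemma prob_atypical_le:
  assumes \<delta>: "0 \<le> \<delta>" "\<delta> \<le> 1"
  shows "measure_pmf.prob (labels_pmf n) (atypical k n \<pi> \<delta>) \<le> 2 * real k * exp (- (real n * \<delta>\<^sup>2 / 4))"
proof -
  let ?A = "\<lambda>a. {z. \<bar>real (card {i\<in>{..<n}. z i \<in> {a}}) - (\<Sum>i<n. measure_pmf.prob (label_pmf k \<pi>) {a})\<bar> \<ge> \<delta> * real n}"
  have sum: "(\<Sum>i<n. measure_pmf.prob (label_pmf k \<pi>) {a}) = real n * \<pi> a" if "a < k" for a
    using that by (simp add: measure_pmf_single pmf_label_pmf)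
  have each: "measure_pmf.prob (labels_pmf n) (?A a) \<le> 2 * exp (- (real n * \<delta>\<^sup>2 / 4))" if a: "a \<in> {..<k}" for a
  proof -
    have "\<pi> a \<le> 1" using member_le_sum[of a "{..<k}" \<pi>] \<pi>_pos \<pi>_sum a by (auto simp: less_imp_le)
    have "measure_pmf.prob (labels_pmf n) (?A a) \<le>
        2 * exp ((\<delta> / 2)\<^sup>2 * (\<Sum>i<n. measure_pmf.prob (label_pmf k \<pi>) {a}) - (\<delta> / 2) * (\<delta> * real n))"
      by (rule Pi_pmf_chernoff) (use \<delta> in auto)
    also have "\<dots> = 2 * exp ((\<delta> / 2)\<^sup>2 * (real n * \<pi> a) - (\<delta> / 2) * (\<delta> * real n))" using a by (simp only: sum lessThan_iff)
    also have "(\<delta> / 2)\<^sup>2 * (real n * \<pi> a) \<le> (\<delta> / 2)\<^sup>2 * (real n * 1)"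
      using \<open>\<pi> a \<le> 1\<close> by (intro mult_left_mono) auto
    also have "(\<delta> / 2)\<^sup>2 * (real n * 1) - (\<delta> / 2) * (\<delta> * real n) = - (real n * \<delta>\<^sup>2 / 4)"
      by (simp add: power2_eq_square)
    finally show ?thesis by simp
  qed
  have "atypical k n \<pi> \<delta> \<subseteq> (\<Union>a\<in>{..<k}. ?A a)"
  proof
    fix z assume "z \<in> atypical k n \<pi> \<delta>"
    then obtain a where a: "a < k" "real (n_cnt n z a) < (\<pi> a - \<delta>) * real n" by (auto simp: atypical_def)
    have "{i\<in>{..<n}. z i \<in> {a}} = {i. i < n \<and> z i = a}" by auto
    then have "z \<in> ?A a" unfolding mem_Collect_eq sum[OF a(1)] using a by (simp add: n_cnt_def algebra_simps)
    then show "z \<in> (\<Union>a\<in>{..<k}. ?A a)" using a by blast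
  qed
  then have "measure_pmf.prob (labels_pmf n) (atypical k n \<pi> \<delta>) \<le> measure_pmf.prob (labels_pmf n) (\<Union>a\<in>{..<k}. ?A a)"
    by (intro measure_pmf.finite_measure_mono) auto
  also have "\<dots> \<le> (\<Sum>a\<in>{..<k}. measure_pmf.prob (labels_pmf n) (?A a))"
    by (intro measure_UNION_le) auto
  also have "\<dots> \<le> real (card {..<k}) * (2 * exp (- (real n * \<delta>\<^sup>2 / 4)))"
    using each by (rule sum_bounded_above)
  finally show ?thesis by simp
qed

end

lemma sbm_eq_bind:
  "sbm k \<pi> S \<rho> n = bind_pmf (Pi_pmf {..<n} 0 (\<lambda>_. label_pmf k \<pi>))
     (\<lambda>z. map_pmf (\<lambda>E. (z, adjacency E)) (edge_pmf (node_pairs n) (\<lambda>p. \<rho> * S (z (fst p)) (z (snd p)))))"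
  unfolding sbm_def map_pmf_def adjacency_def node_pairs_def case_prod_unfold ..

lemma mismatch_eq_0I:
  assumes "\<sigma> permutes {..<k}" "\<And>i. i < n \<Longrightarrow> e i = \<sigma> (z i)"
  shows "mismatch k n e z = 0"
proof -
  have "{i. i < n \<and> e i \<noteq> \<sigma> (z i)} = {}" using assms(2) by auto
  then have "card {i. i < n \<and> e i \<noteq> \<sigma> (z i)} = 0" by (simp only: card.empty)
  moreover have "mismatch k n e z \<le> card {i. i < n \<and> e i \<noteq> \<sigma> (z i)}"
    unfolding mismatch_def using assms(1) by (intro Min_le finite_imageI finite_permutations imageI) auto
  ultimately show ?thesis by linarith
qed

lemma error_bound_tendsto_0:
  fixes a b c d K k l :: real
  assumes "a > 0" "b > 0" "c > 0" "d > 0" "K > 0" "l > 0"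
  shows "(\<lambda>n::nat. 2 * k * exp (- (real n * d)) + (2 * K * exp (- (a * ln (real n))) + 2 / real n +
     exp (real n * l + K * ln (real n ^ 2 + 1) + K / 2 * (1 + ln (real n)) - c * (real n * ln (real n))) +
     (exp (k * exp (K / 2 - b * ln (real n))) - 1))) \<longlonglongrightarrow> 0"
proof -
  have 1: "(\<lambda>n::nat. 2 * k * exp (- (real n * d))) \<longlonglongrightarrow> 0" using assms by real_asymp
  have 2: "(\<lambda>n::nat. 2 * K * exp (- (a * ln (real n)))) \<longlonglongrightarrow> 0" using assms by real_asymp
  have 3: "(\<lambda>n::nat. 2 / real n) \<longlonglongrightarrow> 0" by real_asymp
  have 4: "(\<lambda>n::nat. exp (real n * l + K * ln (real n ^ 2 + 1) + K / 2 * (1 + ln (real n)) -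
      c * (real n * ln (real n)))) \<longlonglongrightarrow> 0" using assms by real_asymp
  have 5: "(\<lambda>n::nat. exp (k * exp (K / 2 - b * ln (real n))) - 1) \<longlonglongrightarrow> 0" using assms by real_asymp
  from tendsto_add[OF 1 tendsto_add[OF tendsto_add[OF tendsto_add[OF 2 3] 4] 5]] show ?thesis by simp
qed

lemma sbm_error_le:
  fixes k n :: nat and \<pi> :: "nat \<Rightarrow> real" and S :: "nat \<Rightarrow> nat \<Rightarrow> real"
    and \<rho> \<alpha> s0 s1 cs \<kappa> \<delta> \<gamma> \<tau> d :: real and est :: "(nat \<Rightarrow> nat \<Rightarrow> bool) \<Rightarrow> nat \<Rightarrow> nat"
  assumes k: "k \<ge> 2" and \<pi>_pos: "\<forall>a<k. \<pi> a > 0" and \<pi>_sum: "(\<Sum>a<k. \<pi> a) = 1"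
    and S: "symmetric_pos k S" and S_ge: "\<And>a b. a < k \<Longrightarrow> b < k \<Longrightarrow> s0 \<le> S a b"
    and S_le: "\<And>a b. a < k \<Longrightarrow> b < k \<Longrightarrow> S a b \<le> s1" and s0: "0 < s0"
    and cs: "\<And>b b'. b < k \<Longrightarrow> b' < k \<Longrightarrow> b \<noteq> b' \<Longrightarrow> 2 * cs \<le> (\<Sum>a<k. \<pi> a * (sqrt (S a b) - sqrt (S a b'))\<^sup>2)"
    and \<kappa>: "\<And>b b'. b < k \<Longrightarrow> b' < k \<Longrightarrow> b \<noteq> b' \<Longrightarrow> \<exists>c<k. (sqrt (S b c) - sqrt (S b' c))\<^sup>2 \<ge> \<kappa>" and \<kappa>_pos: "\<kappa> > 0"
    and \<alpha>: "\<alpha> > 0" and \<delta>: "0 < \<delta>" "\<delta> \<le> 1" "\<And>a. a < k \<Longrightarrow> \<alpha> \<le> \<pi> a - \<delta>"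
    and \<gamma>: "\<gamma> > 0" "real k * \<gamma> < \<alpha>" and \<tau>: "\<tau> > 0" and d: "d > 0"
  defines "K \<equiv> card (blocks k)"
  defines "c1 \<equiv> 8 * real K / (\<alpha>\<^sup>2 * s0)" and "\<epsilon> \<equiv> (real k)\<^sup>2 * \<gamma>"
  assumes small: "c1 * \<tau>\<^sup>2 \<le> d / 2" "c1 * \<epsilon> * (2 * s1 + 2 + s1)\<^sup>2 + (\<delta> + \<epsilon>) * (real k * s1) / 2 \<le> d"
    and \<rho>: "0 < \<rho>" "\<rho> * s1 \<le> 1/2" and n: "n \<ge> 2" "\<alpha> * real n \<ge> 2" "\<gamma> * real n \<ge> 2" "\<tau>\<^sup>2 \<le> 4 * s1\<^sup>2 * real n"
    and dense: "ln (real n) \<le> real n * \<rho>" "(1 + real K / 2 + d) * ln (real n) \<le> real n * \<rho> * (cs - d)"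
    and est: "\<And>A. F_set k n \<alpha> \<noteq> {} \<Longrightarrow> est A \<in> F_set k n \<alpha> \<and> (\<forall>e\<in>F_set k n \<alpha>. Q_ICL k n A e \<le> Q_ICL k n A (est A))"
  shows "measure_pmf.prob (sbm k \<pi> S \<rho> n) {(z, A). mismatch k n (est A) z \<noteq> 0} \<le>
    2 * real k * exp (- (real n * (\<delta>\<^sup>2 / 4))) + (2 * real K * exp (- (\<tau>\<^sup>2 / (4 * s1) * ln (real n))) + 2 / real n +
     exp (real n * ln (real k) + real K * ln (real n ^ 2 + 1) + real K / 2 * (1 + ln (real n)) - \<gamma>\<^sup>2 * \<kappa> / 16 * (real n * ln (real n))) +
     (exp (real k * exp (real K / 2 - d / 2 * ln (real n))) - 1))"
    (is "_ \<le> _ + (?B1 + ?B2 + ?B3 + ?B4)")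
proof -
  note Kd = K_def
  define L where "L = ln (real n)"
  have npos: "real n > 0" and L: "L > 0" using n by (auto simp: L_def)
  have s1: "s1 > 0" using S_ge[of 0 0] S_le[of 0 0] s0 k by simp
  let ?B = "?B1 + ?B2 + ?B3 + ?B4"
  let ?X = "{(z, A). mismatch k n (est A) z \<noteq> 0}"
  have B_nonneg: "?B \<ge> 0" by (intro add_nonneg_nonneg) auto
  have cond: "measure_pmf.prob (map_pmf (\<lambda>E. (z, adjacency E)) (edge_pmf (node_pairs n) (\<lambda>p. \<rho> * S (z (fst p)) (z (snd p))))) ?X \<le> ?B"
    if z: "z \<in> labelings k n" "z \<notin> atypical k n \<pi> \<delta>" for z
  proof -
    have typical: "real (n_cnt n z a) \<ge> (\<pi> a - \<delta>) * real n" if "a < k" for a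
    proof (rule ccontr)
      assume "\<not> ?thesis"
      then have "z \<in> atypical k n \<pi> \<delta>" unfolding atypical_def using that by (auto simp only: not_le)
      then show False using z(2) by contradiction
    qed
    have zF: "z \<in> F_set k n \<alpha>"
    proof -
      have "\<alpha> * real n \<le> real (n_cnt n z a)" if "a < k" for a
        using typical[OF that] mult_right_mono[OF \<delta>(3)[OF that], of "real n"] by simp
      then show ?thesis using z(1) by (simp add: F_set_def)
    qed
    interpret sbm_conditional k n S \<rho> \<alpha> s0 s1 z
      by unfold_locales (use S S_ge S_le s0 \<rho> \<alpha> n zF in auto)
    have K: "K = sbm_conditional.K k"
      by (simp add: Kd K_def)
    define l where "l = \<tau> * sqrt L / (2 * s1 * real n * sqrt \<rho>)"
    have l0: "0 \<le> l" using \<tau> L s1 npos \<rho> by (simp add: l_def)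
    have l1: "l \<le> 1"
    proof -
      have "\<tau>\<^sup>2 * L \<le> (4 * s1\<^sup>2 * real n) * (real n * \<rho>)"
        using n(4) dense(1) L \<tau> by (intro mult_mono) (auto simp: L_def)
      then have "(\<tau> * sqrt L)\<^sup>2 \<le> (2 * s1 * real n * sqrt \<rho>)\<^sup>2"
        using L \<rho> by (simp add: power_mult_distrib power2_eq_square[of "real n"])
      then have "\<tau> * sqrt L \<le> 2 * s1 * real n * sqrt \<rho>"
        by (rule power2_le_imp_le) (use s1 npos \<rho> in auto)
      then show ?thesis using s1 npos \<rho> by (simp add: l_def divide_le_eq_1)
    qed
    let ?bad = "{E. \<exists>e\<in>F_set k n \<alpha>. \<not> equiv_labeling e \<and> kt_lik k n E z \<le> kt_lik k n E e}"
    have sub: "(\<lambda>E. (z, adjacency E)) -` ?X \<subseteq> ?bad"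
    proof
      fix E assume "E \<in> (\<lambda>E. (z, adjacency E)) -` ?X"
      then have mis: "mismatch k n (est (adjacency E)) z \<noteq> 0" by simp
      have e: "est (adjacency E) \<in> F_set k n \<alpha>" "Q_ICL k n (adjacency E) z \<le> Q_ICL k n (adjacency E) (est (adjacency E))"
        using est[of "adjacency E"] zF by auto
      have "ln (kt_lik k n E z) \<le> ln (kt_lik k n E (est (adjacency E)))"
        using e(2) npos by (simp add: Q_ICL_adjacency divide_le_cancel)
      then have "kt_lik k n E z \<le> kt_lik k n E (est (adjacency E))" by (simp add: kt_lik_pos)
      moreover have "\<not> equiv_labeling (est (adjacency E))"
      proof
        assume "equiv_labeling (est (adjacency E))"
        then obtain \<sigma> where \<sigma>: "\<sigma> permutes {..<k}" "\<And>i. i < n \<Longrightarrow> est (adjacency E) i = \<sigma> (z i)"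
          unfolding equiv_labeling_def by blast
        show False using mismatch_eq_0I[OF \<sigma>] mis by contradiction
      qed
      ultimately show "E \<in> ?bad" using e(1) by blast
    qed
    have law: "edge_pmf (node_pairs n) (\<lambda>p. \<rho> * S (z (fst p)) (z (snd p))) = edge_law"
      by (rule Pi_pmf_cong) (auto simp: edge_prob_def)
    have "measure_pmf.prob (map_pmf (\<lambda>E. (z, adjacency E)) edge_law) ?X \<le> measure_pmf.prob edge_law ?bad"
      using sub by (simp only: measure_map_pmf) (intro measure_pmf.finite_measure_mono, auto)
    also have "\<dots> \<le>
      real K * (2 * exp (l\<^sup>2 * ((real n)\<^sup>2 * (\<rho> * s1)) - l * (\<tau> * real n * sqrt (\<rho> * L)))) +
      real n * (2 * exp (real n * (\<rho> * s1) - ((2 * s1 + 2) * (real n * \<rho>) - real n * (\<rho> * s1)))) +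
      real k ^ n * (real n ^ 2 + 1) ^ K *
        (sqrt ((exp 1 * real n) ^ K) * exp (- ((\<gamma> * real n) * (\<gamma> * real n - 1) * (\<rho> * \<kappa> / 8)))) +
      ((1 + real k * exp (c1 * \<tau>\<^sup>2 * L + real K / 2 * (1 + L) +
        real n * \<rho> * (c1 * \<epsilon> * (2 * s1 + 2 + s1)\<^sup>2 - cs + (\<delta> + \<epsilon>) * (real k * s1) / 2))) ^ n - 1)"
      (is "_ \<le> ?b1 + ?b2 + ?b3 + ?b4")
      unfolding L_def c1_def \<epsilon>_def K
      by (rule prob_bad_le[where \<pi> = \<pi>]) (use cs \<kappa> typical \<delta> \<gamma> n l0 l1 s1 in auto)
    also have "?b1 \<le> ?B1"
    proof -
      have sr: "sqrt \<rho> > 0" "sqrt \<rho> * sqrt \<rho> = \<rho>" "sqrt L * sqrt L = L" using \<rho> L by auto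
      have "l * (\<tau> * real n * sqrt (\<rho> * L)) = \<tau>\<^sup>2 * (sqrt L * sqrt L) / (2 * s1)"
        using sr s1 npos by (simp add: l_def real_sqrt_mult power2_eq_square)
      moreover have "l\<^sup>2 * ((real n)\<^sup>2 * (\<rho> * s1)) = \<tau>\<^sup>2 * L / (4 * s1)"
      proof -
        have "l\<^sup>2 = \<tau>\<^sup>2 * L / (4 * s1\<^sup>2 * (real n)\<^sup>2 * \<rho>)"
          using L \<rho> by (simp add: l_def power_divide power_mult_distrib)
        then show ?thesis using s1 npos \<rho> by (simp add: power2_eq_square)
      qed
      ultimately have "l\<^sup>2 * ((real n)\<^sup>2 * (\<rho> * s1)) - l * (\<tau> * real n * sqrt (\<rho> * L)) = - (\<tau>\<^sup>2 / (4 * s1) * L)"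
        unfolding sr by simp
      then show ?thesis by (simp add: L_def)
    qed
    also have "?b2 \<le> ?B2"
    proof -
      have "real n * (\<rho> * s1) - ((2 * s1 + 2) * (real n * \<rho>) - real n * (\<rho> * s1)) = - (2 * (real n * \<rho>))"
        by (simp add: algebra_simps)
      then have "?b2 = real n * (2 * exp (- (2 * (real n * \<rho>))))" by (simp only:)
      also have "\<dots> \<le> real n * (2 * exp (- (2 * L)))"
        using dense(1) by (intro mult_left_mono) (auto simp: L_def)
      also have "\<dots> = ?B2"
      proof -
        have "exp (2 * L) = real n * real n" using npos by (simp add: L_def exp_double power2_eq_square)
        then show ?thesis using npos by (simp add: exp_minus field_simps)
      qed
      finally show ?thesis .
    qed
    also have "?b3 \<le> ?B3"
    proof -
      have e1: "real k ^ n = exp (real n * ln (real k))" using k by (simp add: exp_of_nat_mult)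
      have n2: "real n ^ 2 + 1 > 0" by (simp add: add_nonneg_pos)
      have e2: "(real n ^ 2 + 1) ^ K = exp (real K * ln (real n ^ 2 + 1))" using n2 by (simp only: exp_of_nat_mult exp_ln)
      have "(exp 1 * real n) ^ K = exp (real K * (1 + L))" using npos by (simp add: exp_of_nat_mult exp_add L_def)
      also have "\<dots> = (exp (real K / 2 * (1 + L)))\<^sup>2" by (simp add: exp_double[symmetric])
      finally have e3: "sqrt ((exp 1 * real n) ^ K) = exp (real K / 2 * (1 + L))" by simp
      have "\<gamma>\<^sup>2 * \<kappa> / 16 * (real n * L) \<le> \<gamma>\<^sup>2 * \<kappa> / 16 * (real n * (real n * \<rho>))"
        using dense(1) \<kappa>_pos by (intro mult_left_mono) (auto simp: L_def)
      also have "\<dots> = (\<gamma> * real n) * (\<gamma> * real n / 2) * (\<rho> * \<kappa> / 8)"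
        by (simp add: power2_eq_square)
      also have "\<dots> \<le> (\<gamma> * real n) * (\<gamma> * real n - 1) * (\<rho> * \<kappa> / 8)"
        using n(3) \<gamma> \<rho> \<kappa>_pos by (intro mult_right_mono mult_left_mono) auto
      finally show ?thesis unfolding e1 e2 e3 mult_exp_exp exp_le_cancel_iff by (simp add: L_def)
    qed
    also have "?b4 \<le> ?B4"
    proof -
      have expL: "exp L = real n" using npos by (simp add: L_def)
      define x where "x = exp (c1 * \<tau>\<^sup>2 * L + real K / 2 * (1 + L) +
        real n * \<rho> * (c1 * \<epsilon> * (2 * s1 + 2 + s1)\<^sup>2 - cs + (\<delta> + \<epsilon>) * (real k * s1) / 2))"
      have "c1 * \<tau>\<^sup>2 * L \<le> d / 2 * L" using small(1) L by (intro mult_right_mono) auto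
      moreover have "real n * \<rho> * (c1 * \<epsilon> * (2 * s1 + 2 + s1)\<^sup>2 - cs + (\<delta> + \<epsilon>) * (real k * s1) / 2) \<le> real n * \<rho> * (d - cs)"
        using small(2) npos \<rho> by (intro mult_left_mono) auto
      moreover have "real n * \<rho> * (d - cs) \<le> - ((1 + real K / 2 + d) * L)"
        using dense(2) by (simp add: L_def algebra_simps)
      ultimately have "c1 * \<tau>\<^sup>2 * L + real K / 2 * (1 + L) +
        real n * \<rho> * (c1 * \<epsilon> * (2 * s1 + 2 + s1)\<^sup>2 - cs + (\<delta> + \<epsilon>) * (real k * s1) / 2) \<le>
        d / 2 * L + real K / 2 * (1 + L) - (1 + real K / 2 + d) * L" by linarith
      also have "\<dots> = (real K / 2 - d / 2 * L) - L" by (simp add: field_simps)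
      finally have "x \<le> exp ((real K / 2 - d / 2 * L) - L)" unfolding x_def exp_le_cancel_iff .
      also have "\<dots> = exp (real K / 2 - d / 2 * L) / real n"
        unfolding exp_diff[of "real K / 2 - d / 2 * L" L] expL ..
      finally have nx: "real n * x \<le> exp (real K / 2 - d / 2 * L)" using npos by (simp add: field_simps)
      have x0: "x \<ge> 0" by (simp add: x_def)
      have "(1 + real k * x) ^ n \<le> exp (real k * x) ^ n"
        using x0 by (intro power_mono exp_ge_add_one_self) auto
      also have "\<dots> = exp (real k * (real n * x))" by (simp add: exp_of_nat_mult[symmetric] mult_ac)
      also have "\<dots> \<le> exp (real k * exp (real K / 2 - d / 2 * L))"
        using nx by (simp add: mult_left_mono)
      finally show ?thesis by (simp add: x_def L_def)
    qed
    finally show ?thesis unfolding law by simp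
  qed
  have "measure_pmf.prob (sbm k \<pi> S \<rho> n) ?X \<le>
      measure_pmf.prob (Pi_pmf {..<n} 0 (\<lambda>_. label_pmf k \<pi>)) (atypical k n \<pi> \<delta>) + ?B"
    unfolding sbm_eq_bind
    by (rule prob_bind_pmf_le[OF B_nonneg]) (rule cond, use set_labels_pmf[OF \<pi>_pos \<pi>_sum] in auto)
  also have "measure_pmf.prob (Pi_pmf {..<n} 0 (\<lambda>_. label_pmf k \<pi>)) (atypical k n \<pi> \<delta>) \<le>
      2 * real k * exp (- (real n * (\<delta>\<^sup>2 / 4)))"
    using prob_atypical_le[OF \<pi>_pos \<pi>_sum, of \<delta> n] \<delta> by simp
  finally show ?thesis by simp
qed

lemma finite_positive_lower_bound:
  fixes f :: "'a \<Rightarrow> real"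
  assumes "finite A" "\<And>x. x \<in> A \<Longrightarrow> f x > 0"
  shows "\<exists>m>0. \<forall>x\<in>A. m \<le> f x"
proof (cases "A = {}")
  case False
  have "Min (f ` A) > 0" "\<forall>x\<in>A. Min (f ` A) \<le> f x" using assms False by auto
  then show ?thesis by blast
qed (auto intro: exI[of _ 1])

lemma sparse_regime_margin:
  fixes \<rho> :: "nat \<Rightarrow> real" and cs K :: real
  assumes cs: "cs > 0" and K: "K \<ge> 0" and rho: "\<And>n. \<rho> n > 0"
    and regime: "filterlim (\<lambda>n. real n * \<rho> n / ln (real n)) at_top sequentially
      \<or> ((\<forall>\<^sub>F n in sequentially. \<rho> n = ln (real n) / real n) \<and> cs > 1 + K / 2)"
  obtains d where "d > 0" "\<forall>\<^sub>F n in sequentially. ln (real n) \<le> real n * \<rho> n"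
    "\<forall>\<^sub>F n in sequentially. (1 + K / 2 + d) * ln (real n) \<le> real n * \<rho> n * (cs - d)"
  using regime
proof
  assume lim: "filterlim (\<lambda>n. real n * \<rho> n / ln (real n)) at_top sequentially"
  define d where "d = cs / 2"
  have d: "d > 0" using cs by (simp add: d_def)
  define M where "M = max 1 ((1 + K / 2 + d) / d)"
  have ev: "\<forall>\<^sub>F n in sequentially. M * ln (real n) \<le> real n * \<rho> n"
  proof -
    have "\<forall>\<^sub>F n in sequentially. M \<le> real n * \<rho> n / ln (real n)"
      using lim by (simp add: filterlim_at_top)
    moreover have "\<forall>\<^sub>F n in sequentially. n \<ge> 2" by (rule eventually_ge_at_top)
    ultimately show ?thesis
    proof eventually_elim
      case (elim n)
      then have "ln (real n) > 0" by simp
      then show ?case using elim(1) by (simp add: pos_le_divide_eq)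
    qed
  qed
  have ln0: "\<forall>\<^sub>F n in sequentially. ln (real n) \<ge> 0"
    using eventually_ge_at_top[of 1] by eventually_elim simp
  show thesis
  proof (rule that[OF d])
    show "\<forall>\<^sub>F n in sequentially. ln (real n) \<le> real n * \<rho> n" using ev ln0
    proof eventually_elim
      case (elim n)
      have "1 * ln (real n) \<le> M * ln (real n)" using elim(2) by (intro mult_right_mono) (auto simp: M_def)
      then show ?case using elim(1) by simp
    qed
    show "\<forall>\<^sub>F n in sequentially. (1 + K / 2 + d) * ln (real n) \<le> real n * \<rho> n * (cs - d)" using ev ln0
    proof eventually_elim
      case (elim n)
      have "(1 + K / 2 + d) / d * ln (real n) \<le> M * ln (real n)"
        using elim(2) by (intro mult_right_mono) (auto simp: M_def)
      then have "d * ((1 + K / 2 + d) / d * ln (real n)) \<le> d * (real n * \<rho> n)"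
        using elim(1) d by (intro mult_left_mono) auto
      moreover have "d * ((1 + K / 2 + d) / d * ln (real n)) = (1 + K / 2 + d) * ln (real n)" using d by simp
      moreover have "cs - d = d" by (simp add: d_def)
      ultimately show ?case by (simp only: mult.commute)
    qed
  qed
next
  assume crit: "(\<forall>\<^sub>F n in sequentially. \<rho> n = ln (real n) / real n) \<and> cs > 1 + K / 2"
  define d where "d = (cs - 1 - K / 2) / 2"
  have d: "d > 0" using crit by (simp add: d_def)
  have ev: "\<forall>\<^sub>F n in sequentially. real n * \<rho> n = ln (real n)"
    using crit[THEN conjunct1] eventually_gt_at_top[of 0] by eventually_elim simp
  have eq: "1 + K / 2 + d = cs - d" by (simp add: d_def field_simps)
  show thesis
  proof (rule that[OF d])
    show "\<forall>\<^sub>F n in sequentially. ln (real n) \<le> real n * \<rho> n" using ev by eventually_elim simp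
    show "\<forall>\<^sub>F n in sequentially. (1 + K / 2 + d) * ln (real n) \<le> real n * \<rho> n * (cs - d)"
      using ev by eventually_elim (simp add: eq mult.commute)
  qed
qed

theorem theorem3:
  fixes k :: nat and \<pi> :: "nat \<Rightarrow> real" and S :: "nat \<Rightarrow> nat \<Rightarrow> real"
    and \<rho> :: "nat \<Rightarrow> real" and \<alpha> :: real
    and est :: "nat \<Rightarrow> (nat \<Rightarrow> nat \<Rightarrow> bool) \<Rightarrow> (nat \<Rightarrow> nat)"
  assumes k2: "k \<ge> 2"
    and pi_pos: "\<forall>a<k. \<pi> a > 0"
    and pi_sum: "(\<Sum>a<k. \<pi> a) = 1"
    and S_sym: "\<forall>a<k. \<forall>b<k. S a b = S b a"
    and S_pos: "\<forall>a<k. \<forall>b<k. S a b > 0"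
    and S_cols: "\<forall>b<k. \<forall>b'<k. b \<noteq> b' \<longrightarrow> (\<exists>a<k. S a b \<noteq> S a b')"
    and rho_pos: "\<forall>n. \<rho> n > 0"
    and rho_0: "\<rho> \<longlonglongrightarrow> 0"
    and regime: "filterlim (\<lambda>n. real n * \<rho> n / ln (real n)) at_top sequentially
                 \<or> ((\<forall>\<^sub>F n in sequentially. \<rho> n = ln (real n) / real n)
                    \<and> C_const k \<pi> S \<ge> 1 + (real k)\<^sup>2)"
    and alpha_pos: "0 < \<alpha>"
    and alpha_lt: "\<forall>a<k. \<alpha> < \<pi> a"
    and est_max: "\<forall>n A. F_set k n \<alpha> \<noteq> {} \<longrightarrow>
                    est n A \<in> F_set k n \<alpha> \<and>
                    (\<forall>e\<in>F_set k n \<alpha>. Q_ICL k n A e \<le> Q_ICL k n A (est n A))"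
  shows "(\<lambda>n. measure_pmf.prob (sbm k \<pi> S (\<rho> n) n)
                {(z, A). mismatch k n (est n A) z = 0}) \<longlonglongrightarrow> 1"
proof -
  let ?P = "{..<k} \<times> {..<k}"
  have S: "symmetric_pos k S" using S_sym S_pos by (auto simp: symmetric_pos_def)
  obtain s0 where s0: "s0 > 0" "\<And>a b. a < k \<Longrightarrow> b < k \<Longrightarrow> s0 \<le> S a b"
    using finite_positive_lower_bound[of ?P "\<lambda>(a, b). S a b"] S_pos by fastforce
  define s1 where "s1 = Max ((\<lambda>(a, b). S a b) ` ?P)"
  have s1: "S a b \<le> s1" if "a < k" "b < k" for a b
  proof -
    have "S a b \<in> (\<lambda>(a, b). S a b) ` ?P" using that by force
    then show ?thesis unfolding s1_def by (intro Max_ge) auto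
  qed
  have s1_pos: "s1 > 0" using s1[of 0 0] s0(2)[of 0 0] s0(1) k2 by simp
  obtain \<kappa> where \<kappa>: "\<kappa> > 0" "\<And>b b' c. b < k \<Longrightarrow> b' < k \<Longrightarrow> c < k \<Longrightarrow> S b c \<noteq> S b' c \<Longrightarrow> \<kappa> \<le> (sqrt (S b c) - sqrt (S b' c))\<^sup>2"
  proof -
    let ?T = "{(b, b', c). b < k \<and> b' < k \<and> c < k \<and> S b c \<noteq> S b' c}"
    have fin: "finite ?T" by (rule finite_subset[of _ "{..<k} \<times> {..<k} \<times> {..<k}"]) auto
    have "\<exists>m>0. \<forall>x\<in>?T. m \<le> (case x of (b, b', c) \<Rightarrow> (sqrt (S b c) - sqrt (S b' c))\<^sup>2)"
      by (rule finite_positive_lower_bound[OF fin]) auto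
    then obtain m where m: "m > 0" "\<forall>x\<in>?T. m \<le> (case x of (b, b', c) \<Rightarrow> (sqrt (S b c) - sqrt (S b' c))\<^sup>2)"
      by blast
    show ?thesis
    proof (rule that[OF m(1)])
      fix b b' c assume "b < k" "b' < k" "c < k" "S b c \<noteq> S b' c"
      then have "(b, b', c) \<in> ?T" by simp
      from m(2)[rule_format, OF this] show "m \<le> (sqrt (S b c) - sqrt (S b' c))\<^sup>2" by simp
    qed
  qed
  have \<kappa>': "\<exists>c<k. (sqrt (S b c) - sqrt (S b' c))\<^sup>2 \<ge> \<kappa>" if b: "b < k" "b' < k" "b \<noteq> b'" for b b'
  proof -
    obtain c where "c < k" "S c b \<noteq> S c b'" using S_cols b by blast
    then show ?thesis using \<kappa>(2)[of b b' c] S_sym b by auto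
  qed
  define G where "G = (\<lambda>b b'. \<Sum>a<k. \<pi> a * (sqrt (S a b) - sqrt (S a b'))\<^sup>2)"
  have G: "G b b' > max 0 (C_const k \<pi> S)" if b: "b < k" "b' < k" "b \<noteq> b'" for b b'
  proof -
    obtain c where c: "c < k" "S c b \<noteq> S c b'" using S_cols b by blast
    have "0 < G b b'" unfolding G_def
      by (rule sum_pos2[of _ c]) (use c pi_pos in \<open>auto simp: less_imp_le\<close>)
    moreover have "C_const k \<pi> S < G b b'"
      unfolding G_def by (rule C_const_less[OF k2 pi_pos S_sym S_pos S_cols b])
    ultimately show ?thesis by simp
  qed
  obtain m where m: "m > 0" "\<And>b b'. b < k \<Longrightarrow> b' < k \<Longrightarrow> b \<noteq> b' \<Longrightarrow> m \<le> G b b' - max 0 (C_const k \<pi> S)"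
  proof -
    let ?T = "{(b, b'). b < k \<and> b' < k \<and> b \<noteq> b'}"
    have fin: "finite ?T" by (rule finite_subset[of _ ?P]) auto
    have "\<exists>m>0. \<forall>x\<in>?T. m \<le> (case x of (b, b') \<Rightarrow> G b b' - max 0 (C_const k \<pi> S))"
      by (rule finite_positive_lower_bound[OF fin]) (use G in auto)
    then obtain m where m: "m > 0" "\<forall>x\<in>?T. m \<le> (case x of (b, b') \<Rightarrow> G b b' - max 0 (C_const k \<pi> S))"
      by blast
    show ?thesis
    proof (rule that[OF m(1)])
      fix b b' assume "b < k" "b' < k" "b \<noteq> b'"
      then have "(b, b') \<in> ?T" by simp
      from m(2)[rule_format, OF this] show "m \<le> G b b' - max 0 (C_const k \<pi> S)" by simp
    qed
  qed
  define cs where "cs = (m + max 0 (C_const k \<pi> S)) / 2"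
  have cs_pos: "cs > 0" and cs_C: "cs > C_const k \<pi> S / 2" using m(1) by (auto simp: cs_def)
  have cs: "2 * cs \<le> (\<Sum>a<k. \<pi> a * (sqrt (S a b) - sqrt (S a b'))\<^sup>2)" if "b < k" "b' < k" "b \<noteq> b'" for b b'
    using m(2)[OF that] by (simp add: cs_def G_def)
  define K where "K = card (blocks k)"
  have K: "real K = real k * (real k + 1) / 2"
  proof -
    have "2 * K = k * (k + 1)" unfolding K_def card_blocks by simp
    then have "2 * real K = real k * (real k + 1)" by (metis of_nat_1 of_nat_add of_nat_mult of_nat_numeral)
    then show ?thesis by simp
  qed
  have K_pos: "real K > 0" using k2 by (simp add: K)
  have crit: "1 + real K / 2 < cs" if "C_const k \<pi> S \<ge> 1 + (real k)\<^sup>2"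
  proof -
    have "0 \<le> (real k - 2) * (real k + 1)" using k2 by simp
    then have "real k + 2 \<le> (real k)\<^sup>2" by (simp add: power2_eq_square algebra_simps)
    moreover have "real k * (real k + 1) = (real k)\<^sup>2 + real k" by (simp add: power2_eq_square algebra_simps)
    ultimately have "1 + real K / 2 \<le> (1 + (real k)\<^sup>2) / 2"
      unfolding K by (simp add: field_simps)
    also have "\<dots> \<le> C_const k \<pi> S / 2" using that by (rule divide_right_mono) simp
    also note cs_C
    finally show ?thesis .
  qed
  obtain d where d: "d > 0" "\<forall>\<^sub>F n in sequentially. ln (real n) \<le> real n * \<rho> n"
    "\<forall>\<^sub>F n in sequentially. (1 + real K / 2 + d) * ln (real n) \<le> real n * \<rho> n * (cs - d)"
    by (rule sparse_regime_margin[of cs "real K" \<rho>]) (use cs_pos rho_pos regime crit in auto)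
  define c1 where "c1 = 8 * real K / (\<alpha>\<^sup>2 * s0)"
  have c1: "c1 > 0" using K_pos alpha_pos s0 by (simp add: c1_def)
  define \<tau> where "\<tau> = sqrt (d / (2 * c1))"
  have \<tau>: "\<tau> > 0" "c1 * \<tau>\<^sup>2 \<le> d / 2" using d(1) c1 by (auto simp: \<tau>_def)
  obtain m' where m': "m' > 0" "\<And>a. a < k \<Longrightarrow> m' \<le> \<pi> a - \<alpha>"
    using finite_positive_lower_bound[of "{..<k}" "\<lambda>a. \<pi> a - \<alpha>"] alpha_lt by auto
  have ks: "real k * s1 > 0" using k2 s1_pos by simp
  define \<delta> where "\<delta> = min 1 (min m' (d / (real k * s1)))"
  have \<delta>: "0 < \<delta>" "\<delta> \<le> 1" "\<delta> \<le> m'" "\<delta> \<le> d / (real k * s1)" using m'(1) d(1) ks by (auto simp: \<delta>_def)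
  have \<delta>\<alpha>: "\<alpha> \<le> \<pi> a - \<delta>" if "a < k" for a using m'(2)[OF that] \<delta>(3) by simp
  define W where "W = (real k)\<^sup>2 * (c1 * (2 * s1 + 2 + s1)\<^sup>2 + real k * s1 / 2)"
  have W: "W > 0" unfolding W_def using k2 c1 ks by (intro mult_pos_pos add_nonneg_pos) auto
  define \<gamma> where "\<gamma> = min (\<alpha> / (2 * real k)) (d / (2 * W))"
  have \<gamma>: "\<gamma> > 0" "\<gamma> \<le> \<alpha> / (2 * real k)" "\<gamma> \<le> d / (2 * W)"
    using alpha_pos k2 d(1) W by (auto simp: \<gamma>_def)
  have \<gamma>\<alpha>: "real k * \<gamma> < \<alpha>"
  proof -
    have "real k * \<gamma> \<le> real k * (\<alpha> / (2 * real k))" using \<gamma>(2) by (intro mult_left_mono) auto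
    also have "\<dots> = \<alpha> / 2" using k2 by simp
    finally show ?thesis using alpha_pos by simp
  qed
  have small: "c1 * ((real k)\<^sup>2 * \<gamma>) * (2 * s1 + 2 + s1)\<^sup>2 + (\<delta> + (real k)\<^sup>2 * \<gamma>) * (real k * s1) / 2 \<le> d"
  proof -
    have "W * \<gamma> \<le> W * (d / (2 * W))" using \<gamma>(3) W by (intro mult_left_mono) auto
    then have "W * \<gamma> \<le> d / 2" using W by simp
    moreover have "\<delta> * (real k * s1) / 2 \<le> d / 2"
      using \<delta>(4) pos_le_divide_eq[OF ks] by (simp add: divide_right_mono)
    moreover have "c1 * ((real k)\<^sup>2 * \<gamma>) * (2 * s1 + 2 + s1)\<^sup>2 + (\<delta> + (real k)\<^sup>2 * \<gamma>) * (real k * s1) / 2 =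
        W * \<gamma> + \<delta> * (real k * s1) / 2"
      unfolding W_def by (simp add: algebra_simps add_divide_distrib)
    ultimately show ?thesis by simp
  qed
  define U where "U = (\<lambda>n::nat. 2 * real k * exp (- (real n * (\<delta>\<^sup>2 / 4))) +
     (2 * real K * exp (- (\<tau>\<^sup>2 / (4 * s1) * ln (real n))) + 2 / real n +
     exp (real n * ln (real k) + real K * ln (real n ^ 2 + 1) + real K / 2 * (1 + ln (real n)) - \<gamma>\<^sup>2 * \<kappa> / 16 * (real n * ln (real n))) +
     (exp (real k * exp (real K / 2 - d / 2 * ln (real n))) - 1)))"
  have U: "U \<longlonglongrightarrow> 0"
    unfolding U_def using \<tau>(1) s1_pos d(1) \<gamma>(1) \<kappa>(1) \<delta>(1) K_pos k2 by (intro error_bound_tendsto_0) auto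
  have large: "\<forall>\<^sub>F n in sequentially. c \<le> x * real n" if "x > 0" for c x :: real
    using that by real_asymp
  have "(\<lambda>n. \<rho> n * s1) \<longlonglongrightarrow> 0 * s1" by (intro tendsto_mult rho_0 tendsto_const)
  then have rho_s1: "\<forall>\<^sub>F n in sequentially. \<rho> n * s1 < 1/2" by (intro order_tendstoD(2)) auto
  have s1_sq: "4 * s1\<^sup>2 > 0" using s1_pos by simp
  have lower: "\<forall>\<^sub>F n in sequentially. 1 - U n \<le> measure_pmf.prob (sbm k \<pi> S (\<rho> n) n) {(z, A). mismatch k n (est n A) z = 0}"
    using d(2) d(3) rho_s1 large[OF alpha_pos, of 2] large[OF \<gamma>(1), of 2]
      large[OF s1_sq, of "\<tau>\<^sup>2"] eventually_ge_at_top[of 2]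
  proof eventually_elim
    case (elim n)
    have "measure_pmf.prob (sbm k \<pi> S (\<rho> n) n) {(z, A). mismatch k n (est n A) z \<noteq> 0} \<le> U n"
      unfolding U_def K_def
      by (rule sbm_error_le[OF k2 pi_pos pi_sum S s0(2) s1 s0(1) cs \<kappa>' \<kappa>(1) alpha_pos \<delta>(1,2) \<delta>\<alpha> \<gamma>(1) \<gamma>\<alpha> \<tau>(1) d(1)])
        (use elim \<tau>(2) small rho_pos est_max in \<open>auto simp: c1_def K_def\<close>)
    moreover have "- {(z, A). mismatch k n (est n A) z = 0} = {(z, A). mismatch k n (est n A) z \<noteq> 0}" by auto
    moreover have "measure_pmf.prob (sbm k \<pi> S (\<rho> n) n) (- {(z, A). mismatch k n (est n A) z = 0}) =
        1 - measure_pmf.prob (sbm k \<pi> S (\<rho> n) n) {(z, A). mismatch k n (est n A) z = 0}"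
      using measure_pmf.prob_compl[of "{(z, A). mismatch k n (est n A) z = 0}" "sbm k \<pi> S (\<rho> n) n"] by (simp add: Compl_eq_Diff_UNIV)
    ultimately show ?case by simp
  qed
  show ?thesis
  proof (rule tendsto_sandwich[OF lower])
    show "\<forall>\<^sub>F n in sequentially. measure_pmf.prob (sbm k \<pi> S (\<rho> n) n) {(z, A). mismatch k n (est n A) z = 0} \<le> 1"
      by simp
    show "(\<lambda>n. 1 - U n) \<longlonglongrightarrow> 1" using tendsto_diff[OF tendsto_const U, of 1] by simp
  qed simp
qed

end
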